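(* Let $K_1,K_2\subset\mathbb{R}$ be regular Cantor sets of class $C^{1+\alpha}$, $\alpha>0$, such that $d=\mathrm{HD}(K_1)+\mathrm{HD}(K_2)>1$. For $\theta\in\mathbb{R}$ let $\mu_\theta=(\mathrm{proj}_\theta)_*(m_d|_{K_1\times K_2})$ be the push-forward to $L_\theta$ of the restriction of $m_d$ to $K_1\times K_2$. Then for $m$-almost every $\theta\in\mathbb{R}$ the Radon–Nikodym derivative $\chi_\theta=d\mu_\theta/dm$ is an $L^2$ function on $L_\theta$ with respect to $m$.
   Context: $\mathrm{HD}$ denotes Hausdorff dimension and $m_d$ is the $d$-dimensional Hausdorff measure, $m_d(K)=\lim_{\varepsilon\to0}\inf\sum_{U\in\mathcal{U}}|U|^d$, the infimum being over (countable) covers $\mathcal{U}$ of $K$ by sets of diameter less than $\varepsilon$, with $|U|$ the diameter of $U$. $m$ denotes Lebesgue measure on $\mathbb{R}$, and also on any line in $\mathbb{R}^2$ through the origin (identified isometrically with $\mathbb{R}$). For $\theta\in\mathbb{R}$, $v_\theta=(\cos\theta,\sin\theta)$, $L_\theta$ is the line in $\mathbb{R}^2$ through the origin containing $v_\theta$, and $\mathrm{proj}_\theta:\mathbb{R}^2\to L_\theta$ is the orthogonal projection. The derivative $\chi_\theta$ is defined for those $\theta$ for which $\mu_\theta$ is absolutely continuous with respect to $m$; this holds for $m$-almost every $\theta$. Regular Cantor sets: $K\subset\mathbb{R}$ is a regular Cantor set of class $C^{1+\alpha}$, $\alpha>0$, if: (i) there are disjoint compact (nondegenerate) intervals $I_1,\dots,I_r\subseteq[0,1]$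 such that $K\subset I_1\cup\cdots\cup I_r$ and the boundary of each $I_i$ is contained in $K$; (ii) there is a $C^{1+\alpha}$ expanding map $\psi$ ($|\psi'|>1$) defined in a neighbourhood of $I_1\cup\cdots\cup I_r$ such that each $\psi(I_i)$ is the convex hull of a finite union of some of the intervals $I_j$, and such that (ii.1) for each $i\in\{1,\dots,r\}$ and all $n$ sufficiently big, $\psi^n(K\cap I_i)=K$; (ii.2) $K=\bigcap_{n\in\mathbb{N}}\psi^{-n}(I_1\cup\cdots\cup I_r)$, that is, $K$ is the set of points all of whose iterates under $\psi$ remain in $I_1\cup\cdots\cup I_r$. *)

theory Defs
  imports "HOL-Analysis.Analysis"
begin

section \<open>Hausdorff measure and Hausdorff dimension\<close>

text \<open>The conventions for \<open>|U|\<^sup>d\<close> are the usual ones: the empty set contributes 0 and, in dimension 0,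
  every nonempty set contributes 1 (whereas \<open>0 powr 0 = 0\<close>).\<close>

definition diam_power :: "real \<Rightarrow> 'a::metric_space set \<Rightarrow> ennreal" where
  "diam_power d U = (if U = {} then 0 else if d = 0 then 1 else ennreal (diameter U powr d))"

text \<open>Countable covers are indexed by the natural numbers; finite covers are padded with empty sets.
  Boundedness is required since \<^const>\<open>diameter\<close> has no meaning for unbounded sets.\<close>

definition small_covers :: "real \<Rightarrow> 'a::metric_space set \<Rightarrow> (nat \<Rightarrow> 'a set) set" where
  "small_covers \<epsilon> K = {U. K \<subseteq> (\<Union>i. U i) \<and> (\<forall>i. bounded (U i) \<and> diameter (U i) < \<epsilon>)}"

definition hausdorff_pre :: "real \<Rightarrow> real \<Rightarrow> 'a::metric_space set \<Rightarrow> ennreal" where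
  "hausdorff_pre d \<epsilon> K = (INF U\<in>small_covers \<epsilon> K. \<Sum>i. diam_power d (U i))"

definition hausdorff_outer :: "real \<Rightarrow> 'a::metric_space set \<Rightarrow> ennreal" where
  "hausdorff_outer d K = Lim (at_right 0) (\<lambda>\<epsilon>. hausdorff_pre d \<epsilon> K)"

text \<open>Lemma \<open>emeasure_hausdorff_measure\<close> below shows that on Borel sets this measure is indeed
  \<^const>\<open>hausdorff_outer\<close>.\<close>

definition hausdorff_measure :: "real \<Rightarrow> 'a::metric_space measure" where
  "hausdorff_measure d = measure_of UNIV (sets borel) (hausdorff_outer d)"

text \<open>In a Euclidean space the infimum is over a nonempty set, as it contains every \<open>s > DIM('a)\<close>.\<close>

definition hausdorff_dim :: "'a::euclidean_space set \<Rightarrow> real" where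
  "hausdorff_dim K = Inf {s. 0 \<le> s \<and> hausdorff_outer s K = 0}"


subsection \<open>The Hausdorff measure is well defined\<close>

lemma hausdorff_pre_antimono: "\<epsilon> \<le> \<epsilon>' \<Longrightarrow> hausdorff_pre d \<epsilon>' K \<le> hausdorff_pre d \<epsilon> K"
  unfolding hausdorff_pre_def
  by (rule INF_superset_mono) (simp_all add: small_covers_def subset_iff, meson less_le_trans)

lemma hausdorff_pre_tendsto_SUP:
  "((\<lambda>\<epsilon>. hausdorff_pre d \<epsilon> K) \<longlongrightarrow> (SUP \<epsilon>\<in>{0<..}. hausdorff_pre d \<epsilon> K)) (at_right 0)"
proof (rule order_tendstoI)
  fix a assume "a < (SUP \<epsilon>\<in>{0<..}. hausdorff_pre d \<epsilon> K)"
  then obtain e where e: "e > 0" "a < hausdorff_pre d e K"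
    by (auto simp: less_SUP_iff)
  have "\<forall>\<^sub>F \<epsilon> in at_right 0. \<epsilon> \<in> {0<..<e}"
    using e(1) by (rule eventually_at_right_real)
  then show "\<forall>\<^sub>F \<epsilon> in at_right 0. a < hausdorff_pre d \<epsilon> K"
  proof eventually_elim
    case (elim \<epsilon>)
    then show ?case
      using hausdorff_pre_antimono[of \<epsilon> e d K] e(2) by (auto elim: less_le_trans)
  qed
next
  fix a assume a: "(SUP \<epsilon>\<in>{0<..}. hausdorff_pre d \<epsilon> K) < a"
  have "\<forall>\<^sub>F \<epsilon> in at_right (0::real). \<epsilon> \<in> {0<..<1}"
    by (rule eventually_at_right_real) simp
  then show "\<forall>\<^sub>F \<epsilon> in at_right 0. hausdorff_pre d \<epsilon> K < a"
    by eventually_elim (rule le_less_trans[OF SUP_upper a], simp)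
qed

lemma hausdorff_outer_eq_SUP: "hausdorff_outer d K = (SUP \<epsilon>\<in>{0<..}. hausdorff_pre d \<epsilon> K)"
  unfolding hausdorff_outer_def
  by (intro tendsto_Lim hausdorff_pre_tendsto_SUP) simp

lemma hausdorff_pre_tendsto:
  "((\<lambda>\<epsilon>. hausdorff_pre d \<epsilon> K) \<longlongrightarrow> hausdorff_outer d K) (at_right 0)"
  unfolding hausdorff_outer_eq_SUP by (rule hausdorff_pre_tendsto_SUP)

lemma hausdorff_pre_le_outer: "\<epsilon> > 0 \<Longrightarrow> hausdorff_pre d \<epsilon> K \<le> hausdorff_outer d K"
  unfolding hausdorff_outer_eq_SUP by (rule SUP_upper) simp

lemma hausdorff_pre_empty: "\<epsilon> > 0 \<Longrightarrow> hausdorff_pre d \<epsilon> {} = 0"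
  unfolding hausdorff_pre_def
  by (rule antisym, rule INF_lower2[of "\<lambda>_. {}"]) (auto simp: small_covers_def diam_power_def)

lemma hausdorff_pre_mono: "A \<subseteq> B \<Longrightarrow> hausdorff_pre d \<epsilon> A \<le> hausdorff_pre d \<epsilon> B"
  unfolding hausdorff_pre_def
  by (rule INF_superset_mono) (auto simp: small_covers_def)

lemma hausdorff_outer_mono: "A \<subseteq> B \<Longrightarrow> hausdorff_outer d A \<le> hausdorff_outer d B"
  unfolding hausdorff_outer_eq_SUP by (rule SUP_mono') (rule hausdorff_pre_mono)

lemma hausdorff_pre_countably_subadditive:
  "hausdorff_pre d \<epsilon> (\<Union>n. A n) \<le> (\<Sum>n::nat. hausdorff_pre d \<epsilon> (A n))"
proof (rule ennreal_le_epsilon)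
  fix e :: real assume fin: "(\<Sum>n. hausdorff_pre d \<epsilon> (A n)) < top" and e: "0 < e"
  have "\<exists>U\<in>small_covers \<epsilon> (A n). (\<Sum>i. diam_power d (U i))
            \<le> hausdorff_pre d \<epsilon> (A n) + e * (1/2)^Suc n" for n
  proof -
    have "hausdorff_pre d \<epsilon> (A n) < top"
      using fin ennreal_suminf_lessD by blast
    then have "hausdorff_pre d \<epsilon> (A n) < hausdorff_pre d \<epsilon> (A n) + ennreal (e * (1/2)^Suc n)"
      using e by (simp add: ennreal_add_left_cancel_less[of _ 0, simplified])
    then show ?thesis
      unfolding hausdorff_pre_def[of d \<epsilon> "A n"] by (auto simp: INF_less_iff intro: less_imp_le)
  qed
  then obtain U where U: "\<And>n. U n \<in> small_covers \<epsilon> (A n)"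
    and le: "\<And>n. (\<Sum>i. diam_power d (U n i)) \<le> hausdorff_pre d \<epsilon> (A n) + e * (1/2)^Suc n"
    by metis
  let ?V = "\<lambda>k. case prod_decode k of (n, i) \<Rightarrow> U n i"
  have "?V \<in> small_covers \<epsilon> (\<Union>n. A n)"
    unfolding small_covers_def
  proof safe
    fix x n assume "x \<in> A n"
    then obtain i where "x \<in> U n i" using U[of n] by (auto simp: small_covers_def)
    then show "x \<in> (\<Union>k. ?V k)" by (intro UN_I[of "prod_encode (n, i)"]) auto
  qed (use U in \<open>auto simp: small_covers_def split: prod.split\<close>)
  then have "hausdorff_pre d \<epsilon> (\<Union>n. A n) \<le> (\<Sum>k. diam_power d (?V k))"
    unfolding hausdorff_pre_def by (rule INF_lower)
  also have "\<dots> = (\<Sum>k. case_prod (\<lambda>n i. diam_power d (U n i)) (prod_decode k))"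
    by (simp add: case_prod_beta)
  also have "\<dots> = (\<Sum>n. \<Sum>i. diam_power d (U n i))"
    by (rule suminf_ennreal_2dimen) simp
  also have "\<dots> \<le> (\<Sum>n. hausdorff_pre d \<epsilon> (A n) + ennreal (e * (1/2)^Suc n))"
    by (intro suminf_le le) auto
  also have "\<dots> = (\<Sum>n. hausdorff_pre d \<epsilon> (A n)) + (\<Sum>n. ennreal (e * (1/2)^Suc n))"
    by (rule suminf_add[symmetric]) auto
  also have "(\<Sum>n. ennreal (e * (1/2)^Suc n)) = ennreal e"
  proof (rule suminf_ennreal_eq)
    show "(\<lambda>n. e * (1/2)^Suc n) sums e"
      using sums_mult[OF power_half_series, of e] by simp
  qed (use e in auto)
  finally show "hausdorff_pre d \<epsilon> (\<Union>n. A n) \<le> (\<Sum>n. hausdorff_pre d \<epsilon> (A n)) + ennreal e" .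
qed

lemma hausdorff_outer_countably_subadditive:
  "hausdorff_outer d (\<Union>n. A n) \<le> (\<Sum>n::nat. hausdorff_outer d (A n))"
  unfolding hausdorff_outer_eq_SUP[of d "\<Union>n. A n"]
proof (rule SUP_least)
  fix \<epsilon> :: real assume "\<epsilon> \<in> {0<..}"
  then have "(\<Sum>n. hausdorff_pre d \<epsilon> (A n)) \<le> (\<Sum>n. hausdorff_outer d (A n))"
    by (intro suminf_le hausdorff_pre_le_outer) auto
  then show "hausdorff_pre d \<epsilon> (\<Union>n. A n) \<le> (\<Sum>n. hausdorff_outer d (A n))"
    using hausdorff_pre_countably_subadditive order_trans by blast
qed

lemma outer_measure_space_hausdorff_outer: "outer_measure_space UNIV (hausdorff_outer d)"
  unfolding outer_measure_space_def
proof (intro conjI)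
  show "positive UNIV (hausdorff_outer d)"
    unfolding positive_def hausdorff_outer_eq_SUP by (simp add: hausdorff_pre_empty)
qed (auto simp: increasing_def countably_subadditive_def hausdorff_outer_mono
      hausdorff_outer_countably_subadditive)

lemma hausdorff_outer_subadditive:
  "hausdorff_outer d (A \<union> B) \<le> hausdorff_outer d A + hausdorff_outer d B"
proof -
  interpret sigma_algebra UNIV "UNIV :: 'a set set"
    using sigma_algebra_Pow[of UNIV] by simp
  have "subadditive (UNIV :: 'a set set) (hausdorff_outer d)"
    using outer_measure_space_hausdorff_outer[of d]
    by (auto simp: outer_measure_space_def intro: countably_subadditive_subadditive)
  then have "hausdorff_outer d (A \<union> (B - A)) \<le> hausdorff_outer d A + hausdorff_outer d (B - A)"
    by (intro subadditiveD) auto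
  also have "\<dots> \<le> hausdorff_outer d A + hausdorff_outer d B"
    by (intro add_left_mono hausdorff_outer_mono) auto
  finally show ?thesis by simp
qed

lemma ennreal_suminf_tail_tendsto:
  fixes f :: "nat \<Rightarrow> ennreal"
  assumes fin: "(\<Sum>k. f k) < top"
  shows "(\<lambda>n. \<Sum>k. f (k + n)) \<longlonglongrightarrow> 0"
proof -
  have f: "f k < top" for k
    using fin ennreal_suminf_lessD by blast
  define g where "g k = enn2real (f k)" for k
  have fg: "f k = ennreal (g k)" and g: "g k \<ge> 0" for k
    using f[of k] by (auto simp: g_def)
  have sg: "summable g"
    using fin g unfolding fg by (intro summable_suminf_not_top) auto
  have "(\<lambda>n. ennreal (\<Sum>k. g (k + n))) \<longlonglongrightarrow> ennreal 0"
    by (intro tendsto_ennrealI suminf_exist_split2 sg)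
  moreover have "(\<Sum>k. f (k + n)) = ennreal (\<Sum>k. g (k + n))" for n
    unfolding fg using sg g by (intro suminf_ennreal2) (auto simp: summable_iff_shift)
  ultimately show ?thesis by simp
qed

lemma hausdorff_outer_separated:
  assumes \<delta>: "\<delta> > 0" and sep: "\<And>x y. x \<in> A \<Longrightarrow> y \<in> B \<Longrightarrow> \<delta> \<le> dist x y"
  shows "hausdorff_outer d A + hausdorff_outer d B \<le> hausdorff_outer d (A \<union> B)"
proof -
  have *: "hausdorff_pre d \<epsilon> A + hausdorff_pre d \<epsilon> B \<le> hausdorff_pre d \<epsilon> (A \<union> B)"
    if \<epsilon>: "0 < \<epsilon>" "\<epsilon> < \<delta>" for \<epsilon>
    unfolding hausdorff_pre_def[of d \<epsilon> "A \<union> B"]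
  proof (rule INF_greatest)
    fix U assume U: "U \<in> small_covers \<epsilon> (A \<union> B)"
    define V where "V S i = (if U i \<inter> S = {} then {} else U i)" for S i
    have V: "V S \<in> small_covers \<epsilon> S" if "S \<subseteq> A \<union> B" for S
      using U that \<epsilon> by (fastforce simp: small_covers_def V_def)
    have "diam_power d (V A i) + diam_power d (V B i) \<le> diam_power d (U i)" for i
    proof (cases "U i \<inter> A = {} \<or> U i \<inter> B = {}")
      case True
      then show ?thesis by (auto simp: V_def diam_power_def)
    next
      case False
      then obtain x y where xy: "x \<in> U i" "x \<in> A" "y \<in> U i" "y \<in> B" by blast
      have "dist x y \<le> diameter (U i)"
        using U xy by (intro diameter_bounded_bound) (auto simp: small_covers_def)
      also have "\<dots> < \<epsilon>" using U by (simp add: small_covers_def)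
      also note \<open>\<epsilon> < \<delta>\<close>
      finally show ?thesis using sep[OF xy(2,4)] by simp
    qed
    then have "(\<Sum>i. diam_power d (V A i)) + (\<Sum>i. diam_power d (V B i)) \<le> (\<Sum>i. diam_power d (U i))"
      by (subst suminf_add) (auto intro!: suminf_le)
    moreover have "hausdorff_pre d \<epsilon> A \<le> (\<Sum>i. diam_power d (V A i))"
      "hausdorff_pre d \<epsilon> B \<le> (\<Sum>i. diam_power d (V B i))"
      unfolding hausdorff_pre_def by (auto intro!: INF_lower V)
    ultimately show "hausdorff_pre d \<epsilon> A + hausdorff_pre d \<epsilon> B \<le> (\<Sum>i. diam_power d (U i))"
      using add_mono order_trans by blast
  qed
  have ev: "\<forall>\<^sub>F \<epsilon> in at_right 0. hausdorff_pre d \<epsilon> A + hausdorff_pre d \<epsilon> B \<le> hausdorff_pre d \<epsilon> (A \<union> B)"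
    using eventually_at_right_real[OF \<delta>] by eventually_elim (use * in auto)
  show ?thesis
    by (rule tendsto_le[OF _ hausdorff_pre_tendsto tendsto_add[OF hausdorff_pre_tendsto hausdorff_pre_tendsto] ev])
       simp
qed

text \<open>Caratheodory's criterion: closed sets are measurable for the outer measure.\<close>

lemma closed_in_lambda_system_hausdorff_outer:
  assumes "closed C"
  shows "C \<in> lambda_system UNIV UNIV (hausdorff_outer d)"
proof -
  let ?\<phi> = "hausdorff_outer d"
  have sub: "?\<phi> (X \<union> Y) \<le> ?\<phi> X + ?\<phi> Y" for X Y
    by (rule hausdorff_outer_subadditive)
  have "?\<phi> (A \<inter> C) + ?\<phi> (A - C) \<le> ?\<phi> A" for A
  proof (cases "?\<phi> A = top \<or> C = {}")
    case True
    moreover have "?\<phi> {} = 0"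
      using outer_measure_space_hausdorff_outer[of d] by (auto simp: outer_measure_space_def positive_def)
    ultimately show ?thesis by auto
  next
    case False
    then have finA: "?\<phi> A < top" and "C \<noteq> {}" by (auto simp: top.not_eq_extremum)
    define f where "f x = infdist x C" for x
    have lip: "f x - f y \<le> dist x y" for x y
      unfolding f_def using infdist_triangle[of x C y] by (simp add: algebra_simps)
    have pos: "f x > 0 \<longleftrightarrow> x \<notin> C" for x
      unfolding f_def using in_closed_iff_infdist_zero[OF \<open>closed C\<close> \<open>C \<noteq> {}\<close>] infdist_nonneg[of x C]
      by (metis less_irrefl order_le_less)
    define R where "R n = {x\<in>A. 1 / real (n+2) \<le> f x \<and> f x < 1 / real (n+1)}" for n
    define E where "E n = {x\<in>A. 1 / real (n+1) \<le> f x}" for n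
    have R_sum: "(\<Sum>k. ?\<phi> (R (2*k + j))) \<le> ?\<phi> A" for j
    proof (rule suminf_le_const[OF summableI])
      fix n
      have "(\<Sum>k<n. ?\<phi> (R (2*k + j))) \<le> ?\<phi> (\<Union>k<n. R (2*k + j))"
      proof (induction n)
        case 0
        then show ?case by simp
      next
        case (Suc n)
        have "?\<phi> (\<Union>k<n. R (2*k + j)) + ?\<phi> (R (2*n + j)) \<le> ?\<phi> ((\<Union>k<n. R (2*k + j)) \<union> R (2*n + j))"
        proof (rule hausdorff_outer_separated)
          show "(if 2*n+j > 0 then 1 / real (2*n+j) - 1 / real (2*n+j+1) else 1) > 0"
            by (simp add: frac_less2)
        next
          fix x y assume "x \<in> (\<Union>k<n. R (2*k + j))" "y \<in> R (2*n + j)"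
          then obtain k where k: "k < n" "x \<in> R (2*k+j)" by auto
          have "1 / real (2*n+j) \<le> 1 / real (2*k+j+2)"
            using k(1) by (intro divide_left_mono) auto
          also have "\<dots> \<le> f x" using k(2) by (simp add: R_def algebra_simps)
          finally have "1 / real (2*n+j) - 1 / real (2*n+j+1) \<le> f x - f y"
            using \<open>y \<in> R (2*n + j)\<close> by (simp add: R_def algebra_simps)
          then show "(if 2*n+j > 0 then 1 / real (2*n+j) - 1 / real (2*n+j+1) else 1) \<le> dist x y"
            using lip[of x y] k(1) by auto
        qed
        then have "?\<phi> (\<Union>k<n. R (2*k + j)) + ?\<phi> (R (2*n + j)) \<le> ?\<phi> (\<Union>k<Suc n. R (2*k + j))"
          by (simp add: lessThan_Suc Un_commute)
        from order_trans[OF add_right_mono[OF Suc] this] show ?case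
          by simp
      qed
      also have "\<dots> \<le> ?\<phi> A" by (rule hausdorff_outer_mono) (auto simp: R_def)
      finally show "(\<Sum>k<n. ?\<phi> (R (2*k + j))) \<le> ?\<phi> A" .
    qed
    define T where "T n j = (\<Sum>k. ?\<phi> (R (2*(k+n) + j)))" for n j
    have T_lim: "(\<lambda>n. T n j) \<longlonglongrightarrow> 0" for j
    proof -
      have "(\<Sum>k. ?\<phi> (R (2*k + j))) < top"
        using R_sum[of j] finA by (rule le_less_trans)
      then show ?thesis unfolding T_def by (rule ennreal_suminf_tail_tendsto)
    qed
    have main: "?\<phi> (A \<inter> C) + ?\<phi> (A - C) \<le> ?\<phi> A + (T n 0 + T n 1)" for n
    proof -
      have "A - C \<subseteq> E (2*n) \<union> ((\<Union>k. R (2*(k+n) + 0)) \<union> (\<Union>k. R (2*(k+n) + 1)))"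
      proof
        fix x assume x: "x \<in> A - C"
        then have fx: "f x > 0" using pos by auto
        show "x \<in> E (2*n) \<union> ((\<Union>k. R (2*(k+n) + 0)) \<union> (\<Union>k. R (2*(k+n) + 1)))"
        proof (cases "x \<in> E (2*n)")
          case False
          define m where "m = (LEAST m. 1 / real (m+1) \<le> f x)"
          have ex: "\<exists>m. 1 / real (m+1) \<le> f x"
            using reals_Archimedean[OF fx] by (auto simp: field_simps intro: less_imp_le)
          have m1: "1 / real (m+1) \<le> f x" unfolding m_def using ex by (rule LeastI_ex)
          have m2: "\<not> 1 / real (l+1) \<le> f x" if "l < m" for l
            using that unfolding m_def by (rule not_less_Least)
          have "m > 2*n"
          proof (rule ccontr)
            assume "\<not> m > 2*n"
            then have "1 / real (2*n+1) \<le> 1 / real (m+1)" by (intro divide_left_mono) auto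
            with m1 False x show False by (auto simp: E_def)
          qed
          then obtain l where l: "m = Suc l" "2*n \<le> l" by (cases m) auto
          have "x \<in> R l" using m1 m2[of l] l x by (auto simp: R_def)
          moreover have "\<exists>k. l = 2*(k+n) \<or> l = 2*(k+n)+1" using l(2) by presburger
          ultimately show ?thesis by auto
        qed auto
      qed
      then have "?\<phi> (A - C) \<le> ?\<phi> (E (2*n) \<union> ((\<Union>k. R (2*(k+n) + 0)) \<union> (\<Union>k. R (2*(k+n) + 1))))"
        by (rule hausdorff_outer_mono)
      also have "\<dots> \<le> ?\<phi> (E (2*n)) + (?\<phi> (\<Union>k. R (2*(k+n) + 0)) + ?\<phi> (\<Union>k. R (2*(k+n) + 1)))"
        by (rule order_trans[OF sub add_left_mono[OF sub]])
      also have "\<dots> \<le> ?\<phi> (E (2*n)) + (T n 0 + T n 1)"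
        unfolding T_def by (intro add_left_mono add_mono hausdorff_outer_countably_subadditive)
      finally have 1: "?\<phi> (A - C) \<le> ?\<phi> (E (2*n)) + (T n 0 + T n 1)" .
      have "?\<phi> (A \<inter> C) + ?\<phi> (E (2*n)) \<le> ?\<phi> ((A \<inter> C) \<union> E (2*n))"
      proof (rule hausdorff_outer_separated)
        fix x y assume "x \<in> A \<inter> C" "y \<in> E (2*n)"
        then have "f x = 0" "1 / real (2*n+1) \<le> f y" by (auto simp: f_def E_def)
        then show "1 / real (2*n+1) \<le> dist x y" using lip[of y x] by (simp add: dist_commute)
      qed simp
      also have "\<dots> \<le> ?\<phi> A" by (rule hausdorff_outer_mono) (auto simp: E_def)
      finally have "?\<phi> (A \<inter> C) + ?\<phi> (E (2*n)) + (T n 0 + T n 1) \<le> ?\<phi> A + (T n 0 + T n 1)"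
        by (rule add_right_mono)
      with add_left_mono[OF 1, of "?\<phi> (A \<inter> C)"] show ?thesis
        unfolding add.assoc by (rule order_trans)
    qed
    have "(\<lambda>n. ?\<phi> A + (T n 0 + T n 1)) \<longlonglongrightarrow> ?\<phi> A + (0 + 0)"
      by (intro tendsto_add tendsto_const T_lim)
    then show ?thesis
      using main by (intro LIMSEQ_le_const) auto
  qed
  moreover have "?\<phi> A \<le> ?\<phi> (A \<inter> C) + ?\<phi> (A - C)" for A
    using sub[of "A \<inter> C" "A - C"] by (simp add: Int_Diff_Un)
  ultimately have "?\<phi> (A \<inter> C) + ?\<phi> (A - C) = ?\<phi> A" for A
    by (intro antisym)
  moreover have "- C \<inter> A = A - C" for A by auto
  ultimately show ?thesis
    by (simp add: lambda_system_def Compl_eq_Diff_UNIV[symmetric] Int_commute)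
qed

lemma measure_space_hausdorff_outer: "measure_space UNIV (sets borel) (hausdorff_outer d)"
proof -
  interpret sigma_algebra UNIV "UNIV :: 'a set set"
    using sigma_algebra_Pow[of UNIV] by simp
  have L: "measure_space UNIV (lambda_system UNIV UNIV (hausdorff_outer d)) (hausdorff_outer d :: 'a set \<Rightarrow> _)"
    by (rule caratheodory_lemma[OF outer_measure_space_hausdorff_outer])
  then have sa: "sigma_algebra UNIV (lambda_system UNIV UNIV (hausdorff_outer d :: 'a set \<Rightarrow> _))"
    by (simp add: measure_space_def)
  have "S \<in> lambda_system UNIV UNIV (hausdorff_outer d)" if "open S" for S :: "'a set"
    using lambda_system_Compl[OF closed_in_lambda_system_hausdorff_outer[of "- S" d]] that
    by (simp add: closed_def Compl_eq_Diff_UNIV[symmetric])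
  then have "sigma_sets UNIV {S :: 'a set. open S} \<subseteq> lambda_system UNIV UNIV (hausdorff_outer d)"
    by (intro sigma_algebra.sigma_sets_subset[OF sa]) auto
  then have "sets (borel :: 'a measure) \<subseteq> lambda_system UNIV UNIV (hausdorff_outer d)"
    by (simp add: borel_def)
  with L show ?thesis
    by (rule measure_down[OF _ sets.sigma_algebra_axioms[of borel, simplified]])
qed

lemma space_hausdorff_measure [simp]: "space (hausdorff_measure d) = UNIV"
  by (simp add: hausdorff_measure_def space_measure_of_conv)

lemma sets_hausdorff_measure [simp, measurable_cong]: "sets (hausdorff_measure d) = sets borel"
  unfolding hausdorff_measure_def by (metis sets.sets_measure_of_eq space_borel)

lemma emeasure_hausdorff_measure:
  assumes "A \<in> sets borel"
  shows "emeasure (hausdorff_measure d) A = hausdorff_outer d A"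
  using assms measure_space_hausdorff_outer[of d]
  by (intro emeasure_measure_of[OF hausdorff_measure_def]) (auto simp: measure_space_def)


section \<open>Regular Cantor sets\<close>

text \<open>Write \<open>1 + \<alpha> = k + \<beta>\<close> with \<open>k\<close> a positive integer and \<open>0 < \<beta> \<le> 1\<close>. A map of class \<open>C\<^bsup>1+\<alpha>\<^esup>\<close> on an open set
  is \<open>k\<close> times differentiable with locally \<open>\<beta>\<close>-Hoelder (so continuous) \<open>k\<close>-th derivative. For
  \<open>0 < \<alpha> \<le> 1\<close> this says that the first derivative is locally \<open>\<alpha>\<close>-Hoelder.\<close>

definition C_one_plus :: "real \<Rightarrow> real set \<Rightarrow> (real \<Rightarrow> real) \<Rightarrow> bool" where
  "C_one_plus \<alpha> U f \<longleftrightarrow>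
     (let k = nat \<lceil>\<alpha>\<rceil>; \<beta> = 1 + \<alpha> - real k in
        (\<forall>j<k. \<forall>x\<in>U. (deriv ^^ j) f differentiable at x) \<and>
        (\<forall>S. compact S \<and> S \<subseteq> U \<longrightarrow>
           (\<exists>c. \<forall>x\<in>S. \<forall>y\<in>S. \<bar>(deriv ^^ k) f x - (deriv ^^ k) f y\<bar> \<le> c * \<bar>x - y\<bar> powr \<beta>)))"

text \<open>The intervals are \<open>I\<^sub>i = {a i..b i}\<close> for \<open>i < r\<close>. The map \<open>\<psi>\<close> is a total function of which only the
  values on the neighbourhood \<open>U\<close> matter: an orbit that stays in the intervals never uses others.\<close>

definition regular_cantor_set :: "real \<Rightarrow> real set \<Rightarrow> bool" where
  "regular_cantor_set \<alpha> K \<longleftrightarrow>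
     (\<exists>(r::nat) (a::nat \<Rightarrow> real) (b::nat \<Rightarrow> real) (U::real set) (\<psi>::real \<Rightarrow> real).
        let I = (\<lambda>i. {a i..b i}); \<I> = (\<Union>i<r. I i) in
          1 \<le> r \<and>
          (\<forall>i<r. a i < b i \<and> I i \<subseteq> {0..1}) \<and>
          disjoint_family_on I {..<r} \<and>
          K \<subseteq> \<I> \<and>
          (\<forall>i<r. frontier (I i) \<subseteq> K) \<and>
          open U \<and> \<I> \<subseteq> U \<and>
          C_one_plus \<alpha> U \<psi> \<and>
          (\<forall>x\<in>U. \<bar>deriv \<psi> x\<bar> > 1) \<and>
          (\<forall>i<r. \<exists>J\<subseteq>{..<r}. \<psi> ` I i = convex hull (\<Union>j\<in>J. I j)) \<and>
          (\<forall>i<r. \<forall>\<^sub>F n in sequentially. (\<psi> ^^ n) ` (K \<inter> I i) = K) \<and>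
          K = (\<Inter>n. (\<psi> ^^ n) -` \<I>))"


section \<open>Projections onto lines through the origin\<close>

definition dir_vec :: "real \<Rightarrow> real \<times> real" where
  "dir_vec \<theta> = (cos \<theta>, sin \<theta>)"

definition line :: "real \<Rightarrow> (real \<times> real) set" where
  "line \<theta> = span {dir_vec \<theta>}"

definition proj :: "real \<Rightarrow> real \<times> real \<Rightarrow> real \<times> real" where
  "proj \<theta> x = (x \<bullet> dir_vec \<theta>) *\<^sub>R dir_vec \<theta>"

lemma norm_dir_vec [simp]: "norm (dir_vec \<theta>) = 1"
  by (simp add: dir_vec_def norm_Pair)

lemma proj_orthogonal:
  shows "proj \<theta> x \<in> line \<theta>" and "y \<in> line \<theta> \<Longrightarrow> orthogonal (x - proj \<theta> x) y"
proof -
  show "proj \<theta> x \<in> line \<theta>"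
    by (simp add: proj_def line_def span_mul span_base)
  have "dir_vec \<theta> \<bullet> dir_vec \<theta> = 1"
    by (simp add: dot_square_norm)
  then show "orthogonal (x - proj \<theta> x) y" if "y \<in> line \<theta>"
    using that by (auto simp: line_def span_singleton proj_def orthogonal_def inner_diff_left)
qed

text \<open>Lebesgue measure on the line, transported by the isometry \<open>t \<mapsto> t v\<^sub>\<theta>\<close>.\<close>

definition lebesgue_line :: "real \<Rightarrow> (real \<times> real) measure" where
  "lebesgue_line \<theta> = distr lborel (restrict_space borel (line \<theta>)) (\<lambda>t. t *\<^sub>R dir_vec \<theta>)"

definition proj_measure :: "real \<Rightarrow> (real \<times> real) set \<Rightarrow> real \<Rightarrow> (real \<times> real) measure" where
  "proj_measure d S \<theta> =
     distr (restrict_space (hausdorff_measure d) S) (restrict_space borel (line \<theta>)) (proj \<theta>)"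

definition square_integrable :: "'a measure \<Rightarrow> ('a \<Rightarrow> ennreal) \<Rightarrow> bool" where
  "square_integrable M f \<longleftrightarrow> f \<in> borel_measurable M \<and> (\<integral>\<^sup>+ x. (f x)\<^sup>2 \<partial>M) < \<infinity>"

end

theory Submission
  imports Defs
begin

text \<open>Only an upper bound on the Hausdorff measure is needed. By bounded distortion, every ball of radius
  \<open>r\<close> centred on a regular Cantor set \<open>K\<close> contains the image of \<open>K\<close> under a map that multiplies distances
  by at least a constant times \<open>r\<close>; by Falconer's implicit argument this bounds the cardinality of separated
  sets in \<open>K\<close> by the power of the scale given by \<open>HD K\<close>, and, expanding small balls to unit size, also
  inside every ball. Covering by products of balls gives \<open>\<mu> (cball z r) \<le> C r\<^sup>d\<close> for the restriction \<open>\<mu>\<close> of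
  \<open>m\<^sub>d\<close> to \<open>K1 \<times> K2\<close>, so the energy \<open>\<integral>\<integral> 1 / dist x y\<close> is finite as \<open>d > 1\<close>. The set of \<open>\<theta>\<close> in a bounded interval
  with \<open>\<bar>z \<bullet> v\<^sub>\<theta>\<bar> \<le> \<eta>\<close> has measure \<open>O(\<eta> / norm z)\<close>. By Fubini and Fatou, the correlations
  \<open>(1 / 2r) (\<nu> \<times> \<nu>) {(s, t). \<bar>s - t\<bar> \<le> 2r}\<close> of the projection \<open>\<nu>\<close> of \<open>\<mu>\<close> are therefore bounded along a sequence
  \<open>r \<rightarrow> 0\<close> for almost every \<open>\<theta>\<close>. Averaging over intervals of radius \<open>r\<close>, one gets
  \<open>\<integral> g d\<nu> \<le> \<integral> g\<^sup>2 + M\<close> for lower semicontinuous \<open>g \<ge> 0\<close>; open neighbourhoods of null sets give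
  absolute continuity, and approximations of the truncated density give square integrability.\<close>

section \<open>Separated sets and Hausdorff dimension\<close>

text \<open>Two obstacles shape the first half. \<open>hausdorff_dim\<close> only says that
  \<open>hausdorff_outer t K\<close> vanishes for t above the dimension s, and for general sets the
  dimension of a product may exceed the sum of the dimensions. Both are met by counting separated
  points with the exponent s itself; a count with a larger exponent would leave a negative power of
  the mesh and would not bound the measure of the product. The exact exponent is available because a
  violation of the count at s is a strict inequality: it persists at some t > s, where it forces
  \<open>hausdorff_outer t K\<close> to be positive. The kernel 1 / dist is dictated by the
  projections: the measure of the directions nearly orthogonal to z, divided by the width of the
  strip, is of order 1 / norm z. In the second half, absolute continuity cannot be presupposed. A
  bound on correlations is a quadratic bound on averages of \<nu>, so it is turned by duality into a
  linear inequality between integrals of test functions, which makes sense for a singular \<nu> as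
  well.\<close>

lemma powr_ge_powr_less_one: "0 \<le> x \<Longrightarrow> x \<le> 1 \<Longrightarrow> s \<le> t \<Longrightarrow> x powr t \<le> x powr (s::real)"
  by (cases "x = 0") (auto intro: powr_mono')

text \<open>For covers by sets of diameter below 1 every term decreases as the exponent grows.
  Larger scales follow since \<open>hausdorff_pre\<close> is antitone in the scale.\<close>

lemma hausdorff_outer_zero_mono:
  assumes "hausdorff_outer s K = 0" "0 \<le> s" "s \<le> t"
  shows "hausdorff_outer t K = 0"
proof -
  have "hausdorff_pre t \<epsilon> K \<le> 0" if \<epsilon>: "0 < \<epsilon>" for \<epsilon>
  proof -
    have "hausdorff_pre t (min 1 \<epsilon>) K \<le> hausdorff_pre s (min 1 \<epsilon>) K"
      unfolding hausdorff_pre_def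
    proof (rule INF_mono)
      fix U assume U: "U \<in> small_covers (min 1 \<epsilon>) K"
      have "diam_power t (U i) \<le> diam_power s (U i)" for i
      proof -
        have "bounded (U i)" "diameter (U i) < 1" using U by (auto simp: small_covers_def)
        then show ?thesis
          using assms powr_ge_powr_less_one[of "diameter (U i)" s t] diameter_ge_0[of "U i"]
          by (auto simp: diam_power_def powr_le1 intro!: ennreal_leI)
      qed
      then show "\<exists>V\<in>small_covers (min 1 \<epsilon>) K. (\<Sum>i. diam_power t (V i)) \<le> (\<Sum>i. diam_power s (U i))"
        using U by (intro bexI[of _ U] suminf_le) auto
    qed
    also have "\<dots> \<le> 0"
      using hausdorff_pre_le_outer[of "min 1 \<epsilon>" s K] assms \<epsilon> by simp
    finally show ?thesis
      using hausdorff_pre_antimono[of "min 1 \<epsilon>" \<epsilon> t K] by simp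
  qed
  then show ?thesis unfolding hausdorff_outer_eq_SUP by simp
qed

text \<open>About m intervals of length 1 / m cost at most 2 / m in exponent 2. This shows that the
  infimum defining \<open>hausdorff_dim\<close> is over a nonempty set.\<close>

lemma hausdorff_outer_2_zero:
  assumes "K \<subseteq> {0..1::real}" shows "hausdorff_outer 2 K = 0"
proof -
  have "hausdorff_pre 2 \<epsilon> K \<le> 0" if \<epsilon>: "0 < \<epsilon>" for \<epsilon>
  proof (rule ennreal_le_epsilon)
    fix e :: real assume e: "0 < e"
    obtain m where m: "2 / min \<epsilon> e < real m" using reals_Archimedean2 by blast
    moreover have "2 / min \<epsilon> e > 0" using \<epsilon> e by simp
    ultimately have m0: "m > 0" by (metis less_trans of_nat_0_less_iff)
    \<comment> \<open>The index i = m is included for the point x = 1, whose floor at mesh 1 / m is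
      m.\<close>
    define U where "U i = (if i \<le> m then {real i / m..(real i + 1) / m} else {})" for i
    have diam: "diameter (U i) = (if i \<le> m then 1 / m else 0)" for i
      using m0 by (auto simp: U_def diameter_closed_interval field_simps)
    have "2 / m < min \<epsilon> e" using m m0 \<epsilon> e by (simp add: field_simps del: min_less_iff_conj)
    then have "2 / m < \<epsilon>" and sm2: "2 / m < e" by simp_all
    moreover have "1 / m \<le> 2 / m" by (simp add: divide_right_mono)
    ultimately have sm: "1 / m < \<epsilon>" "2 / m < e" by linarith+
    have "U \<in> small_covers \<epsilon> K"
      unfolding small_covers_def
    proof safe
      fix x assume "x \<in> K"
      then have x: "0 \<le> x" "x \<le> 1" using assms by auto
      have "0 \<le> x * m" using x by simp
      then have "real (nat \<lfloor>x * m\<rfloor>) \<le> x * m \<and> x * m \<le> real (nat \<lfloor>x * m\<rfloor>) + 1" by linarith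
      moreover have "nat \<lfloor>x * m\<rfloor> \<le> m" using x m0
        by (metis floor_mono floor_of_nat mult_left_le_one_le nat_int nat_mono of_nat_0_le_iff)
      ultimately show "x \<in> (\<Union>i. U i)"
        using m0 by (intro UN_I[of "nat \<lfloor>x * m\<rfloor>"]) (auto simp: U_def field_simps)
    next
      fix i show "bounded (U i)" by (auto simp: U_def)
      show "diameter (U i) < \<epsilon>" using diam[of i] sm \<epsilon> by auto
    qed
    then have "hausdorff_pre 2 \<epsilon> K \<le> (\<Sum>i. diam_power 2 (U i))"
      unfolding hausdorff_pre_def by (rule INF_lower)
    also have "\<dots> = (\<Sum>i\<le>m. diam_power 2 (U i))"
      by (rule suminf_finite) (auto simp: U_def diam_power_def)
    also have "\<dots> \<le> (\<Sum>i\<le>m. ennreal ((1/m)^2))"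
      by (intro sum_mono) (auto simp: diam_power_def diam powr_numeral)
    also have "\<dots> = ennreal ((m + 1) * (1/m)^2)" by (simp add: ennreal_mult ennreal_of_nat_eq_real_of_nat del: ennreal_plus)
    also have "\<dots> \<le> ennreal e"
    proof (rule ennreal_leI)
      have "(m + 1) * (1/m)^2 \<le> 2 * m * (1/m)^2" using m0 by (intro mult_right_mono) auto
      also have "\<dots> = 2 / m" using m0 by (simp add: power2_eq_square)
      finally show "(m + 1) * (1/m)^2 \<le> e" using sm by simp
    qed
    finally show "hausdorff_pre 2 \<epsilon> K \<le> 0 + ennreal e" by simp
  qed
  then show ?thesis unfolding hausdorff_outer_eq_SUP by simp
qed

lemma hausdorff_dim_nonneg:
  assumes "K \<subseteq> {0..1::real}" shows "0 \<le> hausdorff_dim K"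
  unfolding hausdorff_dim_def
  using hausdorff_outer_2_zero[OF assms] by (intro cInf_greatest) (auto intro: exI[of _ 2])

text \<open>The infimum need not be attained, so vanishing is available only strictly above the
  dimension.\<close>

lemma hausdorff_outer_above_dim:
  assumes "K \<subseteq> {0..1::real}" "hausdorff_dim K < t" shows "hausdorff_outer t K = 0"
proof -
  have "\<exists>s\<in>{s. 0 \<le> s \<and> hausdorff_outer s K = 0}. s < t"
    using assms hausdorff_outer_2_zero[OF assms(1)] unfolding hausdorff_dim_def
    by (subst cInf_less_iff[symmetric]) (auto intro: exI[of _ 2])
  then show ?thesis using hausdorff_outer_zero_mono[of _ K t] by auto
qed

section \<open>Positivity of Hausdorff measure from expanding copies\<close>

text \<open>Descent on the number of covering sets. If the sum is below \<open>\<delta> powr t\<close>, every covering set meets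
  at most one of the images \<open>g j ` K\<close>; pulling back the sets that meet the cheapest image gives a cover
  of \<open>K\<close> by strictly fewer sets whose sum has not increased.\<close>

lemma diam_descent:
  fixes K :: "'a::real_normed_vector set" and g :: "'b \<Rightarrow> 'a \<Rightarrow> 'a"
  assumes "K \<noteq> {}" "finite J" "2 \<le> card J" "0 < \<kappa>" "0 < \<delta>" "0 < t" "1 \<le> card J * \<kappa> powr t"
    and g: "\<And>j x. j \<in> J \<Longrightarrow> x \<in> K \<Longrightarrow> g j x \<in> K"
    and ex: "\<And>j x y. j \<in> J \<Longrightarrow> x \<in> K \<Longrightarrow> y \<in> K \<Longrightarrow> \<kappa> * dist x y \<le> dist (g j x) (g j y)"
    and sep: "\<And>i j x y. i \<in> J \<Longrightarrow> j \<in> J \<Longrightarrow> i \<noteq> j \<Longrightarrow> x \<in> K \<Longrightarrow> y \<in> K \<Longrightarrow> \<delta> \<le> dist (g i x) (g j y)"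
    and "finite A" "\<And>i. i \<in> A \<Longrightarrow> bounded (U i)" "K \<subseteq> (\<Union>i\<in>A. U i)"
  shows "\<delta> powr t \<le> (\<Sum>i\<in>A. diameter (U i) powr t)"
  using \<open>finite A\<close> assms(12,13)
proof (induction A arbitrary: U rule: finite_psubset_induct)
  case (psubset A)
  show ?case
  proof (rule ccontr)
    assume neg: "\<not> \<delta> powr t \<le> (\<Sum>i\<in>A. diameter (U i) powr t)"
    have small: "diameter (U i) < \<delta>" if "i \<in> A" for i
    proof -
      have "diameter (U i) powr t \<le> (\<Sum>i\<in>A. diameter (U i) powr t)"
        by (rule member_le_sum) (use that psubset in auto)
      then have "diameter (U i) powr t < \<delta> powr t" using neg by simp
      then show ?thesis
        using \<open>0 < t\<close> \<open>0 < \<delta>\<close> by (meson not_le powr_mono2 less_imp_le)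
    qed
    define B where "B j = {i\<in>A. U i \<inter> g j ` K \<noteq> {}}" for j
    have BA: "B j \<subseteq> A" for j by (auto simp: B_def)
    have disj: "B i \<inter> B j = {}" if ij: "i \<in> J" "j \<in> J" "i \<noteq> j" for i j
    proof (rule ccontr)
      assume "B i \<inter> B j \<noteq> {}"
      then obtain k x y where k: "k \<in> A" "x \<in> K" "y \<in> K" "g i x \<in> U k" "g j y \<in> U k"
        by (auto simp: B_def)
      have "dist (g i x) (g j y) \<le> diameter (U k)"
        using psubset.prems k by (intro diameter_bounded_bound) auto
      then show False using sep[OF ij k(2,3)] small[OF k(1)] by simp
    qed
    have Bne: "B j \<noteq> {}" if "j \<in> J" for j
    proof -
      obtain x where "x \<in> K" using assms by auto
      then show ?thesis using g[OF that] psubset.prems by (fastforce simp: B_def)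
    qed
    \<comment> \<open>Pigeonhole: the families \<open>B j\<close> are disjoint parts of A, so the
      cheapest one costs at most the average.\<close>
    have "\<exists>j\<in>J. card J * (\<Sum>i\<in>B j. diameter (U i) powr t) \<le> (\<Sum>i\<in>A. diameter (U i) powr t)"
    proof (rule ccontr)
      assume c: "\<not> ?thesis"
      have Jne: "J \<noteq> {}" using \<open>2 \<le> card J\<close> by auto
      have "card J * (\<Sum>i\<in>A. diameter (U i) powr t) = (\<Sum>j\<in>J. \<Sum>i\<in>A. diameter (U i) powr t)" by simp
      also have "\<dots> < (\<Sum>j\<in>J. card J * (\<Sum>i\<in>B j. diameter (U i) powr t))"
        using c \<open>finite J\<close> Jne by (intro sum_strict_mono) auto
      also have "\<dots> = card J * (\<Sum>j\<in>J. \<Sum>i\<in>B j. diameter (U i) powr t)" by (simp add: sum_distrib_left)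
      also have "(\<Sum>j\<in>J. \<Sum>i\<in>B j. diameter (U i) powr t) = (\<Sum>i\<in>(\<Union>j\<in>J. B j). diameter (U i) powr t)"
        using \<open>finite J\<close> disj finite_subset[OF BA psubset.hyps(1)] by (intro sum.UNION_disjoint[symmetric]) auto
      also have "\<dots> \<le> (\<Sum>i\<in>A. diameter (U i) powr t)"
        using psubset.hyps BA by (intro sum_mono2) auto
      finally show False by (simp add: mult_left_mono)
    qed
    then obtain j where j: "j \<in> J" "card J * (\<Sum>i\<in>B j. diameter (U i) powr t) \<le> (\<Sum>i\<in>A. diameter (U i) powr t)"
      by auto
    obtain j' where j': "j' \<in> J" "j' \<noteq> j"
    proof -
      have "J \<noteq> {j}" using \<open>2 \<le> card J\<close> by auto
      then show ?thesis using j(1) that by blast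
    qed
    \<comment> \<open>Strictness makes the induction work: a second index j' owns a nonempty family
      disjoint from \<open>B j\<close>.\<close>
    have "B j \<subset> A" using BA[of j] BA[of j'] Bne[OF j'(1)] disj[OF j'(1) j(1) j'(2)] by auto
    define V where "V i = {x\<in>K. g j x \<in> U i}" for i
    have dV: "dist x y \<le> diameter (U i) / \<kappa>" if "i \<in> A" "x \<in> V i" "y \<in> V i" for i x y
    proof -
      have "\<kappa> * dist x y \<le> dist (g j x) (g j y)" using ex[OF j(1)] that by (auto simp: V_def)
      also have "\<dots> \<le> diameter (U i)" using that psubset.prems by (intro diameter_bounded_bound) (auto simp: V_def)
      finally show ?thesis using \<open>0 < \<kappa>\<close> by (simp add: field_simps)
    qed
    have bV: "bounded (V i)" if "i \<in> A" for i
      unfolding bounded_two_points using dV[OF that] by blast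
    have diamV: "diameter (V i) \<le> diameter (U i) / \<kappa>" if i: "i \<in> A" for i
    proof (rule diameter_le)
      show "V i \<noteq> {} \<or> 0 \<le> diameter (U i) / \<kappa>"
        using \<open>0 < \<kappa>\<close> psubset.prems(1)[OF i] by (simp add: diameter_ge_0)
    qed (use dV[OF i] in \<open>auto simp: dist_norm[symmetric]\<close>)
    have "\<delta> powr t \<le> (\<Sum>i\<in>B j. diameter (V i) powr t)"
    proof (rule psubset.IH[OF \<open>B j \<subset> A\<close>])
      show "K \<subseteq> (\<Union>i\<in>B j. V i)"
        using psubset.prems(2) g[OF j(1)] by (fastforce simp: V_def B_def)
    qed (use bV BA in blast)
    also have "\<dots> \<le> (\<Sum>i\<in>B j. diameter (U i) powr t / \<kappa> powr t)"
    proof (rule sum_mono)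
      fix i assume "i \<in> B j"
      then have i: "i \<in> A" using BA by auto
      have "diameter (V i) powr t \<le> (diameter (U i) / \<kappa>) powr t"
        using \<open>0 < t\<close> diamV[OF i] bV[OF i] by (intro powr_mono2) (auto simp: diameter_ge_0)
      also have "\<dots> = diameter (U i) powr t / \<kappa> powr t"
        using psubset.prems(1)[OF i] \<open>0 < \<kappa>\<close> by (simp add: powr_divide diameter_ge_0)
      finally show "diameter (V i) powr t \<le> diameter (U i) powr t / \<kappa> powr t" .
    qed
    also have "\<dots> = (1 / \<kappa> powr t) * (\<Sum>i\<in>B j. diameter (U i) powr t)"
      by (simp add: sum_divide_distrib)
    \<comment> \<open>The loss 1 / \<kappa> powr t of the pull-back is paid by the factor
      \<open>card J\<close> gained from the pigeonhole.\<close>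
    also have "\<dots> \<le> card J * (\<Sum>i\<in>B j. diameter (U i) powr t)"
      using assms(7) \<open>0 < \<kappa>\<close> by (intro mult_right_mono sum_nonneg) (auto simp: field_simps)
    also note j(2)
    finally show False using neg by simp
  qed
qed

text \<open>Countable covers reduce to finite ones: each set is fattened to an open neighbourhood at
  a summable cost, and compactness extracts a finite subcover.\<close>

lemma hausdorff_outer_pos:
  fixes K :: "'a::real_normed_vector set"
  assumes "compact K" "0 < t" "0 < c"
    and fin: "\<And>A (U :: nat \<Rightarrow> 'a set). finite A \<Longrightarrow> (\<And>i. i \<in> A \<Longrightarrow> bounded (U i)) \<Longrightarrow> K \<subseteq> (\<Union>i\<in>A. U i)
            \<Longrightarrow> c \<le> (\<Sum>i\<in>A. diameter (U i) powr t)"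
  shows "hausdorff_outer t K \<noteq> 0"
proof
  assume "hausdorff_outer t K = 0"
  \<comment> \<open>The other half of c is reserved for the fattening, whose costs c / 2 *
    (1/2)^(i+1) add up to c / 2.\<close>
  then have "hausdorff_pre t 1 K < ennreal (c/2)"
    using hausdorff_pre_le_outer[of 1 t K] \<open>0 < c\<close> by simp
  then obtain U where U: "U \<in> small_covers 1 K" "(\<Sum>i. diam_power t (U i)) < ennreal (c/2)"
    by (auto simp: hausdorff_pre_def INF_less_iff)
  have bU: "bounded (U i)" for i using U by (auto simp: small_covers_def)
  have "\<exists>\<eta>>0. (diameter (U i) + 2 * \<eta>) powr t < diameter (U i) powr t + c / 2 * (1/2)^Suc i" for i
  proof -
    \<comment> \<open>Continuity at \<eta> = 0 holds even for diameter 0, because t > 0.\<close>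
    have "((\<lambda>\<eta>. (diameter (U i) + 2 * \<eta>) powr t) \<longlongrightarrow> (diameter (U i) + 2 * 0) powr t) (at_right 0)"
      using \<open>0 < t\<close> bU[of i]
      by (intro tendsto_powr' tendsto_intros)
         (auto simp: eventually_at_right_less diameter_ge_0 add_nonneg_nonneg eventually_at_filter)
    then have "\<forall>\<^sub>F \<eta> in at_right 0. (diameter (U i) + 2 * \<eta>) powr t < diameter (U i) powr t + c / 2 * (1/2)^Suc i"
      by (rule order_tendstoD) (use \<open>0 < c\<close> in simp)
    moreover have "\<forall>\<^sub>F \<eta> in at_right 0. (\<eta>::real) > 0" by (rule eventually_at_right_less)
    ultimately have "\<forall>\<^sub>F \<eta> in at_right 0. \<eta> > 0 \<and> (diameter (U i) + 2 * \<eta>) powr t < diameter (U i) powr t + c / 2 * (1/2)^Suc i"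
      by eventually_elim simp
    then show ?thesis using eventually_happens trivial_limit_at_right_real by blast
  qed
  then obtain \<eta> where \<eta>: "\<And>i. 0 < \<eta> i"
    "\<And>i. (diameter (U i) + 2 * \<eta> i) powr t < diameter (U i) powr t + c / 2 * (1/2)^Suc i" by metis
  define V where "V i = (\<Union>x\<in>U i. ball x (\<eta> i))" for i
  have dV: "dist x y \<le> diameter (U i) + 2 * \<eta> i" if xy: "x \<in> V i" "y \<in> V i" for x y i
  proof -
    obtain x' y' where "x' \<in> U i" "x \<in> ball x' (\<eta> i)" "y' \<in> U i" "y \<in> ball y' (\<eta> i)"
      using xy unfolding V_def by blast
    then have *: "x' \<in> U i" "y' \<in> U i" "dist x' x < \<eta> i" "dist y' y < \<eta> i" by auto
    have "dist x' y' \<le> diameter (U i)" using * bU by (intro diameter_bounded_bound)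
    then show ?thesis using * by metric
  qed
  have bV: "bounded (V i)" for i
    unfolding bounded_two_points using dV by blast
  have "K \<subseteq> (\<Union>i. V i)"
  proof
    fix x assume "x \<in> K"
    then obtain i where "x \<in> U i" using U by (auto simp: small_covers_def)
    then show "x \<in> (\<Union>i. V i)" using \<eta>(1)[of i] by (intro UN_I[of i]) (auto simp: V_def intro!: bexI[of _ x])
  qed
  then obtain A where A: "finite A" "K \<subseteq> (\<Union>i\<in>A. V i)"
  proof -
    have "open (V i)" for i by (auto simp: V_def)
    then show ?thesis using compactE_image[OF \<open>compact K\<close>, of UNIV V] \<open>K \<subseteq> (\<Union>i. V i)\<close> that by metis
  qed
  define A' where "A' = {i\<in>A. U i \<noteq> {}}"
  have A': "finite A'" "K \<subseteq> (\<Union>i\<in>A'. V i)"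
    using A unfolding A'_def V_def by (simp, blast)
  have "ennreal c \<le> ennreal (\<Sum>i\<in>A'. diameter (V i) powr t)" using fin[OF A'(1) bV A'(2)] by (rule ennreal_leI)
  also have "\<dots> = (\<Sum>i\<in>A'. ennreal (diameter (V i) powr t))" by simp
  also have "\<dots> \<le> (\<Sum>i\<in>A'. diam_power t (U i) + ennreal (c / 2 * (1/2)^Suc i))"
  proof (rule sum_mono)
    fix i assume i: "i \<in> A'"
    have "diameter (V i) \<le> diameter (U i) + 2 * \<eta> i"
      using dV \<eta>(1)[of i] diameter_ge_0[OF bU, of i] by (intro diameter_le) (auto simp: dist_norm[symmetric])
    then have "diameter (V i) powr t \<le> (diameter (U i) + 2 * \<eta> i) powr t"
      using \<open>0 < t\<close> bV by (intro powr_mono2) (auto simp: diameter_ge_0)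
    also note \<eta>(2)[of i]
    finally have "ennreal (diameter (V i) powr t) \<le> ennreal (diameter (U i) powr t + c / 2 * (1/2)^Suc i)"
      by (intro ennreal_leI) simp
    then show "ennreal (diameter (V i) powr t) \<le> diam_power t (U i) + ennreal (c / 2 * (1/2)^Suc i)"
      using i \<open>0 < t\<close> \<open>0 < c\<close> by (simp add: diam_power_def A'_def)
  qed
  also have "\<dots> \<le> (\<Sum>i. diam_power t (U i) + ennreal (c / 2 * (1/2)^Suc i))"
    using A' by (intro sum_le_suminf) auto
  also have "\<dots> = (\<Sum>i. diam_power t (U i)) + (\<Sum>i. ennreal (c / 2 * (1/2)^Suc i))"
    by (rule suminf_add[symmetric]) auto
  also have "(\<Sum>i. ennreal (c / 2 * (1/2)^Suc i)) = ennreal (c / 2)"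
  proof (rule suminf_ennreal_eq)
    show "(\<lambda>n. c / 2 * (1/2)^Suc n) sums (c / 2)"
      using sums_mult[OF power_half_series, of "c / 2"] by simp
  qed (use \<open>0 < c\<close> in auto)
  also have "(\<Sum>i. diam_power t (U i)) + ennreal (c / 2) < ennreal (c / 2) + ennreal (c / 2)"
    using U(2) by (subst add.commute) (simp add: ennreal_add_left_cancel_less)
  also have "\<dots> = ennreal c" using \<open>0 < c\<close> by (subst ennreal_plus[symmetric]) auto
  finally show False by simp
qed

text \<open>The condition behind the implicit argument. It bounds distances from below because
  covers of the copy are pulled back to \<open>K\<close> through g, and a lower bound controls the
  pulled back diameters.\<close>

definition small_copies :: "real \<Rightarrow> real set \<Rightarrow> bool" where
  "small_copies c K \<longleftrightarrow> (\<forall>x\<in>K. \<forall>r. 0 < r \<and> r \<le> 1 \<longrightarrow>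
     (\<exists>g. g ` K \<subseteq> K \<inter> cball x r \<and> (\<forall>u\<in>K. \<forall>v\<in>K. c * r * dist u v \<le> dist (g u) (g v))))"

text \<open>With too many points in S, the copies of \<open>K\<close> around them satisfy the
  hypotheses of \<open>diam_descent\<close> for some t above the dimension, with ratio c * r. Then
  \<open>hausdorff_outer t K\<close> is positive, a contradiction. No multiplicative constant is
  lost.\<close>

lemma card_separated_le_dim:
  assumes K: "compact K" "K \<subseteq> {0..1}" "0 < c" "c < 1" "small_copies c K"
    and r: "0 < r" "r \<le> 1" and S: "finite S" "S \<subseteq> K" "\<And>x y. x \<in> S \<Longrightarrow> y \<in> S \<Longrightarrow> x \<noteq> y \<Longrightarrow> 3 * r \<le> dist x y"
  shows "card S \<le> (c * r) powr (- hausdorff_dim K)"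
proof (rule ccontr)
  define s where "s = hausdorff_dim K"
  have s0: "0 \<le> s" unfolding s_def by (rule hausdorff_dim_nonneg[OF K(2)])
  have "c * r \<le> c * 1" using K r by (intro mult_left_mono) auto
  also have "\<dots> < 1" using K by simp
  finally have cr: "0 < c * r" "c * r < 1" using K r by auto
  assume neg: "\<not> card S \<le> (c * r) powr (- hausdorff_dim K)"
  then have gt: "(c * r) powr (- s) < card S" by (simp add: s_def)
  have "1 = (c * r) powr 0" using K r by simp
  also have "\<dots> \<le> (c * r) powr (-s)" using cr s0 by (intro powr_mono') auto
  finally have card: "2 \<le> card S" using gt by linarith
  \<comment> \<open>The strict inequality at s survives for exponents slightly above s.\<close>
  have "((\<lambda>t. (c * r) powr (- t)) \<longlongrightarrow> (c * r) powr (- s)) (at_right s)"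
    using cr by (intro tendsto_intros) auto
  then have "\<forall>\<^sub>F t in at_right s. (c * r) powr (- t) < card S" by (rule order_tendstoD) (rule gt)
  moreover have "\<forall>\<^sub>F t in at_right s. s < t" by (rule eventually_at_right_less)
  ultimately have "\<forall>\<^sub>F t in at_right s. s < t \<and> (c * r) powr (- t) < card S" by eventually_elim simp
  then obtain t where t: "s < t" "(c * r) powr (- t) < card S"
    using eventually_happens trivial_limit_at_right_real by blast
  have ct: "1 \<le> card S * (c * r) powr t" 
  proof -
    have "1 = (c * r) powr (- t) * (c * r) powr t" using K r by (simp flip: powr_add)
    also have "\<dots> \<le> card S * (c * r) powr t" using t(2) by (intro mult_right_mono) auto
    finally show ?thesis .
  qed
  have "\<forall>x\<in>S. \<exists>g. g ` K \<subseteq> K \<inter> cball x r \<and> (\<forall>u\<in>K. \<forall>v\<in>K. c * r * dist u v \<le> dist (g u) (g v))"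
    using K(5) r S(2) by (auto simp: small_copies_def)
  then obtain g where g: "\<And>x. x \<in> S \<Longrightarrow> g x ` K \<subseteq> K \<inter> cball x r"
    "\<And>x u v. x \<in> S \<Longrightarrow> u \<in> K \<Longrightarrow> v \<in> K \<Longrightarrow> c * r * dist u v \<le> dist (g x u) (g x v)" by metis
  have "S \<noteq> {}" using card by auto
  then have Kne: "K \<noteq> {}" using S by auto
  \<comment> \<open>Copies lie within r of centres that are 3 * r apart, which leaves r between
    them.\<close>
  have sep: "r \<le> dist (g i x) (g j y)" if "i \<in> S" "j \<in> S" "i \<noteq> j" "x \<in> K" "y \<in> K" for i j x y
  proof -
    have "dist i (g i x) \<le> r" "dist j (g j y) \<le> r" using g(1) that by (auto simp: image_subset_iff)
    then show ?thesis using S(3)[OF that(1-3)] by metric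
  qed
  have "hausdorff_outer t K \<noteq> 0"
  proof (rule hausdorff_outer_pos[OF K(1)])
    show "0 < t" using t s0 by simp
    show "0 < r powr t" using r by simp
  next
    fix A and U :: "nat \<Rightarrow> real set"
    assume A: "finite A" "\<And>i. i \<in> A \<Longrightarrow> bounded (U i)" "K \<subseteq> (\<Union>i\<in>A. U i)"
    show "r powr t \<le> (\<Sum>i\<in>A. diameter (U i) powr t)"
    proof (rule diam_descent[of K S "c * r" r t g])
      show "0 < t" using t s0 by simp
    qed (use Kne S(1) card cr r ct g sep A in \<open>auto simp: image_subset_iff\<close>)
  qed
  then show False using hausdorff_outer_above_dim[OF K(2), of t] t(1) by (simp add: s_def)
qed

section \<open>Bounded distortion\<close>

text \<open>Uniform constants of a regular Cantor set. The convex hull condition on \<psi> enters as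
  \<open>markov\<close>: if the branch on interval i sends one point of K into interval j, it covers
  the whole part of K there. A single N serves all intervals in \<open>mixing\<close>.\<close>

locale expanding_cantor =
  fixes K :: "real set" and r :: nat and a b :: "nat \<Rightarrow> real" and \<psi> \<psi>' :: "real \<Rightarrow> real"
    and \<sigma> M c \<gamma> \<delta> :: real and N :: nat
  assumes sub01: "\<And>i. i < r \<Longrightarrow> {a i..b i} \<subseteq> {0..1}"
    and gap: "0 < \<delta>" "\<delta> \<le> 1" "\<And>i j x y. i < r \<Longrightarrow> j < r \<Longrightarrow> i \<noteq> j \<Longrightarrow> x \<in> {a i..b i} \<Longrightarrow> y \<in> {a j..b j} \<Longrightarrow> \<delta> \<le> \<bar>x - y\<bar>"
    and covered: "K \<subseteq> (\<Union>i<r. {a i..b i})"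
    and deriv: "\<And>i x. i < r \<Longrightarrow> x \<in> {a i..b i} \<Longrightarrow> (\<psi> has_real_derivative \<psi>' x) (at x)"
    and expands: "1 < \<sigma>" "\<And>i x. i < r \<Longrightarrow> x \<in> {a i..b i} \<Longrightarrow> \<sigma> \<le> \<bar>\<psi>' x\<bar>"
    and deriv_le: "\<And>i x. i < r \<Longrightarrow> x \<in> {a i..b i} \<Longrightarrow> \<bar>\<psi>' x\<bar> \<le> M"
    and hoelder: "0 < \<gamma>" "0 \<le> c"
      "\<And>i x y. i < r \<Longrightarrow> x \<in> {a i..b i} \<Longrightarrow> y \<in> {a i..b i} \<Longrightarrow> \<bar>\<psi>' x - \<psi>' y\<bar> \<le> c * \<bar>x - y\<bar> powr \<gamma>"
    and invariant: "\<And>x. x \<in> K \<Longrightarrow> \<psi> x \<in> K"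
    and markov: "\<And>i j x y. i < r \<Longrightarrow> j < r \<Longrightarrow> x \<in> K \<Longrightarrow> x \<in> {a i..b i} \<Longrightarrow> \<psi> x \<in> {a j..b j} \<Longrightarrow>
      y \<in> K \<Longrightarrow> y \<in> {a j..b j} \<Longrightarrow> \<exists>u\<in>K. u \<in> {a i..b i} \<and> \<psi> u = y"
    and mixing: "\<And>i. i < r \<Longrightarrow> (\<psi> ^^ N) ` (K \<inter> {a i..b i}) = K"
begin

text \<open>Both points lie in one cylinder of order n. Times 0 to n - 1 are constrained, time n is
  not.\<close>

definition same_itinerary :: "nat \<Rightarrow> real \<Rightarrow> real \<Rightarrow> bool" where
  "same_itinerary n x u \<longleftrightarrow> (\<forall>k<n. \<exists>i<r. (\<psi> ^^ k) x \<in> {a i..b i} \<and> (\<psi> ^^ k) u \<in> {a i..b i})"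

text \<open>By the chain rule, the absolute derivative of the n-th iterate at a point x of
  K.\<close>

definition expansion :: "nat \<Rightarrow> real \<Rightarrow> real" where
  "expansion n x = (\<Prod>k<n. \<bar>\<psi>' ((\<psi> ^^ k) x)\<bar>)"

lemma iterate_in: "x \<in> K \<Longrightarrow> (\<psi> ^^ n) x \<in> K"
  by (induction n) (auto intro: invariant)

lemma in_interval: assumes "x \<in> K" obtains i where "i < r" "x \<in> {a i..b i}"
  using assms covered by blast

lemma K_bounds: "x \<in> K \<Longrightarrow> 0 \<le> x \<and> x \<le> 1"
  using in_interval sub01 by (metis atLeastAtMost_iff subset_iff)

lemma dist_K: "x \<in> K \<Longrightarrow> y \<in> K \<Longrightarrow> \<bar>x - y\<bar> \<le> 1"
  using K_bounds[of x] K_bounds[of y] by auto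

lemma mvt_segment:
  assumes "i < r" "u \<in> {a i..b i}" "v \<in> {a i..b i}"
  shows "\<exists>\<xi>. min u v \<le> \<xi> \<and> \<xi> \<le> max u v \<and> \<bar>\<psi> u - \<psi> v\<bar> = \<bar>\<psi>' \<xi>\<bar> * \<bar>u - v\<bar>"
proof -
  have *: "\<exists>\<xi>. u \<le> \<xi> \<and> \<xi> \<le> v \<and> \<bar>\<psi> u - \<psi> v\<bar> = \<bar>\<psi>' \<xi>\<bar> * \<bar>u - v\<bar>"
    if "u < v" "u \<in> {a i..b i}" "v \<in> {a i..b i}" for u v
  proof -
    have "\<exists>z>u. z < v \<and> \<psi> v - \<psi> u = (v - u) * \<psi>' z"
      using that by (intro MVT2 deriv[OF \<open>i < r\<close>]) auto
    then obtain z where z: "u < z" "z < v" "\<psi> v - \<psi> u = (v - u) * \<psi>' z" by blast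
    have "\<bar>\<psi> u - \<psi> v\<bar> = \<bar>\<psi> v - \<psi> u\<bar>" by simp
    also have "\<dots> = \<bar>\<psi>' z\<bar> * \<bar>u - v\<bar>" unfolding z(3) by (simp add: abs_mult mult.commute abs_minus_commute)
    finally show ?thesis using z by (intro exI[of _ z]) auto
  qed
  consider "u < v" | "v < u" | "u = v" by linarith
  then show ?thesis
  proof cases
    case 1 then show ?thesis using *[of u v] assms by auto
  next
    case 2 then show ?thesis using *[of v u] assms by (auto simp: abs_minus_commute)
  qed auto
qed

lemma expand_step:
  assumes "i < r" "u \<in> {a i..b i}" "v \<in> {a i..b i}"
  shows "\<sigma> * \<bar>u - v\<bar> \<le> \<bar>\<psi> u - \<psi> v\<bar>"
proof -
  obtain \<xi> where \<xi>: "min u v \<le> \<xi>" "\<xi> \<le> max u v" "\<bar>\<psi> u - \<psi> v\<bar> = \<bar>\<psi>' \<xi>\<bar> * \<bar>u - v\<bar>"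
    using mvt_segment[OF assms] by blast
  then have "\<xi> \<in> {a i..b i}" using assms by auto
  then show ?thesis using \<xi>(3) expands(2)[OF \<open>i < r\<close>] by (simp add: mult_right_mono)
qed

text \<open>The mean value point is within D of x, so its derivative differs from that at x by at
  most c * D powr \<gamma>. This additive error becomes relative because both derivatives have
  absolute value at least 1.\<close>

lemma distortion_step:
  assumes i: "i < r" and uvx: "u \<in> {a i..b i}" "v \<in> {a i..b i}" "x \<in> {a i..b i}"
    and D: "\<bar>u - x\<bar> \<le> D" "\<bar>v - x\<bar> \<le> D"
  shows "\<bar>\<psi> u - \<psi> v\<bar> \<le> \<bar>\<psi>' x\<bar> * (1 + c * D powr \<gamma>) * \<bar>u - v\<bar>"
    and "\<bar>\<psi>' x\<bar> * \<bar>u - v\<bar> \<le> (1 + c * D powr \<gamma>) * \<bar>\<psi> u - \<psi> v\<bar>"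
proof -
  obtain \<xi> where \<xi>: "min u v \<le> \<xi>" "\<xi> \<le> max u v" "\<bar>\<psi> u - \<psi> v\<bar> = \<bar>\<psi>' \<xi>\<bar> * \<bar>u - v\<bar>"
    using mvt_segment[OF assms(1-3)] by blast
  then have \<xi>i: "\<xi> \<in> {a i..b i}" using assms by auto
  have "\<bar>\<xi> - x\<bar> \<le> D" using \<xi> D by (auto simp: min_def max_def abs_if split: if_splits)
  then have "c * \<bar>\<xi> - x\<bar> powr \<gamma> \<le> c * D powr \<gamma>"
    using hoelder by (intro mult_left_mono powr_mono2) auto
  then have d: "\<bar>\<psi>' \<xi> - \<psi>' x\<bar> \<le> c * D powr \<gamma>" using hoelder(3)[OF i \<xi>i uvx(3)] by linarith
  have e: "0 \<le> c * D powr \<gamma>" using hoelder(2) by simp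
  have 1: "1 \<le> \<bar>\<psi>' x\<bar>" "1 \<le> \<bar>\<psi>' \<xi>\<bar>" using expands(1) expands(2)[OF i] uvx(3) \<xi>i by force+
  have "1 * (c * D powr \<gamma>) \<le> \<bar>\<psi>' x\<bar> * (c * D powr \<gamma>)" "1 * (c * D powr \<gamma>) \<le> \<bar>\<psi>' \<xi>\<bar> * (c * D powr \<gamma>)"
    by (rule mult_right_mono[OF 1(1) e] mult_right_mono[OF 1(2) e])+
  then have "\<bar>\<psi>' \<xi>\<bar> \<le> \<bar>\<psi>' x\<bar> * (1 + c * D powr \<gamma>)" "\<bar>\<psi>' x\<bar> \<le> (1 + c * D powr \<gamma>) * \<bar>\<psi>' \<xi>\<bar>"
    using d by (auto simp: algebra_simps)
  from mult_right_mono[OF this(1), of "\<bar>u - v\<bar>"] mult_right_mono[OF this(2), of "\<bar>u - v\<bar>"]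
  show "\<bar>\<psi> u - \<psi> v\<bar> \<le> \<bar>\<psi>' x\<bar> * (1 + c * D powr \<gamma>) * \<bar>u - v\<bar>"
    "\<bar>\<psi>' x\<bar> * \<bar>u - v\<bar> \<le> (1 + c * D powr \<gamma>) * \<bar>\<psi> u - \<psi> v\<bar>"
    unfolding \<xi>(3) by (simp_all add: mult.assoc)
qed

text \<open>Read backwards from time n: distances start at most 1, as K lies in the unit interval,
  and shrink by \<sigma> at every step back. Hence the downward induction on k.\<close>

lemma same_itinerary_contract:
  assumes "same_itinerary n x u" "x \<in> K" "u \<in> K" "k \<le> n"
  shows "\<sigma> ^ (n - k) * \<bar>(\<psi> ^^ k) u - (\<psi> ^^ k) x\<bar> \<le> 1"
  using \<open>k \<le> n\<close>
proof (induction rule: inc_induct)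
  case base
  then show ?case using dist_K iterate_in assms by simp
next
  case (step k)
  obtain i where i: "i < r" "(\<psi> ^^ k) x \<in> {a i..b i}" "(\<psi> ^^ k) u \<in> {a i..b i}"
    using assms(1) step by (auto simp: same_itinerary_def)
  have "\<sigma> ^ (n - k) * \<bar>(\<psi> ^^ k) u - (\<psi> ^^ k) x\<bar> = \<sigma> ^ (n - Suc k) * (\<sigma> * \<bar>(\<psi> ^^ k) u - (\<psi> ^^ k) x\<bar>)"
    using step by (simp add: Suc_diff_Suc flip: power_Suc2 mult.assoc)
  also have "\<dots> \<le> \<sigma> ^ (n - Suc k) * \<bar>\<psi> ((\<psi> ^^ k) u) - \<psi> ((\<psi> ^^ k) x)\<bar>"
    using expand_step[OF i(1,3,2)] expands(1) by (intro mult_left_mono) auto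
  also have "\<dots> \<le> 1" using step by simp
  finally show ?case .
qed

text \<open>The factor by which the Hoelder errors decay at each step back from time n.\<close>

definition rate :: real where "rate = \<sigma> powr (- \<gamma>)"

lemma rate: "0 < rate" "rate < 1"
proof -
  show "0 < rate" using expands(1) by (simp add: rate_def)
  show "rate < 1" unfolding rate_def using expands(1) hoelder(1)
    using powr_less_mono[of "- \<gamma>" 0 \<sigma>] by simp
qed

text \<open>The errors form a geometric series with sum at most c / (1 - \<open>rate\<close>), and 1
  + x is at most exp x.\<close>

definition distortion_bound :: real where "distortion_bound = exp (c / (1 - rate))"

lemma distortion_bound_ge_1: "1 \<le> distortion_bound"
  using rate hoelder(2) by (simp add: distortion_bound_def)

lemma prod_le_distortion_bound: "(\<Prod>k<n. 1 + c * rate ^ (n - k)) \<le> distortion_bound"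
proof -
  have "(\<Prod>k<n. 1 + c * rate ^ (n - k)) \<le> (\<Prod>k<n. exp (c * rate ^ (n - k)))"
    using rate hoelder(2) by (intro prod_mono) (auto intro!: add_nonneg_nonneg mult_nonneg_nonneg)
  also have "\<dots> = exp (\<Sum>k<n. c * rate ^ (n - k))" by (simp add: exp_sum)
  also have "\<dots> \<le> distortion_bound"
  proof -
    \<comment> \<open>Lowering the exponents by one lets the reversed sum run over the powers 0 to n
      - 1.\<close>
    have "(\<Sum>k<n. rate ^ (n - k)) \<le> (\<Sum>k<n. rate ^ (n - Suc k))"
      using rate by (intro sum_mono power_decreasing) auto
    also have "\<dots> = (\<Sum>k<n. rate ^ k)" by (rule sum.nat_diff_reindex)
    also have "\<dots> \<le> (\<Sum>k. rate ^ k)" using rate by (intro sum_le_suminf summable_geometric) auto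
    also have "\<dots> = 1 / (1 - rate)" using rate by (intro suminf_geometric) auto
    finally have "c * (\<Sum>k<n. rate ^ (n - k)) \<le> c * (1 / (1 - rate))" using hoelder(2) by (rule mult_left_mono)
    then show ?thesis by (simp add: distortion_bound_def sum_distrib_left)
  qed
  finally show ?thesis .
qed

lemma expansion_nonneg: "0 \<le> expansion n x"
  by (simp add: expansion_def prod_nonneg)

text \<open>The error at time k depends on the time n - k left before the itineraries may part, so n
  stays fixed while the induction runs over m.\<close>

lemma distortion_aux:
  assumes "same_itinerary n x u" "same_itinerary n x v" "x \<in> K" "u \<in> K" "v \<in> K" "m \<le> n"
  shows "\<bar>(\<psi> ^^ m) u - (\<psi> ^^ m) v\<bar> \<le> expansion m x * (\<Prod>k<m. 1 + c * rate ^ (n - k)) * \<bar>u - v\<bar> \<and>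
    expansion m x * \<bar>u - v\<bar> \<le> (\<Prod>k<m. 1 + c * rate ^ (n - k)) * \<bar>(\<psi> ^^ m) u - (\<psi> ^^ m) v\<bar>"
  using \<open>m \<le> n\<close>
proof (induction m)
  case 0
  then show ?case by (simp add: expansion_def)
next
  case (Suc m)
  obtain i where i: "i < r" "(\<psi> ^^ m) x \<in> {a i..b i}" "(\<psi> ^^ m) u \<in> {a i..b i}"
    using assms(1) Suc.prems unfolding same_itinerary_def by (metis Suc_le_lessD)
  obtain j where j: "j < r" "(\<psi> ^^ m) x \<in> {a j..b j}" "(\<psi> ^^ m) v \<in> {a j..b j}"
    using assms(2) Suc.prems unfolding same_itinerary_def by (metis Suc_le_lessD)
  \<comment> \<open>The interval visited by x is unique, so u and v are in the same one.\<close>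
  have "i = j" using gap(1) gap(3)[OF i(1) j(1) _ i(2) j(2)] by auto
  define D where "D = 1 / \<sigma> ^ (n - m)"
  have D: "\<bar>(\<psi> ^^ m) u - (\<psi> ^^ m) x\<bar> \<le> D" "\<bar>(\<psi> ^^ m) v - (\<psi> ^^ m) x\<bar> \<le> D"
    using same_itinerary_contract[of n x u m] same_itinerary_contract[of n x v m] assms Suc.prems expands(1)
    by (auto simp: D_def field_simps)
  have Dq: "D powr \<gamma> = rate ^ (n - m)"
    using expands(1)
    by (simp add: D_def rate_def powr_divide powr_minus_divide power_one_over powr_realpow[symmetric] powr_powr mult.commute)
  define P where "P = (\<Prod>k<m. 1 + c * rate ^ (n - k))"
  define B where "B = 1 + c * rate ^ (n - m)"
  have B: "0 \<le> B" using rate hoelder(2) by (simp add: B_def)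
  have P: "(\<Prod>k<Suc m. 1 + c * rate ^ (n - k)) = P * B" by (simp add: P_def B_def)
  have lipschitz_bound: "expansion (Suc m) x = expansion m x * \<bar>\<psi>' ((\<psi> ^^ m) x)\<bar>" by (simp add: expansion_def)
  note st = distortion_step[OF i(1,3) j(3)[folded \<open>i = j\<close>] i(2) D, unfolded Dq, folded B_def]
  have IH: "\<bar>(\<psi> ^^ m) u - (\<psi> ^^ m) v\<bar> \<le> expansion m x * P * \<bar>u - v\<bar>"
    "expansion m x * \<bar>u - v\<bar> \<le> P * \<bar>(\<psi> ^^ m) u - (\<psi> ^^ m) v\<bar>"
    using Suc by (auto simp: P_def)
  have "\<bar>\<psi> ((\<psi> ^^ m) u) - \<psi> ((\<psi> ^^ m) v)\<bar> \<le> \<bar>\<psi>' ((\<psi> ^^ m) x)\<bar> * B * (expansion m x * P * \<bar>u - v\<bar>)"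
    using st(1) mult_left_mono[OF IH(1), of "\<bar>\<psi>' ((\<psi> ^^ m) x)\<bar> * B"] B by simp
  moreover have "expansion (Suc m) x * \<bar>u - v\<bar> \<le> P * B * \<bar>\<psi> ((\<psi> ^^ m) u) - \<psi> ((\<psi> ^^ m) v)\<bar>"
  proof -
    have P0: "0 \<le> P" using rate hoelder(2) by (auto simp: P_def intro!: prod_nonneg)
    have "expansion (Suc m) x * \<bar>u - v\<bar> = \<bar>\<psi>' ((\<psi> ^^ m) x)\<bar> * (expansion m x * \<bar>u - v\<bar>)" by (simp add: lipschitz_bound)
    also have "\<dots> \<le> \<bar>\<psi>' ((\<psi> ^^ m) x)\<bar> * (P * \<bar>(\<psi> ^^ m) u - (\<psi> ^^ m) v\<bar>)"
      by (rule mult_left_mono[OF IH(2)]) simp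
    also have "\<dots> = P * (\<bar>\<psi>' ((\<psi> ^^ m) x)\<bar> * \<bar>(\<psi> ^^ m) u - (\<psi> ^^ m) v\<bar>)" by simp
    also have "\<dots> \<le> P * (B * \<bar>\<psi> ((\<psi> ^^ m) u) - \<psi> ((\<psi> ^^ m) v)\<bar>)" by (rule mult_left_mono[OF st(2) P0])
    finally show ?thesis by (simp add: mult.assoc)
  qed
  ultimately show ?case unfolding P lipschitz_bound by (simp add: mult_ac)
qed

lemma distortion:
  assumes "same_itinerary n x u" "same_itinerary n x v" "x \<in> K" "u \<in> K" "v \<in> K"
  shows "\<bar>(\<psi> ^^ n) u - (\<psi> ^^ n) v\<bar> \<le> distortion_bound * expansion n x * \<bar>u - v\<bar>"
    and "expansion n x * \<bar>u - v\<bar> \<le> distortion_bound * \<bar>(\<psi> ^^ n) u - (\<psi> ^^ n) v\<bar>"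
proof -
  note * = distortion_aux[OF assms order_refl] prod_le_distortion_bound[of n]
  have "(expansion n x * \<bar>u - v\<bar>) * (\<Prod>k<n. 1 + c * rate ^ (n - k)) \<le> (expansion n x * \<bar>u - v\<bar>) * distortion_bound"
    using *(2) expansion_nonneg by (intro mult_left_mono) auto
  with *(1) show "\<bar>(\<psi> ^^ n) u - (\<psi> ^^ n) v\<bar> \<le> distortion_bound * expansion n x * \<bar>u - v\<bar>"
    by (simp add: mult_ac)
  have "(\<Prod>k<n. 1 + c * rate ^ (n - k)) * \<bar>(\<psi> ^^ n) u - (\<psi> ^^ n) v\<bar> \<le> distortion_bound * \<bar>(\<psi> ^^ n) u - (\<psi> ^^ n) v\<bar>"
    using *(2) by (intro mult_right_mono) auto
  with *(1) show "expansion n x * \<bar>u - v\<bar> \<le> distortion_bound * \<bar>(\<psi> ^^ n) u - (\<psi> ^^ n) v\<bar>" by linarith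
qed

section \<open>Inverse branches and small copies of K\<close>

lemma same_itinerary_refl: "x \<in> K \<Longrightarrow> same_itinerary n x x"
  unfolding same_itinerary_def using iterate_in in_interval by metis

text \<open>The inverse branch of the n-th iterate along the orbit of x reaches every point of K in
  the interval of (\<psi> ^^ n) x. The last branch is inverted first, the remaining ones by
  induction.\<close>

lemma markov_iterate:
  assumes "x \<in> K" "j < r" "(\<psi> ^^ n) x \<in> {a j..b j}" "y \<in> K" "y \<in> {a j..b j}"
  shows "\<exists>u\<in>K. same_itinerary n x u \<and> (\<psi> ^^ n) u = y"
  using assms(2-)
proof (induction n arbitrary: j y)
  case 0
  then show ?case by (auto simp: same_itinerary_def)
next
  case (Suc n)
  obtain i where i: "i < r" "(\<psi> ^^ n) x \<in> {a i..b i}" using in_interval[OF iterate_in[OF assms(1)]] by blast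
  obtain u' where u': "u' \<in> K" "u' \<in> {a i..b i}" "\<psi> u' = y"
    using markov[OF i(1) Suc.prems(1) iterate_in[OF assms(1)] i(2)] Suc.prems by auto
  obtain u where u: "u \<in> K" "same_itinerary n x u" "(\<psi> ^^ n) u = u'"
    using Suc.IH[OF i u'(1,2)] by blast
  have "same_itinerary (Suc n) x u"
    using u i u' by (auto simp: same_itinerary_def less_Suc_eq)
  then show ?case using u u' by (intro bexI[of _ u]) auto
qed

text \<open>M serves two points of one interval. For different intervals the points are at least
  \<delta> apart and their images at most 1 apart, whence 1 / \<delta>.\<close>

definition lipschitz_bound :: real where "lipschitz_bound = max M (1 / \<delta>)"

lemma lipschitz_K:
  assumes "x \<in> K" "y \<in> K" shows "\<bar>\<psi> x - \<psi> y\<bar> \<le> lipschitz_bound * \<bar>x - y\<bar>"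
proof -
  obtain i j where ij: "i < r" "x \<in> {a i..b i}" "j < r" "y \<in> {a j..b j}"
    using in_interval assms by metis
  show ?thesis
  proof (cases "i = j")
    case True
    obtain \<xi> where \<xi>: "min x y \<le> \<xi>" "\<xi> \<le> max x y" "\<bar>\<psi> x - \<psi> y\<bar> = \<bar>\<psi>' \<xi>\<bar> * \<bar>x - y\<bar>"
      using mvt_segment ij True by blast
    then have "\<xi> \<in> {a i..b i}" using ij True by auto
    then have "\<bar>\<psi>' \<xi>\<bar> \<le> lipschitz_bound" using deriv_le[OF ij(1)] by (force simp: lipschitz_bound_def)
    then show ?thesis unfolding \<xi>(3) by (intro mult_right_mono) auto
  next
    case False
    have "\<bar>\<psi> x - \<psi> y\<bar> \<le> 1" using assms invariant dist_K by blast
    also have "1 \<le> (1 / \<delta>) * \<bar>x - y\<bar>" using gap(3)[OF ij(1,3) False ij(2,4)] gap(1) by (simp add: field_simps)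
    also have "\<dots> \<le> lipschitz_bound * \<bar>x - y\<bar>" by (intro mult_right_mono) (auto simp: lipschitz_bound_def)
    finally show ?thesis .
  qed
qed

lemma lipschitz_bound_ge_1: "1 \<le> lipschitz_bound"
  using gap by (auto simp: lipschitz_bound_def le_max_iff_disj)

lemma lipschitz_iterate:
  assumes "x \<in> K" "y \<in> K" shows "\<bar>(\<psi> ^^ n) x - (\<psi> ^^ n) y\<bar> \<le> lipschitz_bound ^ n * \<bar>x - y\<bar>"
proof (induction n)
  case (Suc n)
  have "\<bar>\<psi> ((\<psi> ^^ n) x) - \<psi> ((\<psi> ^^ n) y)\<bar> \<le> lipschitz_bound * \<bar>(\<psi> ^^ n) x - (\<psi> ^^ n) y\<bar>"
    using lipschitz_K iterate_in assms by blast
  also have "\<dots> \<le> lipschitz_bound * (lipschitz_bound ^ n * \<bar>x - y\<bar>)" using Suc lipschitz_bound_ge_1 by (intro mult_left_mono) auto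
  finally show ?case by (simp add: mult_ac)
qed simp

lemma expansion_Suc: "expansion (Suc n) x = expansion n x * \<bar>\<psi>' ((\<psi> ^^ n) x)\<bar>"
  by (simp add: expansion_def)

lemma expansion_ge: assumes "x \<in> K" shows "\<sigma> ^ n \<le> expansion n x"
proof (induction n)
  case 0
  then show ?case by (simp add: expansion_def)
next
  case (Suc n)
  obtain i where "i < r" "(\<psi> ^^ n) x \<in> {a i..b i}" using in_interval[OF iterate_in[OF assms(1)]] by blast
  then have "\<sigma> \<le> \<bar>\<psi>' ((\<psi> ^^ n) x)\<bar>" by (rule expands(2))
  then have "\<sigma> ^ n * \<sigma> \<le> expansion n x * \<bar>\<psi>' ((\<psi> ^^ n) x)\<bar>"
    using Suc expands(1) expansion_nonneg by (intro mult_mono) auto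
  then show ?case by (simp add: expansion_Suc mult.commute)
qed

text \<open>The copy is an inverse branch on a cylinder of size comparable to the radius. The
  constant collects \<open>lipschitz_bound ^ N\<close> from the N mixing steps, one
  \<open>distortion_bound\<close> from the choice of n, another from distortion on the cylinder, and
  M from overshooting the threshold.\<close>

lemma small_copies_K:
  assumes "1 \<le> M"
  shows "small_copies (1 / (lipschitz_bound ^ N * distortion_bound\<^sup>2 * M)) K"
  unfolding small_copies_def
proof (intro ballI allI impI)
  fix x \<rho> :: real assume x: "x \<in> K" and \<rho>: "0 < \<rho> \<and> \<rho> \<le> 1"
  \<comment> \<open>Stopping time: the expansion is just large enough for the cylinder of x to fit
    into the ball of radius \<rho>, and minimality makes it too large by at most the factor
    M.\<close>
  define n where "n = (LEAST n. distortion_bound / \<rho> \<le> expansion n x)"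
  obtain n0 where "distortion_bound / \<rho> < \<sigma> ^ n0" using real_arch_pow expands(1) by blast
  then have "distortion_bound / \<rho> \<le> expansion n0 x" using expansion_ge[OF x, of n0] by simp
  then have n1: "distortion_bound / \<rho> \<le> expansion n x" unfolding n_def by (rule LeastI)
  have n2: "expansion n x \<le> distortion_bound * M / \<rho>"
  proof (cases n)
    case 0
    have "1 \<le> distortion_bound * M" using mult_mono[of 1 distortion_bound 1 M] distortion_bound_ge_1 assms by simp
    then show ?thesis using 0 \<rho> by (simp add: expansion_def field_simps)
  next
    case (Suc m)
    then have "expansion m x < distortion_bound / \<rho>" unfolding n_def using not_less_Least by (metis lessI not_le)
    moreover obtain i where "i < r" "(\<psi> ^^ m) x \<in> {a i..b i}" using in_interval[OF iterate_in[OF x]] by blast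
    then have "\<bar>\<psi>' ((\<psi> ^^ m) x)\<bar> \<le> M" by (rule deriv_le)
    ultimately have "expansion (Suc m) x \<le> (distortion_bound / \<rho>) * M"
      unfolding expansion_Suc using expansion_nonneg \<rho> distortion_bound_ge_1 by (intro mult_mono) auto
    then show ?thesis by (simp add: Suc)
  qed
  obtain j where j: "j < r" "(\<psi> ^^ n) x \<in> {a j..b j}" using in_interval[OF iterate_in[OF x]] by blast
  \<comment> \<open>The cylinder is known to cover only K in the interval j; N further steps spread
    that piece over all of K.\<close>
  have "\<exists>u\<in>K. same_itinerary n x u \<and> (\<psi> ^^ N) ((\<psi> ^^ n) u) = w" if w: "w \<in> K" for w
  proof -
    obtain y where "y \<in> K \<inter> {a j..b j}" "(\<psi> ^^ N) y = w" using mixing[OF j(1)] w by (metis imageE)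
    then show ?thesis using markov_iterate[OF x j, of y] by auto
  qed
  then obtain g where g: "\<And>w. w \<in> K \<Longrightarrow> g w \<in> K" "\<And>w. w \<in> K \<Longrightarrow> same_itinerary n x (g w)"
    "\<And>w. w \<in> K \<Longrightarrow> (\<psi> ^^ N) ((\<psi> ^^ n) (g w)) = w" by metis
  show "\<exists>g. g ` K \<subseteq> K \<inter> cball x \<rho> \<and> (\<forall>u\<in>K. \<forall>v\<in>K. 1 / (lipschitz_bound ^ N * distortion_bound\<^sup>2 * M) * \<rho> * dist u v \<le> dist (g u) (g v))"
  proof (intro exI conjI ballI)
    show "g ` K \<subseteq> K \<inter> cball x \<rho>"
    proof safe
      fix w assume w: "w \<in> K"
      show "g w \<in> K" using g(1)[OF w] .
      have "(distortion_bound / \<rho>) * \<bar>x - g w\<bar> \<le> expansion n x * \<bar>x - g w\<bar>" using n1 by (rule mult_right_mono) simp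
      also have "\<dots> \<le> distortion_bound * \<bar>(\<psi> ^^ n) x - (\<psi> ^^ n) (g w)\<bar>"
        by (rule distortion(2)[OF same_itinerary_refl[OF x] g(2)[OF w] x x g(1)[OF w]])
      also have "\<dots> \<le> distortion_bound * 1" using distortion_bound_ge_1 dist_K iterate_in x g(1)[OF w] by (intro mult_left_mono) auto
      finally have "\<bar>x - g w\<bar> \<le> \<rho>" using \<rho> distortion_bound_ge_1 by (simp add: field_simps)
      then show "g w \<in> cball x \<rho>" by (simp add: dist_real_def)
    qed
    fix u v assume u: "u \<in> K" and v: "v \<in> K"
    have "dist u v = \<bar>(\<psi> ^^ N) ((\<psi> ^^ n) (g u)) - (\<psi> ^^ N) ((\<psi> ^^ n) (g v))\<bar>" using g(3) u v by (simp add: dist_real_def)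
    also have "\<dots> \<le> lipschitz_bound ^ N * \<bar>(\<psi> ^^ n) (g u) - (\<psi> ^^ n) (g v)\<bar>"
      using lipschitz_iterate iterate_in g(1) u v by blast
    also have "\<dots> \<le> lipschitz_bound ^ N * (distortion_bound * expansion n x * \<bar>g u - g v\<bar>)"
      using lipschitz_bound_ge_1 distortion(1)[OF g(2)[OF u] g(2)[OF v] x g(1)[OF u] g(1)[OF v]] by (intro mult_left_mono) auto
    also have "\<dots> \<le> lipschitz_bound ^ N * (distortion_bound * (distortion_bound * M / \<rho>) * \<bar>g u - g v\<bar>)"
      using lipschitz_bound_ge_1 distortion_bound_ge_1 n2 by (intro mult_left_mono mult_right_mono) auto
    finally have "dist u v \<le> (lipschitz_bound ^ N * distortion_bound\<^sup>2 * M) * dist (g u) (g v) / \<rho>"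
      by (simp add: power2_eq_square mult_ac dist_real_def)
    moreover have "0 < lipschitz_bound ^ N * distortion_bound\<^sup>2 * M" using lipschitz_bound_ge_1 distortion_bound_ge_1 assms by (intro mult_pos_pos) auto
    ultimately show "1 / (lipschitz_bound ^ N * distortion_bound\<^sup>2 * M) * \<rho> * dist u v \<le> dist (g u) (g v)"
      using \<rho> by (simp add: field_simps)
  qed
qed

text \<open>Iterate until S no longer follows the itinerary of x. At that time some point of S is
  \<delta> away from x, so the expansion is at least of order \<delta> / \<rho>, and by bounded
  distortion all distances within S have grown in that proportion.\<close>

lemma separated_blow_up:
  assumes x: "x \<in> K" and S: "finite S" "S \<subseteq> K \<inter> cball x \<rho>" "2 \<le> card S" and r: "0 < \<epsilon>" "0 < \<rho>"
    and sep: "\<And>u v. u \<in> S \<Longrightarrow> v \<in> S \<Longrightarrow> u \<noteq> v \<Longrightarrow> \<epsilon> \<le> dist u v"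
  shows "\<exists>T\<subseteq>K. finite T \<and> card T = card S \<and>
    (\<forall>u\<in>T. \<forall>v\<in>T. u \<noteq> v \<longrightarrow> \<delta> / distortion_bound\<^sup>2 * (\<epsilon> / \<rho>) \<le> dist u v)"
proof -
  define Q where "Q n \<longleftrightarrow> (\<forall>u\<in>S. same_itinerary n x u)" for n
  \<comment> \<open>A point other than x must leave the itinerary of x, since a shared one of length
    n0 would force it too close to x.\<close>
  have "\<not> S \<subseteq> {x}" using S(3) card_mono[of "{x}" S] by auto
  then obtain u0 where u0: "u0 \<in> S" "u0 \<noteq> x" by auto
  obtain n0 where n0: "1 / \<bar>u0 - x\<bar> < \<sigma> ^ n0" using real_arch_pow expands(1) by blast
  have "\<not> Q n0"
  proof
    assume "Q n0"
    then have "\<sigma> ^ n0 * \<bar>u0 - x\<bar> \<le> 1"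
      using same_itinerary_contract[of n0 x u0 0] u0 x S by (auto simp: Q_def)
    then show False using n0 u0 by (simp add: field_simps)
  qed
  moreover have "Q 0" by (simp add: Q_def same_itinerary_def)
  \<comment> \<open>Up to level n all of S shares the itinerary of x, at level n + 1 some point has
    left it.\<close>
  ultimately obtain n where n: "Q n" "\<not> Q (Suc n)" by (metis nat_induct)
  then obtain u where u: "u \<in> S" "\<not> same_itinerary (Suc n) x u" by (auto simp: Q_def)
  have SK: "S \<subseteq> K" using S by auto
  obtain i where i: "i < r" "(\<psi> ^^ n) x \<in> {a i..b i}" using in_interval[OF iterate_in[OF x]] by blast
  obtain j where j: "j < r" "(\<psi> ^^ n) u \<in> {a j..b j}" using in_interval[OF iterate_in] SK u by blast
  have "same_itinerary n x u" using n u by (auto simp: Q_def)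
  then have "i \<noteq> j" using u(2) i j by (auto simp: same_itinerary_def less_Suc_eq)
  then have "\<delta> \<le> \<bar>(\<psi> ^^ n) x - (\<psi> ^^ n) u\<bar>" using gap(3) i j by blast
  also have "\<dots> \<le> distortion_bound * expansion n x * \<bar>x - u\<bar>"
    using distortion(1)[OF same_itinerary_refl[OF x] _ x x] \<open>same_itinerary n x u\<close> u SK by blast
  also have "\<dots> \<le> distortion_bound * expansion n x * \<rho>"
    using distortion_bound_ge_1 expansion_nonneg u S by (intro mult_left_mono) (auto simp: dist_real_def)
  finally have ex: "\<delta> / (distortion_bound * \<rho>) \<le> expansion n x" using distortion_bound_ge_1 r by (simp add: field_simps)
  have key: "\<delta> / distortion_bound\<^sup>2 * (\<epsilon> / \<rho>) \<le> \<bar>(\<psi> ^^ n) u - (\<psi> ^^ n) v\<bar>" if uv: "u \<in> S" "v \<in> S" "u \<noteq> v" for u v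
  proof -
    have "\<delta> / (distortion_bound * \<rho>) * \<epsilon> \<le> expansion n x * \<bar>u - v\<bar>"
      using ex sep[OF uv] r expansion_nonneg by (intro mult_mono) (auto simp: dist_real_def)
    also have "\<dots> \<le> distortion_bound * \<bar>(\<psi> ^^ n) u - (\<psi> ^^ n) v\<bar>"
      using distortion(2)[OF _ _ x, of n u v] n uv SK by (auto simp: Q_def)
    finally show ?thesis using distortion_bound_ge_1 r by (simp add: field_simps power2_eq_square)
  qed
  have pos: "0 < \<delta> / distortion_bound\<^sup>2 * (\<epsilon> / \<rho>)" using gap distortion_bound_ge_1 r by simp
  have "inj_on (\<psi> ^^ n) S"
  proof (rule inj_onI, rule ccontr)
    fix u v assume "u \<in> S" "v \<in> S" "(\<psi> ^^ n) u = (\<psi> ^^ n) v" "u \<noteq> v"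
    then show False using key[of u v] pos by simp
  qed
  then show ?thesis
    using key S(1) SK iterate_in
    by (intro exI[of _ "(\<psi> ^^ n) ` S"]) (auto simp: card_image dist_real_def)
qed

end

section \<open>Homogeneity of regular Cantor sets\<close>

lemma hoelder_imp_continuous_on:
  fixes f :: "real \<Rightarrow> real"
  assumes "0 < \<gamma>" "\<And>x y. x \<in> S \<Longrightarrow> y \<in> S \<Longrightarrow> \<bar>f x - f y\<bar> \<le> c * \<bar>x - y\<bar> powr \<gamma>"
  shows "continuous_on S f"
  unfolding continuous_on_def
proof
  fix x assume x: "x \<in> S"
  have "((\<lambda>y. c * \<bar>y - x\<bar> powr \<gamma>) \<longlongrightarrow> c * \<bar>x - x\<bar> powr \<gamma>) (at x within S)"
    using assms(1) by (intro tendsto_intros tendsto_powr') auto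
  then have "((\<lambda>y. c * \<bar>y - x\<bar> powr \<gamma>) \<longlongrightarrow> 0) (at x within S)" by simp
  moreover have "\<forall>\<^sub>F y in at x within S. norm (f y - f x) \<le> c * \<bar>y - x\<bar> powr \<gamma>"
    using assms(2) x by (auto simp: eventually_at_filter)
  ultimately have "((\<lambda>y. f y - f x) \<longlongrightarrow> 0) (at x within S)"
    by (rule Lim_null_comparison[rotated])
  then show "(f \<longlongrightarrow> f x) (at x within S)" by (simp add: LIM_zero_iff)
qed

text \<open>For \<alpha> at most 1 the exponent is \<alpha> itself. For larger \<alpha> the second
  derivative is continuous, hence bounded on the compact union, and the first derivative is
  Lipschitz on each interval.\<close>

lemma C_one_plus_deriv_hoelder:
  fixes a b :: "'i \<Rightarrow> real"
  assumes "0 < \<alpha>" "C_one_plus \<alpha> U f" "finite A" "(\<Union>i\<in>A. {a i..b i}) \<subseteq> U"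
    "\<And>i. i \<in> A \<Longrightarrow> {a i..b i} \<subseteq> {0..1}"
  shows "\<exists>\<gamma> c. 0 < \<gamma> \<and> 0 \<le> c \<and>
    (\<forall>i\<in>A. \<forall>x\<in>{a i..b i}. \<forall>y\<in>{a i..b i}. \<bar>deriv f x - deriv f y\<bar> \<le> c * \<bar>x - y\<bar> powr \<gamma>)"
proof -
  define k where "k = nat \<lceil>\<alpha>\<rceil>"
  define \<beta> where "\<beta> = 1 + \<alpha> - real k"
  define S where "S = (\<Union>i\<in>A. {a i..b i})"
  have S: "compact S" "S \<subseteq> U" "S \<subseteq> {0..1}" using assms(3-5) unfolding S_def by (simp, blast+)
  have k: "1 \<le> k" "0 < \<beta>" using \<open>0 < \<alpha>\<close> unfolding k_def \<beta>_def by linarith+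
  have D: "(deriv ^^ j) f differentiable at x" if "j < k" "x \<in> U" for j x
    using assms(2) that by (simp add: C_one_plus_def k_def Let_def)
  have "\<exists>c. \<forall>x\<in>S. \<forall>y\<in>S. \<bar>(deriv ^^ k) f x - (deriv ^^ k) f y\<bar> \<le> c * \<bar>x - y\<bar> powr \<beta>"
    using assms(2) S(1,2) by (simp add: C_one_plus_def k_def \<beta>_def Let_def)
  then obtain c where c: "\<And>x y. x \<in> S \<Longrightarrow> y \<in> S \<Longrightarrow> \<bar>(deriv ^^ k) f x - (deriv ^^ k) f y\<bar> \<le> c * \<bar>x - y\<bar> powr \<beta>"
    by blast
  show ?thesis
  proof (cases "k = 1")
    case True
    have "\<bar>deriv f x - deriv f y\<bar> \<le> max c 0 * \<bar>x - y\<bar> powr \<beta>" if "x \<in> S" "y \<in> S" for x y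
    proof -
      have "\<bar>deriv f x - deriv f y\<bar> \<le> c * \<bar>x - y\<bar> powr \<beta>" using c[OF that] True by simp
      also have "\<dots> \<le> max c 0 * \<bar>x - y\<bar> powr \<beta>" by (rule mult_right_mono) auto
      finally show ?thesis .
    qed
    then have "\<forall>i\<in>A. \<forall>x\<in>{a i..b i}. \<forall>y\<in>{a i..b i}. \<bar>deriv f x - deriv f y\<bar> \<le> max c 0 * \<bar>x - y\<bar> powr \<beta>"
      unfolding S_def by blast
    then show ?thesis using k(2) max.cobounded2 by blast
  next
    case False
    then have k2: "2 \<le> k" using k by simp
    have "continuous_on S ((deriv ^^ 2) f)"
    \<comment> \<open>For k = 2 the second derivative is the top one, known only to be Hoelder; for
      larger k it is differentiable.\<close>
    proof (cases "k = 2")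
      case True
      then show ?thesis using hoelder_imp_continuous_on[OF k(2), of S "(deriv ^^ k) f" c] c by simp
    next
      case False
      then have "2 < k" using k2 by simp
      then show ?thesis
        using D S by (intro continuous_at_imp_continuous_on ballI differentiable_imp_continuous_within) auto
    qed
    then have "bounded ((deriv ^^ 2) f ` S)" using compact_continuous_image compact_imp_bounded S(1) by blast
    then obtain B where B: "0 < B" "\<And>x. x \<in> S \<Longrightarrow> \<bar>(deriv ^^ 2) f x\<bar> \<le> B"
      unfolding bounded_pos by auto
    have "\<bar>deriv f x - deriv f y\<bar> \<le> B * \<bar>x - y\<bar> powr 1"
      if i: "i \<in> A" "x \<in> {a i..b i}" "y \<in> {a i..b i}" for i x y
    proof -
      have "norm (deriv f x - deriv f y) \<le> B * norm (x - y)"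
      proof (rule field_differentiable_bound[of "{a i..b i}" "deriv f" "(deriv ^^ 2) f"])
        fix z assume "z \<in> {a i..b i}"
        then have z: "z \<in> S" using i by (auto simp: S_def)
        have "(deriv ^^ 1) f differentiable at z" using D[of 1 z] k2 z S by auto
        then have "(deriv f has_real_derivative deriv (deriv f) z) (at z)"
          by (simp add: DERIV_deriv_iff_real_differentiable)
        then show "(deriv f has_field_derivative (deriv ^^ 2) f z) (at z within {a i..b i})"
          by (simp add: numeral_2_eq_2 has_field_derivative_at_within)
        show "norm ((deriv ^^ 2) f z) \<le> B" using B(2)[OF z] by simp
      qed (use i in auto)
      then show ?thesis by simp
    qed
    then show ?thesis using B(1) by - (rule exI[of _ 1], rule exI[of _ B], auto)
  qed
qed

lemma finite_intervals_gap:
  fixes a b :: "nat \<Rightarrow> real"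
  assumes "disjoint_family_on (\<lambda>i. {a i..b i}) {..<r}"
  shows "\<exists>\<delta>>0. \<delta> \<le> 1 \<and> (\<forall>i<r. \<forall>j<r. i \<noteq> j \<longrightarrow> (\<forall>x\<in>{a i..b i}. \<forall>y\<in>{a j..b j}. \<delta> \<le> \<bar>x - y\<bar>))"
proof -
  have "\<exists>d>0. i < r \<longrightarrow> j < r \<longrightarrow> i \<noteq> j \<longrightarrow> (\<forall>x\<in>{a i..b i}. \<forall>y\<in>{a j..b j}. d \<le> \<bar>x - y\<bar>)" for i j
  proof (cases "i < r \<and> j < r \<and> i \<noteq> j")
    case True
    then have "{a i..b i} \<inter> {a j..b j} = {}" using assms by (auto simp: disjoint_family_on_def)
    then show ?thesis
      using separate_compact_closed[of "{a i..b i}" "{a j..b j}"] by (auto simp: dist_real_def)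
  qed (auto intro: exI[of _ 1])
  then obtain d where d: "\<And>i j. 0 < d i j" "\<And>i j x y. i < r \<Longrightarrow> j < r \<Longrightarrow> i \<noteq> j \<Longrightarrow>
      x \<in> {a i..b i} \<Longrightarrow> y \<in> {a j..b j} \<Longrightarrow> d i j \<le> \<bar>x - y\<bar>" by metis
  \<comment> \<open>The element 1 keeps the set nonempty when no pairs exist and caps the gap at
    1.\<close>
  define D where "D = insert 1 ((\<lambda>(i, j). d i j) ` ({..<r} \<times> {..<r}))"
  have D: "finite D" "D \<noteq> {}" by (auto simp: D_def)
  have "0 < Min D" using D d(1) by (subst Min_gr_iff) (auto simp: D_def)
  moreover have "Min D \<le> 1" using D by (intro Min_le) (auto simp: D_def)
  moreover have "Min D \<le> \<bar>x - y\<bar>" if "i < r" "j < r" "i \<noteq> j" "x \<in> {a i..b i}" "y \<in> {a j..b j}" for i j x y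
  proof -
    have "Min D \<le> d i j" using D that by (intro Min_le) (auto simp: D_def)
    then show ?thesis using d(2)[OF that] by linarith
  qed
  ultimately show ?thesis by blast
qed

text \<open>A hull that meets an interval of the family contains it. If y is missing, no segment
  from the generating set to z can pass y, so that set lies entirely beyond the interval on the side
  of z. Then the hull misses z.\<close>

lemma interval_in_convex_hull:
  fixes a b :: "'i \<Rightarrow> real"
  assumes "disjoint_family_on (\<lambda>i. {a i..b i}) A" "J \<subseteq> A" "j \<in> A"
    and z: "z \<in> {a j..b j}" "z \<in> convex hull (\<Union>i\<in>J. {a i..b i})" and y: "y \<in> {a j..b j}"
  shows "y \<in> convex hull (\<Union>i\<in>J. {a i..b i})"
proof (rule ccontr)
  let ?Z = "\<Union>i\<in>J. {a i..b i}"
  assume neg: "y \<notin> convex hull ?Z"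
  have "j \<notin> J" using neg y hull_inc[of y ?Z convex] by auto
  then have disj: "?Z \<inter> {a j..b j} = {}" using assms(1-3) by (fastforce simp: disjoint_family_on_def)
  have seg: "closed_segment w z \<subseteq> convex hull ?Z" if "w \<in> ?Z" for w
    by (rule closed_segment_subset[OF hull_inc[OF that] z(2) convex_convex_hull])
  have "y \<noteq> z" using neg z by auto
  then consider "y < z" | "z < y" by linarith
  then show False
  proof cases
    case 1
    have "w > b j" if w: "w \<in> ?Z" for w
    proof -
      have "y \<notin> closed_segment w z" using seg[OF w] neg by blast
      then have "w > y" using 1 by (auto simp: closed_segment_eq_real_ivl split: if_splits)
      then show ?thesis using w disj y by force
    qed
    then have "convex hull ?Z \<subseteq> {b j<..}" by (intro hull_minimal subsetI) auto
    then show False using z by auto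
  next
    case 2
    have "w < a j" if w: "w \<in> ?Z" for w
    proof -
      have "y \<notin> closed_segment w z" using seg[OF w] neg by blast
      then have "w < y" using 2 by (auto simp: closed_segment_eq_real_ivl split: if_splits)
      then show ?thesis using w disj y by force
    qed
    then have "convex hull ?Z \<subseteq> {..<a j}" by (intro hull_minimal subsetI) auto
    then show False using z by auto
  qed
qed

lemma regular_cantor_set_expanding:
  assumes "0 < \<alpha>" "regular_cantor_set \<alpha> K"
  obtains r a b \<psi> \<psi>' \<sigma> M c \<gamma> \<delta> N where "expanding_cantor K r a b \<psi> \<psi>' \<sigma> M c \<gamma> \<delta> N" "1 \<le> M"
    "compact K" "K \<subseteq> {0..1}"
proof -
  obtain r :: nat and a b U \<psi> where r: "1 \<le> r" and ab: "\<forall>i<r. a i < b i \<and> {a i..b i} \<subseteq> {0..1}"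
    and disj: "disjoint_family_on (\<lambda>i. {a i..b i}) {..<r}" and KI: "K \<subseteq> (\<Union>i<r. {a i..b i})"
    and U: "(\<Union>i<r. {a i..b i}) \<subseteq> U" and C: "C_one_plus \<alpha> U \<psi>"
    and ex: "\<forall>x\<in>U. \<bar>deriv \<psi> x\<bar> > 1"
    and hull: "\<forall>i<r. \<exists>J\<subseteq>{..<r}. \<psi> ` {a i..b i} = convex hull (\<Union>j\<in>J. {a j..b j})"
    and mix: "\<forall>i<r. \<forall>\<^sub>F n in sequentially. (\<psi> ^^ n) ` (K \<inter> {a i..b i}) = K"
    and K: "K = (\<Inter>n. (\<psi> ^^ n) -` (\<Union>i<r. {a i..b i}))"
    using assms(2)[unfolded regular_cantor_set_def Let_def] by (elim exE conjE) (rule that, assumption+)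
  note ab = ab[rule_format] and ex = ex[rule_format] and hull = hull[rule_format] and mix = mix[rule_format]
  define I where "I = (\<Union>i<r. {a i..b i})"
  have I: "compact I" "I \<noteq> {}" "I \<subseteq> U" "K \<subseteq> I" "I \<subseteq> {0..1}"
  proof -
    have "a 0 \<in> I" using r ab[of 0] by (auto simp: I_def intro!: bexI[of _ 0])
    then show "I \<noteq> {}" by blast
    show "I \<subseteq> {0..1}" using ab unfolding I_def by blast
  qed (use U KI in \<open>auto simp: I_def\<close>)
  have der: "(\<psi> has_real_derivative deriv \<psi> x) (at x)" if "x \<in> I" for x
  proof -
    have "0 < nat \<lceil>\<alpha>\<rceil>" using \<open>0 < \<alpha>\<close> by simp
    then have "(deriv ^^ 0) \<psi> differentiable at x"
      using C I(3) that unfolding C_one_plus_def Let_def by blast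
    then show ?thesis by (simp add: DERIV_deriv_iff_real_differentiable)
  qed
  obtain \<gamma> c where h: "0 < \<gamma>" "0 \<le> c"
    "\<And>i x y. i < r \<Longrightarrow> x \<in> {a i..b i} \<Longrightarrow> y \<in> {a i..b i} \<Longrightarrow> \<bar>deriv \<psi> x - deriv \<psi> y\<bar> \<le> c * \<bar>x - y\<bar> powr \<gamma>"
    using C_one_plus_deriv_hoelder[OF \<open>0 < \<alpha>\<close> C _ U] ab by auto
  have "continuous_on I (deriv \<psi>)"
    unfolding I_def by (intro continuous_on_closed_Union hoelder_imp_continuous_on[OF h(1) h(3)]) auto
  then have cont: "continuous_on I (\<lambda>x. \<bar>deriv \<psi> x\<bar>)" by (intro continuous_intros)
  obtain x1 where x1: "x1 \<in> I" "\<And>x. x \<in> I \<Longrightarrow> \<bar>deriv \<psi> x1\<bar> \<le> \<bar>deriv \<psi> x\<bar>"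
    using continuous_attains_inf[OF I(1,2) cont] by blast
  obtain x2 where x2: "x2 \<in> I" "\<And>x. x \<in> I \<Longrightarrow> \<bar>deriv \<psi> x\<bar> \<le> \<bar>deriv \<psi> x2\<bar>"
    using continuous_attains_sup[OF I(1,2) cont] by blast
  obtain \<delta> where \<delta>: "0 < \<delta>" "\<delta> \<le> 1" "\<And>i j x y. i < r \<Longrightarrow> j < r \<Longrightarrow> i \<noteq> j \<Longrightarrow> x \<in> {a i..b i} \<Longrightarrow> y \<in> {a j..b j} \<Longrightarrow> \<delta> \<le> \<bar>x - y\<bar>"
    using finite_intervals_gap[OF disj] by blast
  \<comment> \<open>Finitely many intervals, hence one exponent N for all.\<close>
  have "\<forall>\<^sub>F n in sequentially. \<forall>i\<in>{..<r}. (\<psi> ^^ n) ` (K \<inter> {a i..b i}) = K"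
    using mix by (intro eventually_ball_finite) auto
  then obtain N where N: "\<And>i. i < r \<Longrightarrow> (\<psi> ^^ N) ` (K \<inter> {a i..b i}) = K"
    unfolding eventually_sequentially by (metis lessThan_iff order_refl)
  have Kiff: "x \<in> K \<longleftrightarrow> (\<forall>n. (\<psi> ^^ n) x \<in> I)" for x
    by (subst K) (auto simp: I_def)
  have inv: "\<psi> x \<in> K" if "x \<in> K" for x
    unfolding Kiff
  proof
    fix n show "(\<psi> ^^ n) (\<psi> x) \<in> I" using that[unfolded Kiff, rule_format, of "Suc n"] by (simp add: funpow_swap1)
  qed
  \<comment> \<open>The preimages defining K need not be closed, as \<psi> is arbitrary away from
    the intervals. Instead, the closure of K is shown to stay in I and to be invariant, hence
    contained in K.\<close>
  have closure_I: "closure K \<subseteq> I" using I(1,4) by (intro closure_minimal compact_imp_closed)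
  have closure_inv: "\<psi> ` closure K \<subseteq> closure K"
  proof (rule image_closure_subset)
    show "continuous_on (closure K) \<psi>"
      using closure_I der by (intro continuous_at_imp_continuous_on) (blast intro: DERIV_isCont)
    show "\<psi> ` K \<subseteq> closure K" using inv closure_subset by blast
  qed auto
  have "closure K \<subseteq> K"
  proof
    fix x assume "x \<in> closure K"
    then have "(\<psi> ^^ n) x \<in> closure K" for n by (induction n) (use closure_inv in auto)
    then show "x \<in> K" using Kiff closure_I by blast
  qed
  then have clK: "closed K" using closure_subset_eq by blast
  have cK: "compact K"
    using clK I(1,4) by (metis compact_Int_closed inf.absorb_iff2)
  have expanding: "expanding_cantor K r a b \<psi> (deriv \<psi>) \<bar>deriv \<psi> x1\<bar> (max 1 \<bar>deriv \<psi> x2\<bar>) c \<gamma> \<delta> N"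
  proof
    fix i j x y assume ij: "i < r" "j < r" and x: "x \<in> K" "x \<in> {a i..b i}" "\<psi> x \<in> {a j..b j}"
      and y: "y \<in> K" "y \<in> {a j..b j}"
    obtain J where J: "J \<subseteq> {..<r}" "\<psi> ` {a i..b i} = convex hull (\<Union>j\<in>J. {a j..b j})" using hull[OF ij(1)] by blast
    have "\<psi> x \<in> convex hull (\<Union>j\<in>J. {a j..b j})" unfolding J(2)[symmetric] using x(2) by (rule imageI)
    from interval_in_convex_hull[OF disj J(1) _ x(3) this y(2)] ij have "y \<in> \<psi> ` {a i..b i}"
      unfolding J(2) by simp
    then obtain u where u: "u \<in> {a i..b i}" "\<psi> u = y" by blast
    have "(\<psi> ^^ n) u \<in> I" for n
    proof (cases n)
      case 0
      then show ?thesis using u ij by (auto simp: I_def)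
    next
      case (Suc m)
      then show ?thesis using y(1)[unfolded Kiff] u(2) by (auto simp: funpow_Suc_right simp del: funpow.simps)
    qed
    then show "\<exists>u\<in>K. u \<in> {a i..b i} \<and> \<psi> u = y" using u Kiff by blast
  next
    fix i x assume "i < r" "x \<in> {a i..b i}"
    then have x: "x \<in> I" by (auto simp: I_def)
    show "(\<psi> has_real_derivative deriv \<psi> x) (at x)" by (rule der[OF x])
    show "\<bar>deriv \<psi> x1\<bar> \<le> \<bar>deriv \<psi> x\<bar>" using x1 x by blast
    show "\<bar>deriv \<psi> x\<bar> \<le> max 1 \<bar>deriv \<psi> x2\<bar>" using x2(2)[OF x] by simp
  next
    show "1 < \<bar>deriv \<psi> x1\<bar>" using ex x1(1) I(3) by blast
  next
    fix i assume "i < r"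
    from ab[OF this] show "{a i..b i} \<subseteq> {0..1}" ..
    from \<open>i < r\<close> show "(\<psi> ^^ N) ` (K \<inter> {a i..b i}) = K" by (rule N)
  next
    fix i j x y assume "i < r" "j < r" "i \<noteq> j" "x \<in> {a i..b i}" "y \<in> {a j..b j}"
    then show "\<delta> \<le> \<bar>x - y\<bar>" by (rule \<delta>(3))
  next
    fix i x y assume "i < r" "x \<in> {a i..b i}" "y \<in> {a i..b i}"
    then show "\<bar>deriv \<psi> x - deriv \<psi> y\<bar> \<le> c * \<bar>x - y\<bar> powr \<gamma>" by (rule h(3))
  qed (fact \<delta>(1,2) h(1,2) KI inv)+
  show ?thesis using that[OF expanding _ cK] I by auto
qed

lemma small_copies_mono: "small_copies c K \<Longrightarrow> c' \<le> c \<Longrightarrow> small_copies c' K"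
  unfolding small_copies_def
  by (meson mult_right_mono order_trans zero_le_dist less_imp_le)

text \<open>The counting condition of Assouad dimension, here with the exponent s attained.\<close>

definition homogeneous :: "real \<Rightarrow> real \<Rightarrow> real set \<Rightarrow> bool" where
  "homogeneous C s K \<longleftrightarrow> (\<forall>x\<in>K. \<forall>\<epsilon> \<rho> S. 0 < \<epsilon> \<longrightarrow> \<epsilon> \<le> \<rho> \<longrightarrow> finite S \<longrightarrow> S \<subseteq> K \<inter> cball x \<rho> \<longrightarrow>
     (\<forall>u\<in>S. \<forall>v\<in>S. u \<noteq> v \<longrightarrow> \<epsilon> \<le> dist u v) \<longrightarrow> card S \<le> C * (\<rho> / \<epsilon>) powr s)"

text \<open>\<open>separated_blow_up\<close> turns a set in a ball of radius \<rho> into an equally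
  large one in K with separation of order \<epsilon> / \<rho>, to which
  \<open>card_separated_le_dim\<close> applies.\<close>

lemma regular_cantor_set_homogeneous:
  assumes "0 < \<alpha>" "regular_cantor_set \<alpha> K"
  shows "compact K" "K \<subseteq> {0..1}" "\<exists>C. homogeneous C (hausdorff_dim K) K"
proof -
  obtain r a b \<psi> \<psi>' \<sigma> M c \<gamma> \<delta> N where "expanding_cantor K r a b \<psi> \<psi>' \<sigma> M c \<gamma> \<delta> N" and M: "1 \<le> M"
    and K: "compact K" "K \<subseteq> {0..1}"
    using regular_cantor_set_expanding[OF assms] by metis
  then interpret expanding_cantor K r a b \<psi> \<psi>' \<sigma> M c \<gamma> \<delta> N by simp
  show "compact K" "K \<subseteq> {0..1}" by fact+
  define s where "s = hausdorff_dim K"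
  have s: "0 \<le> s" unfolding s_def by (rule hausdorff_dim_nonneg[OF K(2)])
  define A where "A = lipschitz_bound ^ N * distortion_bound\<^sup>2 * M"
  have A: "1 \<le> A"
  proof -
    have "1 * 1 * 1 \<le> lipschitz_bound ^ N * distortion_bound\<^sup>2 * M" using lipschitz_bound_ge_1 distortion_bound_ge_1 M by (intro mult_mono) (auto intro: one_le_power)
    then show ?thesis by (simp add: A_def)
  qed
  \<comment> \<open>The 2 makes the ratio strictly less than 1 even if A = 1, as the counting lemma
    requires.\<close>
  define e where "e = 1 / (2 * A)"
  have e: "0 < e" "e < 1" using A by (auto simp: e_def)
  have "e \<le> 1 / A" using A by (simp add: e_def field_simps)
  then have ec: "small_copies e K" using small_copies_mono small_copies_K[OF M] unfolding A_def by blast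
  define \<kappa> where "\<kappa> = \<delta> / distortion_bound\<^sup>2"
  have "1 \<le> distortion_bound\<^sup>2" using distortion_bound_ge_1 by simp
  then have "\<delta> \<le> distortion_bound\<^sup>2" using gap(2) by linarith
  then have \<kappa>: "0 < \<kappa>" "\<kappa> \<le> 1" using gap(1,2) distortion_bound_ge_1 by (auto simp: \<kappa>_def field_simps)
  \<comment> \<open>The 1 covers sets of at most one point, to which the blow-up does not
    apply.\<close>
  define C where "C = max 1 ((e * \<kappa> / 3) powr (- s))"
  have "homogeneous C s K"
    unfolding homogeneous_def
  proof safe
    fix x \<epsilon> \<rho> S assume x: "x \<in> K" and \<epsilon>: "0 < \<epsilon>" "\<epsilon> \<le> \<rho>" and S: "finite S" "S \<subseteq> K \<inter> cball x \<rho>"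
      and sep: "\<forall>u\<in>S. \<forall>v\<in>S. u \<noteq> v \<longrightarrow> \<epsilon> \<le> dist u v"
    have rr: "0 < \<epsilon> / \<rho>" "\<epsilon> / \<rho> \<le> 1" using \<epsilon> by auto
    show "real (card S) \<le> C * (\<rho> / \<epsilon>) powr s"
    proof (cases "2 \<le> card S")
      case False
      have "1 * 1 \<le> C * (\<rho> / \<epsilon>) powr s" using \<epsilon> s by (intro mult_mono ge_one_powr_ge_zero) (auto simp: C_def)
      then show ?thesis using False by linarith
    next
      case True
      obtain T where T: "T \<subseteq> K" "finite T" "card T = card S" "\<forall>u\<in>T. \<forall>v\<in>T. u \<noteq> v \<longrightarrow> \<kappa> * (\<epsilon> / \<rho>) \<le> dist u v"
        using separated_blow_up[OF x S True, of \<epsilon>] \<epsilon> sep by (auto simp: \<kappa>_def)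
      define t where "t = \<kappa> * (\<epsilon> / \<rho>) / 3"
      have t: "0 < t" "t \<le> 1" using \<kappa> rr mult_mono[of \<kappa> 1 "\<epsilon> / \<rho>" 1] \<epsilon> by (simp_all add: t_def)
      have "card T \<le> (e * t) powr (- s)"
        unfolding s_def using T by (intro card_separated_le_dim[OF K e ec t]) (auto simp: t_def)
      also have "e * t = (e * \<kappa> / 3) * (\<epsilon> / \<rho>)" by (simp add: t_def)
      also have "\<dots> powr (- s) = (e * \<kappa> / 3) powr (- s) * (\<epsilon> / \<rho>) powr (- s)"
        by (rule powr_mult)
      also have "(\<epsilon> / \<rho>) powr (- s) = (\<rho> / \<epsilon>) powr s"
        using \<epsilon> by (simp add: powr_minus powr_divide)
      also have "(e * \<kappa> / 3) powr (- s) * (\<rho> / \<epsilon>) powr s \<le> C * (\<rho> / \<epsilon>) powr s"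
        by (intro mult_right_mono) (auto simp: C_def)
      finally show ?thesis using T by simp
    qed
  qed
  then show "\<exists>C. homogeneous C (hausdorff_dim K) K" unfolding s_def by blast
qed

section \<open>Measure of balls\<close>

text \<open>A separated set of maximal cardinality is a net; the maximum exists because homogeneity
  bounds the cardinalities.\<close>

lemma homogeneous_net:
  assumes h: "homogeneous C s K" and x: "x \<in> K" and \<epsilon>: "0 < \<epsilon>" "\<epsilon> \<le> \<rho>"
  shows "\<exists>S. finite S \<and> card S \<le> C * (\<rho> / \<epsilon>) powr s \<and> K \<inter> cball x \<rho> \<subseteq> (\<Union>p\<in>S. cball p \<epsilon>)"
proof -
  define Q where "Q S \<longleftrightarrow> finite S \<and> S \<subseteq> K \<inter> cball x \<rho> \<and> (\<forall>u\<in>S. \<forall>v\<in>S. u \<noteq> v \<longrightarrow> \<epsilon> \<le> dist u v)" for S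
  have bound: "card S \<le> C * (\<rho> / \<epsilon>) powr s" if "Q S" for S
    using h x \<epsilon> that unfolding homogeneous_def Q_def by blast
  have "Q {}" by (simp add: Q_def)
  moreover have "\<forall>S. Q S \<longrightarrow> card S \<le> nat \<lceil>C * (\<rho> / \<epsilon>) powr s\<rceil>"
    using bound by (meson le_nat_iff nat_ceiling_le_eq of_nat_le_iff order_trans real_nat_ceiling_ge)
  ultimately obtain S where S: "Q S" "\<And>T. Q T \<Longrightarrow> card T \<le> card S"
    using ex_has_greatest_nat[of Q "{}" card] by (metis le_imp_less_Suc)
  have "K \<inter> cball x \<rho> \<subseteq> (\<Union>p\<in>S. cball p \<epsilon>)"
  proof
    fix z assume z: "z \<in> K \<inter> cball x \<rho>"
    show "z \<in> (\<Union>p\<in>S. cball p \<epsilon>)"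
    proof (rule ccontr)
      assume "z \<notin> (\<Union>p\<in>S. cball p \<epsilon>)"
      then have far: "\<epsilon> < dist p z" if "p \<in> S" for p using that by force
      then have "z \<notin> S" using \<epsilon> by force
      have "Q (insert z S)"
        using S(1) z far unfolding Q_def by (auto simp: dist_commute less_imp_le)
      then have "card (insert z S) \<le> card S" by (rule S(2))
      then show False using \<open>z \<notin> S\<close> S(1) by (simp add: Q_def)
    qed
  qed
  then show ?thesis using S(1) bound[OF S(1)] by (auto simp: Q_def)
qed

lemma hausdorff_pre_le_finite_cover:
  assumes "finite A" "0 < e" "\<And>i. i \<in> A \<Longrightarrow> bounded (U i)" "\<And>i. i \<in> A \<Longrightarrow> diameter (U i) < e" "X \<subseteq> (\<Union>i\<in>A. U i)"
  shows "hausdorff_pre d e X \<le> (\<Sum>i\<in>A. diam_power d (U i))"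
proof -
  obtain h where h: "bij_betw h {..<card A} A"
    using ex_bij_betw_nat_finite[OF assms(1)] by (auto simp: atLeast0LessThan)
  have hA: "h n \<in> A" if "n < card A" for n using h that by (auto simp: bij_betw_def)
  define V where "V n = (if n < card A then U (h n) else {})" for n
  have "V \<in> small_covers e X"
    unfolding small_covers_def
  proof safe
    fix x assume "x \<in> X"
    then obtain i where i: "i \<in> A" "x \<in> U i" using assms(5) by blast
    then obtain n where "n < card A" "h n = i" using h unfolding bij_betw_def by (metis imageE lessThan_iff)
    then show "x \<in> (\<Union>n. V n)" using i by (intro UN_I[of n]) (auto simp: V_def)
  qed (use assms(2-4) hA in \<open>auto simp: V_def\<close>)
  then have "hausdorff_pre d e X \<le> (\<Sum>n. diam_power d (V n))"
    unfolding hausdorff_pre_def by (rule INF_lower)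
  also have "\<dots> = (\<Sum>n<card A. diam_power d (V n))"
    by (rule suminf_finite) (auto simp: V_def diam_power_def)
  also have "\<dots> = (\<Sum>n<card A. diam_power d (U (h n)))" by (simp add: V_def)
  also have "\<dots> = (\<Sum>i\<in>A. diam_power d (U i))" by (rule sum.reindex_bij_betw[OF h])
  finally show ?thesis .
qed

text \<open>The product of two \<epsilon>-nets has at most a constant times (\<rho> / \<epsilon>)
  powr d elements, and each product of balls contributes at most (4 * \<epsilon>) powr d. The mesh
  \<epsilon> cancels.\<close>

lemma hausdorff_outer_product_ball:
  fixes K1 K2 :: "real set"
  assumes h: "homogeneous C1 s1 K1" "homogeneous C2 s2 K2" and x: "x \<in> K1" "y \<in> K2"
    and d: "s1 + s2 = d" "0 < d" and \<rho>: "0 < \<rho>"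
  shows "hausdorff_outer d ((K1 \<inter> cball x \<rho>) \<times> (K2 \<inter> cball y \<rho>)) \<le> ennreal (C1 * C2 * 4 powr d * \<rho> powr d)"
  unfolding hausdorff_outer_eq_SUP
proof (rule SUP_least)
  fix e :: real assume "e \<in> {0<..}"
  then have e: "0 < e" by simp
  \<comment> \<open>The 5 makes the diameter bound 4 * \<epsilon> strictly smaller than e.\<close>
  define \<epsilon> where "\<epsilon> = min \<rho> (e / 5)"
  have \<epsilon>: "0 < \<epsilon>" "\<epsilon> \<le> \<rho>" "4 * \<epsilon> < e" using e \<rho> by (auto simp: \<epsilon>_def min_def)
  obtain S1 where S1: "finite S1" "card S1 \<le> C1 * (\<rho> / \<epsilon>) powr s1" "K1 \<inter> cball x \<rho> \<subseteq> (\<Union>p\<in>S1. cball p \<epsilon>)"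
    using homogeneous_net[OF h(1) x(1) \<epsilon>(1,2)] by blast
  obtain S2 where S2: "finite S2" "card S2 \<le> C2 * (\<rho> / \<epsilon>) powr s2" "K2 \<inter> cball y \<rho> \<subseteq> (\<Union>p\<in>S2. cball p \<epsilon>)"
    using homogeneous_net[OF h(2) x(2) \<epsilon>(1,2)] by blast
  define U where "U = (\<lambda>(p::real, q::real). cball p \<epsilon> \<times> cball q \<epsilon>)"
  have dist: "dist z w \<le> 4 * \<epsilon>" if "z \<in> U i" "w \<in> U i" for z w i
  proof -
    obtain p q where i: "i = (p, q)" by (cases i)
    have "dist z w \<le> dist (fst z) (fst w) + dist (snd z) (snd w)"
      using norm_Pair_le[of "fst z - fst w" "snd z - snd w"]
      by (metis dist_norm fst_diff minus_prod_def)
    also have "dist (fst z) (fst w) \<le> 2 * \<epsilon>" using that unfolding i U_def by (auto simp: dist_real_def)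
    also have "dist (snd z) (snd w) \<le> 2 * \<epsilon>" using that unfolding i U_def by (auto simp: dist_real_def)
    finally show ?thesis by simp
  qed
  have diam: "diameter (U i) \<le> 4 * \<epsilon>" for i
    using dist \<epsilon> by (intro diameter_le) (auto simp: dist_norm[symmetric])
  have bdd: "bounded (U i)" for i unfolding bounded_two_points using dist by blast
  have "hausdorff_pre d e ((K1 \<inter> cball x \<rho>) \<times> (K2 \<inter> cball y \<rho>)) \<le> (\<Sum>i\<in>S1 \<times> S2. diam_power d (U i))"
  proof (rule hausdorff_pre_le_finite_cover)
    show "diameter (U i) < e" for i using diam[of i] \<epsilon> by simp
    show "(K1 \<inter> cball x \<rho>) \<times> (K2 \<inter> cball y \<rho>) \<subseteq> (\<Union>i\<in>S1 \<times> S2. U i)"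
      using S1(3) S2(3) unfolding U_def by blast
  qed (use S1 S2 e bdd in auto)
  also have "\<dots> \<le> (\<Sum>i\<in>S1 \<times> S2. ennreal ((4 * \<epsilon>) powr d))"
    using diam bdd d by (intro sum_mono) (auto simp: diam_power_def intro!: ennreal_leI powr_mono2 diameter_ge_0)
  also have "\<dots> = ennreal (\<Sum>i\<in>S1 \<times> S2. (4 * \<epsilon>) powr d)" by (rule sum_ennreal) simp
  also have "(\<Sum>i\<in>S1 \<times> S2. (4 * \<epsilon>) powr d) = real (card S1) * real (card S2) * (4 * \<epsilon>) powr d"
    by (simp only: sum_constant card_cartesian_product of_nat_mult)
  also have "\<dots> \<le> ennreal (C1 * C2 * 4 powr d * \<rho> powr d)"
  proof (rule ennreal_leI)
    have "real (card S1) * real (card S2) \<le> (C1 * (\<rho> / \<epsilon>) powr s1) * (C2 * (\<rho> / \<epsilon>) powr s2)"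
      by (rule mult_mono[OF S1(2) S2(2) order_trans[OF _ S1(2)]]) simp_all
    also have "\<dots> = C1 * C2 * (\<rho> / \<epsilon>) powr d" by (simp add: powr_add mult_ac flip: d(1))
    finally have "real (card S1) * real (card S2) * (4 * \<epsilon>) powr d \<le> C1 * C2 * (\<rho> / \<epsilon>) powr d * (4 * \<epsilon>) powr d"
      by (rule mult_right_mono) simp
    also have "\<dots> = C1 * C2 * ((\<rho> / \<epsilon>) * (4 * \<epsilon>)) powr d" using \<epsilon> \<rho> by (simp only: powr_mult mult.assoc)
    also have "(\<rho> / \<epsilon>) * (4 * \<epsilon>) = 4 * \<rho>" using \<epsilon> by simp
    also have "(4 * \<rho>) powr d = 4 powr d * \<rho> powr d" by (rule powr_mult)
    finally show "real (card S1) * real (card S2) * (4 * \<epsilon>) powr d \<le> C1 * C2 * 4 powr d * \<rho> powr d"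
      by (simp add: mult.assoc)
  qed
  finally show "hausdorff_pre d e ((K1 \<inter> cball x \<rho>) \<times> (K2 \<inter> cball y \<rho>)) \<le> ennreal (C1 * C2 * 4 powr d * \<rho> powr d)" .
qed

definition frostman :: "real \<Rightarrow> real \<Rightarrow> 'a::euclidean_space measure \<Rightarrow> bool" where
  "frostman C d \<mu> \<longleftrightarrow> sets \<mu> = sets borel \<and> finite_measure \<mu> \<and>
     (\<forall>z. \<forall>\<rho>>0. emeasure \<mu> (cball z \<rho>) \<le> ennreal (C * \<rho> powr d))"

text \<open>The centre z is arbitrary. If the ball meets the product, it is enclosed in a ball of
  twice the radius about a point of the product.\<close>

lemma frostman_product:
  assumes h: "homogeneous C1 s1 K1" "homogeneous C2 s2 K2" and d: "s1 + s2 = d" "0 < d"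
    and K: "compact K1" "compact K2"
  shows "\<exists>C\<ge>0. frostman C d (density (hausdorff_measure d) (indicator (K1 \<times> K2)))" (is "\<exists>C\<ge>0. frostman C d ?\<mu>")
proof -
  \<comment> \<open>The factor 2 powr d comes from doubling the radius; the maximum secures the
    sign, as nothing is assumed about C1 and C2.\<close>
  define C where "C = max 0 (C1 * C2 * 4 powr d * 2 powr d)"
  have Q[measurable]: "K1 \<times> K2 \<in> sets borel" using K by (intro borel_compact compact_Times)
  have ball: "emeasure ?\<mu> (cball z \<rho>) \<le> ennreal (C * \<rho> powr d)" if \<rho>: "0 < \<rho>" for z \<rho>
  proof -
    have e: "emeasure ?\<mu> (cball z \<rho>) = hausdorff_outer d (K1 \<times> K2 \<inter> cball z \<rho>)"
      by (subst emeasure_density)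
         (auto simp: emeasure_hausdorff_measure indicator_inter_arith[symmetric])
    show ?thesis
    proof (cases "K1 \<times> K2 \<inter> cball z \<rho> = {}")
      case True
      then show ?thesis unfolding e
        using outer_measure_space_hausdorff_outer[of d, where 'a = "real \<times> real"]
        by (simp add: outer_measure_space_def positive_def)
    next
      case False
      then obtain x y where xy: "x \<in> K1" "y \<in> K2" "dist z (x, y) \<le> \<rho>" by auto
      have "K1 \<times> K2 \<inter> cball z \<rho> \<subseteq> (K1 \<inter> cball x (2*\<rho>)) \<times> (K2 \<inter> cball y (2*\<rho>))"
      proof
        fix w assume w: "w \<in> K1 \<times> K2 \<inter> cball z \<rho>"
        have "dist (x, y) w \<le> 2 * \<rho>" using xy(3) w dist_triangle[of "(x, y)" w z] by (simp add: dist_commute)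
        moreover have "dist x (fst w) \<le> dist (x, y) w" "dist y (snd w) \<le> dist (x, y) w"
          using dist_fst_le[of "(x, y)" w] dist_snd_le[of "(x, y)" w] by auto
        ultimately show "w \<in> (K1 \<inter> cball x (2*\<rho>)) \<times> (K2 \<inter> cball y (2*\<rho>))"
          using w by (cases w) auto
      qed
      then have "emeasure ?\<mu> (cball z \<rho>) \<le> hausdorff_outer d ((K1 \<inter> cball x (2*\<rho>)) \<times> (K2 \<inter> cball y (2*\<rho>)))"
        unfolding e by (rule hausdorff_outer_mono)
      also have "\<dots> \<le> ennreal (C1 * C2 * 4 powr d * (2*\<rho>) powr d)"
        using \<rho> by (intro hausdorff_outer_product_ball[OF h xy(1,2) d]) simp
      also have "\<dots> \<le> ennreal (C * \<rho> powr d)"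
        by (intro ennreal_leI) (auto simp: C_def powr_mult mult.assoc[symmetric] intro!: mult_right_mono)
      finally show ?thesis .
    qed
  qed
  have "bounded (K1 \<times> K2)" using K by (intro compact_imp_bounded compact_Times)
  then obtain B where B: "0 < B" "K1 \<times> K2 \<subseteq> cball 0 B" by (auto simp: bounded_pos subset_iff)
  have "emeasure ?\<mu> (space ?\<mu>) = hausdorff_outer d (K1 \<times> K2)"
    by (subst emeasure_density) (auto simp: emeasure_hausdorff_measure)
  also have "\<dots> = emeasure ?\<mu> (cball 0 B)"
    using B(2)
    by (subst emeasure_density)
       (auto simp: emeasure_hausdorff_measure indicator_inter_arith[symmetric] Int_absorb2)
  also have "\<dots> < top" using ball[OF B(1), of 0] by (auto intro: le_less_trans)
  finally have "finite_measure ?\<mu>" by (intro finite_measureI) auto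
  then have "frostman C d ?\<mu>" using ball by (auto simp: frostman_def)
  then show ?thesis by (intro exI[of _ C]) (auto simp: C_def)
qed

section \<open>Transversality and energy\<close>


text \<open>As pi / 2 < 2, the cubic Taylor error is at most 4 / 6 of the absolute value of w,
  leaving one third.\<close>

lemma abs_sin_ge: fixes w :: real assumes "\<bar>w\<bar> \<le> pi / 2" shows "\<bar>w\<bar> \<le> 3 * \<bar>sin w\<bar>"
proof -
  have "\<bar>sin w - (\<Sum>m<3. sin_coeff m * w ^ m)\<bar> \<le> inverse (fact 3) * \<bar>w\<bar> ^ 3" by (rule Maclaurin_sin_bound)
  then have 1: "\<bar>sin w - w\<bar> \<le> \<bar>w\<bar> ^ 3 / 6" by (simp add: eval_nat_numeral sin_coeff_def)
  have "\<bar>w\<bar> \<le> 2" using assms pi_less_4 by linarith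
  then have "\<bar>w\<bar>\<^sup>2 \<le> 2\<^sup>2" by (intro power_mono) auto
  then have "\<bar>w\<bar>\<^sup>2 * \<bar>w\<bar> \<le> 4 * \<bar>w\<bar>" by (intro mult_right_mono) auto
  then have "\<bar>w\<bar> ^ 3 \<le> 4 * \<bar>w\<bar>" by (simp add: eval_nat_numeral)
  then show ?thesis using 1 by linarith
qed

text \<open>In polar coordinates the inner product is norm z * cos (\<theta> - \<phi>). It is small
  only within 3 * \<eta> / norm z of a zero of the cosine, and the window contains boundedly many
  zeros.\<close>

lemma transversality:
  fixes z :: "real \<times> real" and T :: nat
  assumes "z \<noteq> 0" "0 \<le> \<eta>"
  shows "emeasure lborel {\<theta> \<in> {-real T..real T}. \<bar>z \<bullet> dir_vec \<theta>\<bar> \<le> \<eta>} \<le> ennreal (6 * (2 * real T + 19) * (\<eta> / norm z))"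
proof -
  have n: "norm z > 0" using assms by simp
  have "(fst z / norm z)\<^sup>2 + (snd z / norm z)\<^sup>2 = 1"
  proof -
    have "(fst z / norm z)\<^sup>2 + (snd z / norm z)\<^sup>2 = ((fst z)\<^sup>2 + (snd z)\<^sup>2) / (norm z)\<^sup>2"
      by (simp only: power_divide add_divide_distrib)
    also have "(fst z)\<^sup>2 + (snd z)\<^sup>2 = (norm z)\<^sup>2" by (simp add: norm_prod_def)
    also have "(norm z)\<^sup>2 / (norm z)\<^sup>2 = 1" by (rule divide_self) (use assms in simp)
    finally show ?thesis .
  qed
  then obtain \<phi> where \<phi>: "0 \<le> \<phi>" "\<phi> < 2 * pi" "fst z / norm z = cos \<phi>" "snd z / norm z = sin \<phi>"
    by (rule sincos_total_2pi)
  define \<tau> where "\<tau> = \<eta> / norm z"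
  have z: "z \<bullet> dir_vec \<theta> = norm z * cos (\<theta> - \<phi>)" for \<theta>
  proof -
    have "fst z = norm z * cos \<phi>" "snd z = norm z * sin \<phi>" using \<phi>(3,4) n by (simp_all add: field_simps)
    moreover have "z \<bullet> dir_vec \<theta> = fst z * cos \<theta> + snd z * sin \<theta>" by (cases z) (simp add: dir_vec_def)
    ultimately show ?thesis by (simp only: cos_diff ring_distribs mult_ac)
  qed
  \<comment> \<open>A generous index range: the zeros that occur satisfy the bound T / 2 + 3. Its 2
    * T + 19 elements and the length 6 * \<tau> of each \<open>J k\<close> give the
    constant.\<close>
  define F :: "int set" where "F = {-(int T + 9)..int T + 9}"
  define J where "J k = {\<phi> + pi/2 + of_int k * pi - 3 * \<tau>..\<phi> + pi/2 + of_int k * pi + 3 * \<tau>}" for k :: int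
  have "{\<theta> \<in> {-real T..real T}. \<bar>z \<bullet> dir_vec \<theta>\<bar> \<le> \<eta>} \<subseteq> (\<Union>k\<in>F. J k)"
  proof safe
    fix \<theta> assume \<theta>: "\<theta> \<in> {-real T..real T}" "\<bar>z \<bullet> dir_vec \<theta>\<bar> \<le> \<eta>"
    define u where "u = \<theta> - \<phi> - pi / 2"
    define k where "k = round (u / pi)"
    define w where "w = u - of_int k * pi"
    have "\<bar>of_int k - u / pi\<bar> \<le> 1 / 2" unfolding k_def by (rule of_int_round_abs_le)
    then have "\<bar>of_int k - u / pi\<bar> * pi \<le> 1 / 2 * pi" by (rule mult_right_mono) simp
    then have "\<bar>(of_int k - u / pi) * pi\<bar> \<le> pi / 2" by (simp add: abs_mult)
    moreover have "(of_int k - u / pi) * pi = - w" by (simp add: w_def field_simps)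
    ultimately have w: "\<bar>w\<bar> \<le> pi / 2" by simp
    have "norm z * \<bar>cos (\<theta> - \<phi>)\<bar> \<le> \<eta>" using \<theta>(2) unfolding z by (simp add: abs_mult)
    then have c: "\<bar>cos (\<theta> - \<phi>)\<bar> \<le> \<tau>" using n by (simp add: \<tau>_def field_simps)
    have "\<theta> - \<phi> = w + of_int k * pi + pi / 2" by (simp add: w_def u_def)
    then have "\<bar>cos (\<theta> - \<phi>)\<bar> = \<bar>sin (w + of_int k * pi)\<bar>" by (simp add: cos_add)
    also have "\<dots> = \<bar>sin w\<bar>" by (simp add: sin_add abs_mult mult.commute[of _ pi] sin_integer_2pi cos_npi_int)
    finally have "\<bar>w\<bar> \<le> 3 * \<tau>" using abs_sin_ge[OF w] c by linarith
    then have "\<theta> \<in> J k" by (auto simp: J_def w_def u_def)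
    moreover have "k \<in> F"
    proof -
      have "\<bar>u\<bar> \<le> real T + 5 / 2 * pi" using \<theta>(1) \<phi>(1,2) unfolding u_def by auto
      moreover have "real T \<le> real T / 2 * pi" using pi_ge_two mult_left_mono[of 2 pi "real T / 2"] by simp
      ultimately have "\<bar>of_int k * pi\<bar> \<le> (real T / 2 + 3) * pi" using w unfolding w_def ring_distribs by linarith
      then have "\<bar>of_int k\<bar> * pi \<le> (real T / 2 + 3) * pi" by (simp add: abs_mult)
      then have "\<bar>real_of_int k\<bar> \<le> real T / 2 + 3" by (subst (asm) mult_le_cancel_right) auto
      then show ?thesis unfolding F_def by auto
    qed
    ultimately show "\<theta> \<in> (\<Union>k\<in>F. J k)" by blast
  qed
  then have "emeasure lborel {\<theta> \<in> {-real T..real T}. \<bar>z \<bullet> dir_vec \<theta>\<bar> \<le> \<eta>} \<le> emeasure lborel (\<Union>k\<in>F. J k)"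
    by (rule emeasure_mono) (auto simp: J_def F_def)
  also have "\<dots> \<le> (\<Sum>k\<in>F. emeasure lborel (J k))"
    by (rule emeasure_subadditive_finite) (auto simp: F_def J_def)
  also have "\<dots> = (\<Sum>k\<in>F. ennreal (6 * \<tau>))"
    using n assms by (intro sum.cong) (auto simp: J_def \<tau>_def emeasure_lborel_Icc_eq)
  also have "\<dots> = ennreal (\<Sum>k\<in>F. 6 * \<tau>)" using n assms by (intro sum_ennreal) (auto simp: \<tau>_def)
  also have "(\<Sum>k\<in>F. 6 * \<tau>) = 6 * (2 * real T + 19) * \<tau>" by (simp add: F_def)
  finally show ?thesis by (simp add: \<tau>_def)
qed

section \<open>Finite energy\<close>

text \<open>A majorant of \<open>1 / t\<close>. It is infinite at 0, so the diagonal needs no separate treatment below.\<close>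

definition dyadic_kernel :: "real \<Rightarrow> ennreal" where
  "dyadic_kernel t = 1 + (\<Sum>k. ennreal (2 ^ Suc k) * indicator {..(1/2) ^ k} t)"

lemma dyadic_kernel_measurable [measurable]: "dyadic_kernel \<in> borel_measurable borel"
  unfolding dyadic_kernel_def by measurable

lemma ennreal_le_suminf: "f k \<le> (\<Sum>k. f k :: ennreal)"
  using sum_le_suminf[of f "{k}"] by simp

lemma inverse_le_dyadic_kernel:
  assumes "0 < t" shows "ennreal (1 / t) \<le> dyadic_kernel t"
proof (cases "t \<le> 1")
  case False
  then have "ennreal (1 / t) \<le> 1" by (simp add: ennreal_le_1)
  also have "\<dots> \<le> dyadic_kernel t" by (simp add: dyadic_kernel_def)
  finally show ?thesis .
next
  case True
  \<comment> \<open>Minimality puts t between (1/2)^n and (1/2)^(n-1), so the single term k = n - 1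
    suffices.\<close>
  define n where "n = (LEAST n. (1/2) ^ n < t)"
  have ex: "\<exists>n. (1/2::real) ^ n < t" using real_arch_pow_inv[OF assms, of "1/2"] by simp
  have n: "(1/2) ^ n < t" unfolding n_def using ex by (rule LeastI_ex)
  have "n \<noteq> 0" using n True by (cases n) auto
  then obtain k where k: "n = Suc k" by (cases n) auto
  have "\<not> (1/2) ^ k < t" using not_less_Least[of k "\<lambda>n. (1/2) ^ n < t"] k n_def by simp
  then have tk: "t \<le> (1/2) ^ k" by simp
  have "1 / t \<le> 2 ^ Suc k" using n assms unfolding k by (simp add: field_simps power_divide)
  then have "ennreal (1 / t) \<le> ennreal (2 ^ Suc k) * indicator {..(1/2) ^ k} t"
    using tk by (simp add: ennreal_leI)
  also have "\<dots> \<le> (\<Sum>k. ennreal (2 ^ Suc k) * indicator {..(1/2) ^ k} t)"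
    by (rule ennreal_le_suminf)
  also have "\<dots> \<le> dyadic_kernel t" by (simp add: dyadic_kernel_def)
  finally show ?thesis .
qed

lemma dyadic_kernel_0: "dyadic_kernel 0 = top"
proof -
  have "ennreal (real n) \<le> dyadic_kernel 0" for n
  proof -
    have "real n < 2 ^ n" by (rule of_nat_less_two_power)
    then have "real n \<le> 2 ^ Suc n" unfolding power_Suc by linarith
    then have "ennreal (real n) \<le> ennreal (2 ^ Suc n) * indicator {..(1/2) ^ n} (0::real)" by (simp add: ennreal_leI)
    also have "\<dots> \<le> (\<Sum>k. ennreal (2 ^ Suc k) * indicator {..(1/2) ^ k} (0::real))"
      by (rule ennreal_le_suminf)
    also have "\<dots> \<le> dyadic_kernel 0" by (simp add: dyadic_kernel_def)
    finally show ?thesis .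
  qed
  then have "of_nat n \<le> dyadic_kernel 0" for n by (simp add: ennreal_of_nat_eq_real_of_nat)
  then show ?thesis by (metis ennreal_Ex_less_of_nat less_top not_le)
qed

text \<open>The dyadic ball of radius (1/2)^k contributes at most 2 * C * q^k with q = 2 powr (1 -
  d), and d > 1 makes this series converge, uniformly in x.\<close>

lemma frostman_energy:
  fixes \<mu> :: "'a::euclidean_space measure"
  assumes \<mu>: "frostman C d \<mu>" and d: "1 < d" and C: "0 \<le> C"
  shows "(\<integral>\<^sup>+ x. \<integral>\<^sup>+ y. dyadic_kernel (dist x y) \<partial>\<mu> \<partial>\<mu>) < \<infinity>"
proof -
  interpret finite_measure \<mu> using \<mu> by (simp add: frostman_def)
  have [measurable_cong]: "sets \<mu> = sets borel" using \<mu> by (simp add: frostman_def)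
  have sp: "space \<mu> = UNIV" using sets_eq_imp_space_eq[OF \<open>sets \<mu> = sets borel\<close>] by simp
  define q where "q = (2::real) powr (1 - d)"
  have q: "0 < q" "q < 1" using d powr_less_mono[of "1 - d" 0 2] by (auto simp: q_def)
  define B where "B = measure \<mu> UNIV + 2 * C * (1 / (1 - q))"
  have inner: "(\<integral>\<^sup>+ y. dyadic_kernel (dist x y) \<partial>\<mu>) \<le> ennreal B" for x
  proof -
    have "(\<integral>\<^sup>+ y. dyadic_kernel (dist x y) \<partial>\<mu>) =
      (\<integral>\<^sup>+ y. 1 \<partial>\<mu>) + (\<integral>\<^sup>+ y. (\<Sum>k. ennreal (2 ^ Suc k) * indicator {..(1/2) ^ k} (dist x y)) \<partial>\<mu>)"
      unfolding dyadic_kernel_def by (rule nn_integral_add) measurable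
    also have "(\<integral>\<^sup>+ y. (\<Sum>k. ennreal (2 ^ Suc k) * indicator {..(1/2) ^ k} (dist x y)) \<partial>\<mu>) =
       (\<Sum>k. \<integral>\<^sup>+ y. ennreal (2 ^ Suc k) * indicator {..(1/2) ^ k} (dist x y) \<partial>\<mu>)"
      by (rule nn_integral_suminf) measurable
    also have "\<dots> \<le> (\<Sum>k. ennreal (2 * C * q ^ k))"
    proof (intro suminf_le allI)
      fix k
      have "(\<integral>\<^sup>+ y. ennreal (2 ^ Suc k) * indicator {..(1/2) ^ k} (dist x y) \<partial>\<mu>) =
        (\<integral>\<^sup>+ y. ennreal (2 ^ Suc k) * indicator (cball x ((1/2) ^ k)) y \<partial>\<mu>)"
        by (intro nn_integral_cong) (auto simp: indicator_def)
      also have "\<dots> = ennreal (2 ^ Suc k) * emeasure \<mu> (cball x ((1/2) ^ k))"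
        by (rule nn_integral_cmult_indicator) measurable
      also have "\<dots> \<le> ennreal (2 ^ Suc k) * ennreal (C * ((1/2) ^ k) powr d)"
        using \<mu> by (intro mult_left_mono) (auto simp: frostman_def)
      also have "\<dots> = ennreal (2 ^ Suc k * (C * ((1/2) ^ k) powr d))" using C by (simp add: ennreal_mult)
      also have "2 ^ Suc k * (C * ((1/2) ^ k) powr d) = 2 * C * q ^ k"
      proof -
        have half: "(1/2::real) ^ k = 2 powr (- real k)"
          by (simp add: powr_minus_divide powr_realpow power_one_over)
        have "2 ^ Suc k * (C * ((1/2) ^ k) powr d) = 2 * C * (2 powr real k * 2 powr (- real k * d))"
          unfolding half powr_powr by (simp add: powr_realpow)
        also have "2 powr real k * 2 powr (- real k * d) = (2::real) powr ((1 - d) * real k)"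
          by (simp add: powr_add[symmetric] algebra_simps)
        also have "\<dots> = q ^ k" using q(1) by (simp add: q_def powr_powr flip: powr_realpow)
        finally show ?thesis .
      qed
      finally show "(\<integral>\<^sup>+ y. ennreal (2 ^ Suc k) * indicator {..(1/2) ^ k} (dist x y) \<partial>\<mu>) \<le> ennreal (2 * C * q ^ k)" .
    qed auto
    also have "\<dots> = ennreal (2 * C * (1 / (1 - q)))"
      using q C geometric_sums[of q] by (intro suminf_ennreal_eq sums_mult) auto
    also have "(\<integral>\<^sup>+ y. 1 \<partial>\<mu>) = ennreal (measure \<mu> UNIV)" by (simp add: sp emeasure_eq_measure)
    also have "ennreal (measure \<mu> UNIV) + ennreal (2 * C * (1 / (1 - q))) = ennreal B"
      using q C unfolding B_def by (intro ennreal_plus[symmetric]) auto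
    finally show ?thesis by (simp add: add_left_mono)
  qed
  have "(\<integral>\<^sup>+ x. \<integral>\<^sup>+ y. dyadic_kernel (dist x y) \<partial>\<mu> \<partial>\<mu>) \<le> (\<integral>\<^sup>+ x. ennreal B \<partial>\<mu>)"
    by (intro nn_integral_mono inner)
  also have "\<dots> < \<infinity>" by (simp add: sp emeasure_eq_measure ennreal_mult_less_top)
  finally show ?thesis .
qed

text \<open>Dominates the squared L2 norm of the averages of \<nu> over intervals of radius r. Two
  such intervals meet only if their centres are within 2 * r, hence the threshold.\<close>

definition correlation :: "real measure \<Rightarrow> real \<Rightarrow> ennreal" where
  "correlation \<nu> r = ennreal (1 / (2 * r)) * (\<integral>\<^sup>+ s. \<integral>\<^sup>+ t. indicator {..2 * r} \<bar>s - t\<bar> \<partial>\<nu> \<partial>\<nu>)"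

lemma dir_vec_measurable [measurable]: "dir_vec \<in> borel_measurable borel"
proof -
  have "continuous_on UNIV dir_vec" unfolding dir_vec_def by (intro continuous_intros)
  then show ?thesis by (rule borel_measurable_continuous_onI)
qed

text \<open>After Fubini the inner integral is over \<theta>, where transversality with \<eta> = 2 *
  r cancels the factor 1 / (2 * r). The bound is therefore uniform in r.\<close>

lemma correlation_integral:
  fixes \<mu> :: "(real \<times> real) measure"
  assumes \<mu>: "sets \<mu> = sets borel" "finite_measure \<mu>" and r: "0 < r"
  shows "(\<integral>\<^sup>+ \<theta>. correlation (distr \<mu> borel (\<lambda>x. x \<bullet> dir_vec \<theta>)) r * indicator {-real T..real T} \<theta> \<partial>lborel)
    \<le> ennreal (6 * (2 * real T + 19)) * (\<integral>\<^sup>+ x. \<integral>\<^sup>+ y. dyadic_kernel (dist x y) \<partial>\<mu> \<partial>\<mu>)" (is ?bound)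
    and "(\<lambda>\<theta>. correlation (distr \<mu> borel (\<lambda>x. x \<bullet> dir_vec \<theta>)) r) \<in> borel_measurable borel"
proof -
  interpret finite_measure \<mu> by fact
  note [measurable_cong] = \<mu>(1)
  interpret P: pair_sigma_finite \<mu> lborel ..
  have corr: "correlation (distr \<mu> borel (\<lambda>x. x \<bullet> dir_vec \<theta>)) r = ennreal (1 / (2 * r)) * (\<integral>\<^sup>+ x. \<integral>\<^sup>+ y. indicator {..2 * r} \<bar>(x - y) \<bullet> dir_vec \<theta>\<bar> \<partial>\<mu> \<partial>\<mu>)" for \<theta>
  proof -
    interpret D: finite_measure "distr \<mu> borel (\<lambda>x. x \<bullet> dir_vec \<theta>)" by (rule finite_measure_distr) measurable
    have "(\<integral>\<^sup>+ s. \<integral>\<^sup>+ t. indicator {..2 * r} \<bar>s - t\<bar> \<partial>distr \<mu> borel (\<lambda>x. x \<bullet> dir_vec \<theta>) \<partial>distr \<mu> borel (\<lambda>x. x \<bullet> dir_vec \<theta>)) =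
      (\<integral>\<^sup>+ x. \<integral>\<^sup>+ t. indicator {..2 * r} \<bar>x \<bullet> dir_vec \<theta> - t\<bar> \<partial>distr \<mu> borel (\<lambda>x. x \<bullet> dir_vec \<theta>) \<partial>\<mu>)"
      by (rule nn_integral_distr) measurable
    also have "\<dots> = (\<integral>\<^sup>+ x. \<integral>\<^sup>+ y. indicator {..2 * r} \<bar>(x - y) \<bullet> dir_vec \<theta>\<bar> \<partial>\<mu> \<partial>\<mu>)"
      by (intro nn_integral_cong, subst nn_integral_distr) (simp_all add: inner_diff_left)
    finally show ?thesis by (simp add: correlation_def)
  qed
  show "(\<lambda>\<theta>. correlation (distr \<mu> borel (\<lambda>x. x \<bullet> dir_vec \<theta>)) r) \<in> borel_measurable borel"
    unfolding corr by measurable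
  have "(\<integral>\<^sup>+ \<theta>. correlation (distr \<mu> borel (\<lambda>x. x \<bullet> dir_vec \<theta>)) r * indicator {-real T..real T} \<theta> \<partial>lborel) =
    (\<integral>\<^sup>+ \<theta>. \<integral>\<^sup>+ x. \<integral>\<^sup>+ y. ennreal (1 / (2 * r)) * indicator {-real T..real T} \<theta> * indicator {..2 * r} \<bar>(x - y) \<bullet> dir_vec \<theta>\<bar> \<partial>\<mu> \<partial>\<mu> \<partial>lborel)"
    unfolding corr by (intro nn_integral_cong) (simp add: nn_integral_cmult mult_ac)
  also have "\<dots> = (\<integral>\<^sup>+ x. \<integral>\<^sup>+ \<theta>. \<integral>\<^sup>+ y. ennreal (1 / (2 * r)) * indicator {-real T..real T} \<theta> * indicator {..2 * r} \<bar>(x - y) \<bullet> dir_vec \<theta>\<bar> \<partial>\<mu> \<partial>lborel \<partial>\<mu>)"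
    by (rule P.Fubini') measurable
  also have "\<dots> = (\<integral>\<^sup>+ x. \<integral>\<^sup>+ y. \<integral>\<^sup>+ \<theta>. ennreal (1 / (2 * r)) * indicator {-real T..real T} \<theta> * indicator {..2 * r} \<bar>(x - y) \<bullet> dir_vec \<theta>\<bar> \<partial>lborel \<partial>\<mu> \<partial>\<mu>)"
    by (intro nn_integral_cong P.Fubini') measurable
  also have "\<dots> \<le> (\<integral>\<^sup>+ x. \<integral>\<^sup>+ y. ennreal (6 * (2 * real T + 19)) * dyadic_kernel (dist x y) \<partial>\<mu> \<partial>\<mu>)"
  proof (intro nn_integral_mono)
    fix x y :: "real \<times> real"
    show "(\<integral>\<^sup>+ \<theta>. ennreal (1 / (2 * r)) * indicator {-real T..real T} \<theta> * indicator {..2 * r} \<bar>(x - y) \<bullet> dir_vec \<theta>\<bar> \<partial>lborel) \<le>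
      ennreal (6 * (2 * real T + 19)) * dyadic_kernel (dist x y)"
    proof (cases "x = y")
      case True
      have "ennreal (6 * (2 * real T + 19)) * top = top" by (simp add: ennreal_mult_eq_top_iff)
      then show ?thesis using True by (simp add: dyadic_kernel_0)
    next
      case False
      let ?A = "{\<theta> \<in> {-real T..real T}. \<bar>(x - y) \<bullet> dir_vec \<theta>\<bar> \<le> 2 * r}"
      have A[measurable]: "?A \<in> sets lborel" by measurable
      have "(\<integral>\<^sup>+ \<theta>. ennreal (1 / (2 * r)) * indicator {-real T..real T} \<theta> * indicator {..2 * r} \<bar>(x - y) \<bullet> dir_vec \<theta>\<bar> \<partial>lborel) =
        (\<integral>\<^sup>+ \<theta>. ennreal (1 / (2 * r)) * indicator ?A \<theta> \<partial>lborel)"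
        by (intro nn_integral_cong) (auto simp: indicator_def)
      also have "\<dots> = ennreal (1 / (2 * r)) * emeasure lborel ?A" by (rule nn_integral_cmult_indicator) measurable
      also have "\<dots> \<le> ennreal (1 / (2 * r)) * ennreal (6 * (2 * real T + 19) * (2 * r / norm (x - y)))"
        using False r by (intro mult_left_mono transversality) auto
      also have "\<dots> = ennreal (1 / (2 * r) * (6 * (2 * real T + 19) * (2 * r / norm (x - y))))"
        using r by (intro ennreal_mult[symmetric]) auto
      also have "1 / (2 * r) * (6 * (2 * real T + 19) * (2 * r / norm (x - y))) = 6 * (2 * real T + 19) * (1 / dist x y)"
        using r by (simp add: dist_norm)
      also have "ennreal \<dots> = ennreal (6 * (2 * real T + 19)) * ennreal (1 / dist x y)"
        by (intro ennreal_mult) auto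
      also have "\<dots> \<le> ennreal (6 * (2 * real T + 19)) * dyadic_kernel (dist x y)"
        using False by (intro mult_left_mono inverse_le_dyadic_kernel) auto
      finally show ?thesis .
    qed
  qed
  also have "\<dots> = ennreal (6 * (2 * real T + 19)) * (\<integral>\<^sup>+ x. \<integral>\<^sup>+ y. dyadic_kernel (dist x y) \<partial>\<mu> \<partial>\<mu>)"
    by (simp add: nn_integral_cmult)
  finally show ?bound .
qed

text \<open>Fatou is applied on bounded windows of directions, since the transversality constant
  grows with T; countably many windows exhaust the line.\<close>

lemma AE_liminf_correlation:
  fixes \<mu> :: "(real \<times> real) measure"
  assumes \<mu>: "frostman C d \<mu>" "1 < d" "0 \<le> C"
  shows "AE \<theta> in lborel. liminf (\<lambda>n. correlation (distr \<mu> borel (\<lambda>x. x \<bullet> dir_vec \<theta>)) (1 / real (Suc n))) < \<infinity>"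
proof -
  have *: "sets \<mu> = sets borel" "finite_measure \<mu>" using \<mu> by (auto simp: frostman_def)
  define c where "c n \<theta> = correlation (distr \<mu> borel (\<lambda>x. x \<bullet> dir_vec \<theta>)) (1 / real (Suc n))" for n \<theta>
  have c[measurable]: "c n \<in> borel_measurable borel" for n
    unfolding c_def by (rule correlation_integral(2)[OF *]) simp
  have "AE \<theta> in lborel. liminf (\<lambda>n. c n \<theta> * indicator {-real T..real T} \<theta>) \<noteq> \<infinity>" for T :: nat
  proof (rule nn_integral_noteq_infinite)
    let ?B = "ennreal (6 * (2 * real T + 19)) * (\<integral>\<^sup>+ x. \<integral>\<^sup>+ y. dyadic_kernel (dist x y) \<partial>\<mu> \<partial>\<mu>)"
    have "(\<integral>\<^sup>+ \<theta>. liminf (\<lambda>n. c n \<theta> * indicator {-real T..real T} \<theta>) \<partial>lborel) \<le>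
      liminf (\<lambda>n. \<integral>\<^sup>+ \<theta>. c n \<theta> * indicator {-real T..real T} \<theta> \<partial>lborel)"
      by (rule nn_integral_liminf) measurable
    also have "\<dots> \<le> ?B"
      unfolding c_def by (intro Liminf_le always_eventually allI correlation_integral(1)[OF *]) auto
    also have "?B < \<infinity>" using frostman_energy[OF \<mu>] by (simp add: ennreal_mult_less_top)
    finally show "(\<integral>\<^sup>+ \<theta>. liminf (\<lambda>n. c n \<theta> * indicator {-real T..real T} \<theta>) \<partial>lborel) \<noteq> \<infinity>" by simp
  qed measurable
  then have "AE \<theta> in lborel. \<forall>T::nat. liminf (\<lambda>n. c n \<theta> * indicator {-real T..real T} \<theta>) \<noteq> \<infinity>"
    by (simp add: AE_all_countable)
  then have "AE \<theta> in lborel. liminf (\<lambda>n. c n \<theta>) < \<infinity>"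
  proof eventually_elim
    case (elim \<theta>)
    obtain T :: nat where "\<bar>\<theta>\<bar> \<le> real T" using real_arch_simple by blast
    then have "\<theta> \<in> {-real T..real T}" by auto
    then show ?case using elim[rule_format, of T] by (simp add: less_top)
  qed
  then show ?thesis unfolding c_def .
qed

section \<open>Measures on the line with bounded correlations\<close>


lemma ennreal_mult_le_sum_squares: "a * b \<le> a\<^sup>2 + (b::ennreal)\<^sup>2"
proof (cases "a \<le> b")
  case True
  then have "a * b \<le> b\<^sup>2" unfolding power2_eq_square by (rule mult_right_mono) simp
  then show ?thesis by (simp add: add_increasing)
next
  case False
  then have "a * b \<le> a\<^sup>2" unfolding power2_eq_square by (intro mult_left_mono) auto
  then show ?thesis by (simp add: add_increasing2)
qed

text \<open>Fatou controls only a lower limit, so the bound is required for arbitrarily small radii,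
  not for all of them.\<close>

locale bounded_correlation =
  fixes \<nu> :: "real measure" and M :: real
  assumes sets_\<nu>: "sets \<nu> = sets borel" and fin: "finite_measure \<nu>" and M: "0 \<le> M"
    and bound: "\<And>\<epsilon>. 0 < \<epsilon> \<Longrightarrow> \<exists>r. 0 < r \<and> r < \<epsilon> \<and> correlation \<nu> r \<le> ennreal M"
begin

sublocale finite_measure \<nu> by (rule fin)

lemmas [measurable_cong] = sets_\<nu>

lemma space_\<nu>: "space \<nu> = UNIV" using sets_eq_imp_space_eq[OF sets_\<nu>] by simp

sublocale P: pair_sigma_finite \<nu> lborel ..

text \<open>Fubini moves the averaging from g to \<nu>. The product of g with the averaged \<nu> is
  bounded by the sum of squares, and the square of the averaged \<nu> integrates to at most the
  correlation.\<close>

lemma mean_bound: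
  fixes g :: "real \<Rightarrow> ennreal"
  assumes [measurable]: "g \<in> borel_measurable borel" and r: "0 < r"
  shows "(\<integral>\<^sup>+ x. (\<integral>\<^sup>+ t. ennreal (1 / (2 * r)) * (g t * indicator {..r} \<bar>x - t\<bar>) \<partial>lborel) \<partial>\<nu>)
    \<le> (\<integral>\<^sup>+ t. (g t)\<^sup>2 \<partial>lborel) + correlation \<nu> r"
proof -
  let ?c = "ennreal (1 / (2 * r))"
  define N where "N t = (\<integral>\<^sup>+ x. indicator {..r} \<bar>x - t\<bar> \<partial>\<nu>)" for t
  have [measurable]: "N \<in> borel_measurable borel" unfolding N_def by measurable
  have "(\<integral>\<^sup>+ x. (\<integral>\<^sup>+ t. ?c * (g t * indicator {..r} \<bar>x - t\<bar>) \<partial>lborel) \<partial>\<nu>)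
     = (\<integral>\<^sup>+ t. (\<integral>\<^sup>+ x. ?c * (g t * indicator {..r} \<bar>x - t\<bar>) \<partial>\<nu>) \<partial>lborel)"
    by (rule P.Fubini'[symmetric]) measurable
  also have "\<dots> = (\<integral>\<^sup>+ t. g t * (?c * N t) \<partial>lborel)"
  proof (rule nn_integral_cong)
    fix t
    have "(\<integral>\<^sup>+ x. ?c * (g t * indicator {..r} \<bar>x - t\<bar>) \<partial>\<nu>) = (\<integral>\<^sup>+ x. (?c * g t) * indicator {..r} \<bar>x - t\<bar> \<partial>\<nu>)"
      by (simp only: mult.assoc)
    also have "\<dots> = (?c * g t) * N t" unfolding N_def by (rule nn_integral_cmult) measurable
    finally show "(\<integral>\<^sup>+ x. ?c * (g t * indicator {..r} \<bar>x - t\<bar>) \<partial>\<nu>) = g t * (?c * N t)" by (simp only: mult_ac)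
  qed
  also have "\<dots> \<le> (\<integral>\<^sup>+ t. (g t)\<^sup>2 + (?c * N t)\<^sup>2 \<partial>lborel)"
    by (intro nn_integral_mono ennreal_mult_le_sum_squares)
  also have "\<dots> = (\<integral>\<^sup>+ t. (g t)\<^sup>2 \<partial>lborel) + (\<integral>\<^sup>+ t. (?c * N t)\<^sup>2 \<partial>lborel)"
    by (rule nn_integral_add) measurable
  also have "(\<integral>\<^sup>+ t. (?c * N t)\<^sup>2 \<partial>lborel) =
    (\<integral>\<^sup>+ t. (\<integral>\<^sup>+ x. \<integral>\<^sup>+ y. ?c\<^sup>2 * (indicator {..r} \<bar>x - t\<bar> * indicator {..r} \<bar>y - t\<bar>) \<partial>\<nu> \<partial>\<nu>) \<partial>lborel)"
    unfolding N_def
    by (simp add: nn_integral_cmult nn_integral_multc power_mult_distrib power2_eq_square mult_ac)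
  also have "\<dots> = (\<integral>\<^sup>+ x. (\<integral>\<^sup>+ t. \<integral>\<^sup>+ y. ?c\<^sup>2 * (indicator {..r} \<bar>x - t\<bar> * indicator {..r} \<bar>y - t\<bar>) \<partial>\<nu> \<partial>lborel) \<partial>\<nu>)"
    by (rule P.Fubini') measurable
  also have "\<dots> = (\<integral>\<^sup>+ x. (\<integral>\<^sup>+ y. \<integral>\<^sup>+ t. ?c\<^sup>2 * (indicator {..r} \<bar>x - t\<bar> * indicator {..r} \<bar>y - t\<bar>) \<partial>lborel \<partial>\<nu>) \<partial>\<nu>)"
    by (intro nn_integral_cong P.Fubini') measurable
  \<comment> \<open>The overlap of the intervals about x and y has length at most 2 * r, which turns
    \<open>?c\<^sup>2\<close> into \<open>?c\<close>, and is empty for distant centres.\<close>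
  also have "\<dots> \<le> (\<integral>\<^sup>+ x. (\<integral>\<^sup>+ y. ?c * indicator {..2 * r} \<bar>x - y\<bar> \<partial>\<nu>) \<partial>\<nu>)"
  proof (intro nn_integral_mono)
    fix x y :: real
    show "(\<integral>\<^sup>+ t. ?c\<^sup>2 * (indicator {..r} \<bar>x - t\<bar> * indicator {..r} \<bar>y - t\<bar>) \<partial>lborel) \<le> ?c * indicator {..2 * r} \<bar>x - y\<bar>"
    proof (cases "\<bar>x - y\<bar> \<le> 2 * r")
      case True
      have "(\<integral>\<^sup>+ t. ?c\<^sup>2 * (indicator {..r} \<bar>x - t\<bar> * indicator {..r} \<bar>y - t\<bar>) \<partial>lborel) \<le>
        (\<integral>\<^sup>+ t. ?c\<^sup>2 * indicator {x - r..x + r} t \<partial>lborel)"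
        by (intro nn_integral_mono) (auto simp: indicator_def)
      also have "\<dots> = ?c\<^sup>2 * ennreal (2 * r)" using r by (subst nn_integral_cmult_indicator) auto
      also have "\<dots> = ?c" using r by (simp add: power2_eq_square flip: ennreal_mult)
      finally show ?thesis using True by simp
    next
      case False
      then have "\<not> \<bar>x - t\<bar> \<le> r \<or> \<not> \<bar>y - t\<bar> \<le> r" for t by linarith
      then have zero: "indicator {..r} \<bar>x - t\<bar> * indicator {..r} \<bar>y - t\<bar> = (0::ennreal)" for t
        by (metis atMost_iff indicator_simps(2) mult_zero_left mult_zero_right)
      show ?thesis unfolding zero by simp
    qed
  qed
  also have "\<dots> = correlation \<nu> r" by (simp add: correlation_def nn_integral_cmult)
  finally show ?thesis by (simp add: add_left_mono)
qed

text \<open>Near a point where g exceeds c, all averages over small intervals are at least c. So g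
  is at most the lower limit of its averages, and Fatou passes to \<nu>.\<close>

lemma lsc_integral_le:
  fixes g :: "real \<Rightarrow> ennreal"
  assumes lsc: "\<And>c. open {t. c < g t}"
  shows "(\<integral>\<^sup>+ x. g x \<partial>\<nu>) \<le> (\<integral>\<^sup>+ t. (g t)\<^sup>2 \<partial>lborel) + ennreal M"
proof -
  have g[measurable]: "g \<in> borel_measurable borel"
    using lsc by (intro borel_measurableI_greater) auto
  have "\<exists>r. \<forall>n. 0 < r n \<and> r n < 1 / real (Suc n) \<and> correlation \<nu> (r n) \<le> ennreal M"
    by (intro choice allI bound) simp
  then obtain r where r: "\<And>n. 0 < r n" "\<And>n. r n < 1 / real (Suc n)" "\<And>n. correlation \<nu> (r n) \<le> ennreal M" by blast
  define A where "A n x = (\<integral>\<^sup>+ t. ennreal (1 / (2 * r n)) * (g t * indicator {..r n} \<bar>x - t\<bar>) \<partial>lborel)" for n x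
  have [measurable]: "A n \<in> borel_measurable borel" for n unfolding A_def by measurable
  have "g x \<le> liminf (\<lambda>n. A n x)" for x
    unfolding le_Liminf_iff
  proof (intro allI impI)
    fix y assume "y < g x"
    \<comment> \<open>The averages are only shown to be at least c, so a value strictly above y is
      inserted.\<close>
    then obtain c where c: "y < c" "c < g x" using dense by blast
    then have "x \<in> {t. c < g t}" by simp
    then obtain \<delta> where \<delta>: "0 < \<delta>" "ball x \<delta> \<subseteq> {t. c < g t}" using lsc[of c] unfolding open_contains_ball by blast
    obtain n0 where n0: "1 / real (Suc n0) < \<delta>" using nat_approx_posE[OF \<delta>(1)] by blast
    have "y < A n x" if n: "n0 \<le> n" for n
    proof -
      have "1 / real (Suc n) \<le> 1 / real (Suc n0)" using n by (intro divide_left_mono) auto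
      then have rd: "r n < \<delta>" using r(2)[of n] n0 by simp
      have "c = ennreal (1 / (2 * r n)) * c * ennreal (2 * r n)"
      proof -
        have "ennreal (1 / (2 * r n)) * ennreal (2 * r n) = 1" using r(1)[of n] by (simp flip: ennreal_mult)
        then show ?thesis by (metis mult.left_commute mult.right_neutral mult.commute)
      qed
      also have "\<dots> = (\<integral>\<^sup>+ t. ennreal (1 / (2 * r n)) * c * indicator {x - r n..x + r n} t \<partial>lborel)"
        using r(1)[of n] by (subst nn_integral_cmult_indicator) auto
      also have "\<dots> \<le> A n x"
        unfolding A_def mult.assoc
      proof (intro nn_integral_mono mult_left_mono)
        fix t show "c * indicator {x - r n..x + r n} t \<le> g t * indicator {..r n} \<bar>x - t\<bar>"
        proof (cases "t \<in> {x - r n..x + r n}")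
          case True
          then have "t \<in> ball x \<delta>" using rd by (auto simp: dist_real_def)
          then have "c < g t" using \<delta> by auto
          moreover have "\<bar>x - t\<bar> \<le> r n" using True by auto
          ultimately show ?thesis using True by simp
        qed simp
      qed simp
      finally show ?thesis using c by simp
    qed
    then show "\<forall>\<^sub>F n in sequentially. y < A n x" unfolding eventually_sequentially by blast
  qed
  then have "(\<integral>\<^sup>+ x. g x \<partial>\<nu>) \<le> (\<integral>\<^sup>+ x. liminf (\<lambda>n. A n x) \<partial>\<nu>)" by (rule nn_integral_mono)
  also have "\<dots> \<le> liminf (\<lambda>n. \<integral>\<^sup>+ x. A n x \<partial>\<nu>)" by (rule nn_integral_liminf) measurable
  also have "\<dots> \<le> (\<integral>\<^sup>+ t. (g t)\<^sup>2 \<partial>lborel) + ennreal M"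
  proof (intro Liminf_le always_eventually allI)
    fix n
    have "(\<integral>\<^sup>+ x. A n x \<partial>\<nu>) \<le> (\<integral>\<^sup>+ t. (g t)\<^sup>2 \<partial>lborel) + correlation \<nu> (r n)"
      unfolding A_def by (rule mean_bound[OF g r(1)])
    also have "\<dots> \<le> (\<integral>\<^sup>+ t. (g t)\<^sup>2 \<partial>lborel) + ennreal M" by (rule add_left_mono[OF r(3)])
    finally show "(\<integral>\<^sup>+ x. A n x \<partial>\<nu>) \<le> (\<integral>\<^sup>+ t. (g t)\<^sup>2 \<partial>lborel) + ennreal M" .
  qed simp
  finally show ?thesis .
qed

text \<open>Test with k times the indicator of an open superset of measure below 1 / k^2: the
  quadratic term stays below 1, while the left side is at least k times the mass of A.\<close>

lemma null_sets_lborel_imp_null: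
  assumes A: "A \<in> null_sets lborel"
  shows "emeasure \<nu> A = 0"
proof -
  have [measurable]: "A \<in> sets borel" and A0: "emeasure lborel A = 0" using A by auto
  have k: "real k * measure \<nu> A \<le> 1 + M" if k: "0 < k" for k :: nat
  proof -
    obtain G where G: "open G" "A \<subseteq> G" "emeasure lborel (G - A) < 1 / (real k)\<^sup>2"
      using outer_regular_lborel[of A "1 / (real k)\<^sup>2"] k by auto
    have Gb[measurable]: "G \<in> sets borel" using G(1) by simp
    have "emeasure lborel G \<le> emeasure lborel (G - A) + emeasure lborel A"
    proof -
      have "emeasure lborel ((G - A) \<union> A) \<le> emeasure lborel (G - A) + emeasure lborel A"
        by (rule emeasure_subadditive) auto
      then show ?thesis using G(2) by (simp add: Un_absorb2)
    qed
    then have Gm: "emeasure lborel G \<le> ennreal (1 / (real k)\<^sup>2)" using A0 G(3) by simp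
    have "(\<integral>\<^sup>+ t. (ennreal (real k) * indicator G t)\<^sup>2 \<partial>lborel) = (\<integral>\<^sup>+ t. ennreal ((real k)\<^sup>2) * indicator G t \<partial>lborel)"
      by (intro nn_integral_cong) (auto simp: indicator_def ennreal_power)
    also have "\<dots> = ennreal ((real k)\<^sup>2) * emeasure lborel G" by (rule nn_integral_cmult_indicator) simp
    also have "\<dots> \<le> ennreal ((real k)\<^sup>2) * ennreal (1 / (real k)\<^sup>2)" by (rule mult_left_mono[OF Gm]) simp
    also have "\<dots> = 1" using k by (simp flip: ennreal_mult)
    finally have sq: "(\<integral>\<^sup>+ t. (ennreal (real k) * indicator G t)\<^sup>2 \<partial>lborel) \<le> 1" .
    have "ennreal (real k) * emeasure \<nu> A \<le> ennreal (real k) * emeasure \<nu> G"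
      using G(2) by (intro mult_left_mono emeasure_mono) (auto simp: sets_\<nu>)
    also have "\<dots> = (\<integral>\<^sup>+ x. ennreal (real k) * indicator G x \<partial>\<nu>)"
      by (rule nn_integral_cmult_indicator[symmetric]) measurable
    also have "\<dots> \<le> (\<integral>\<^sup>+ t. (ennreal (real k) * indicator G t)\<^sup>2 \<partial>lborel) + ennreal M"
    proof (rule lsc_integral_le)
      fix c
      have "{t. c < ennreal (real k) * indicator G t} = (if c < ennreal (real k) then G else {})"
        by (auto simp: indicator_def)
      then show "open {t. c < ennreal (real k) * indicator G t}" using G(1) by simp
    qed
    also have "\<dots> \<le> 1 + ennreal M" by (rule add_right_mono[OF sq])
    also have "1 + ennreal M = ennreal (1 + M)" using M by simp
    also have "ennreal (real k) * emeasure \<nu> A = ennreal (real k * measure \<nu> A)"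
      by (simp add: emeasure_eq_measure ennreal_mult)
    finally show ?thesis using M by (subst (asm) ennreal_le_iff) auto
  qed
  have "measure \<nu> A = 0"
  proof (rule ccontr)
    assume "measure \<nu> A \<noteq> 0"
    then have pos: "0 < measure \<nu> A" by (simp add: zero_less_measure_iff)
    obtain k where "1 + M < real k * measure \<nu> A" using reals_Archimedean3[OF pos] by blast
    moreover from this M have "0 < k" by (cases k) auto
    ultimately show False using k[of k] by simp
  qed
  then show ?thesis by (simp add: emeasure_eq_measure)
qed

text \<open>Continuous functions converge to f off a Lebesgue null set, which is also \<nu>-null by
  \<open>null_sets_lborel_imp_null\<close>. Dominated convergence handles the Lebesgue side and
  Fatou the side of \<nu>.\<close>

lemma bounded_integral_le:
  fixes f :: "real \<Rightarrow> real"
  assumes f[measurable]: "f \<in> borel_measurable borel" and B: "\<And>t. 0 \<le> f t" "\<And>t. f t \<le> B"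
    and supp: "\<And>t. B < \<bar>t\<bar> \<Longrightarrow> f t = 0"
  shows "(\<integral>\<^sup>+ x. ennreal (f x) \<partial>\<nu>) \<le> (\<integral>\<^sup>+ t. ennreal ((f t)\<^sup>2) \<partial>lborel) + ennreal M"
proof -
  have "f measurable_on UNIV" by (intro lebesgue_measurable_imp_measurable_on measurable_completion) auto
  then obtain N g where N: "negligible N" and g: "\<And>n. continuous_on UNIV (g n)"
    "\<And>x. x \<notin> N \<Longrightarrow> (\<lambda>n. g n x) \<longlonglongrightarrow> f x"
    unfolding measurable_on_def by (auto simp: simp del: not_all)
  \<comment> \<open>N is null for the completed measure; \<nu> sees only Borel sets, so a Borel null
    superset is taken.\<close>
  obtain N' where N': "N' \<in> null_sets lborel" "N \<subseteq> N'"
    using N by (metis negligible_iff_null_sets null_sets_completion_iff2)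
  have B0: "0 \<le> B" using B(1)[of 0] B(2)[of 0] by simp
  \<comment> \<open>Clipping to the range from 0 to B and multiplying by a trapezoid, equal to 1 up
    to B and 0 beyond B + 1, gives an integrable majorant without changing the limit f.\<close>
  define h where "h n t = max 0 (min 1 (B + 1 - \<bar>t\<bar>)) * max 0 (min B (g n t))" for n t
  have hc: "continuous_on UNIV (h n)" for n
    unfolding h_def using g(1) by (intro continuous_intros) auto
  have [measurable]: "h n \<in> borel_measurable borel" for n by (rule borel_measurable_continuous_onI[OF hc])
  have h0: "0 \<le> h n t" for n t by (simp add: h_def)
  have hB: "h n t \<le> B * indicator {-(B + 1)..B + 1} t" for n t
  proof (cases "\<bar>t\<bar> \<le> B + 1")
    case True
    have "h n t \<le> 1 * B" unfolding h_def using B0 by (intro mult_mono) auto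
    then show ?thesis using True by (auto simp: indicator_def)
  qed (auto simp: h_def indicator_def)
  have lim: "(\<lambda>n. h n t) \<longlonglongrightarrow> f t" if "t \<notin> N'" for t
  proof -
    have "(\<lambda>n. h n t) \<longlonglongrightarrow> max 0 (min 1 (B + 1 - \<bar>t\<bar>)) * max 0 (min B (f t))"
      unfolding h_def using g(2)[of t] that N'(2) by (intro tendsto_intros) auto
    also have "max 0 (min 1 (B + 1 - \<bar>t\<bar>)) * max 0 (min B (f t)) = f t"
      using B[of t] supp[of t] by (cases "B < \<bar>t\<bar>") (auto simp: min_def max_def)
    finally show ?thesis .
  qed
  have AEl: "AE t in lborel. t \<notin> N'" by (rule AE_not_in[OF N'(1)])
  have AE\<nu>: "AE t in \<nu>. t \<notin> N'"
    using N'(1) null_sets_lborel_imp_null[OF N'(1)] by (intro AE_not_in) (auto simp: null_sets_def sets_\<nu>)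
  have sq: "(\<lambda>n. \<integral>\<^sup>+ t. ennreal ((h n t)\<^sup>2) \<partial>lborel) \<longlonglongrightarrow> (\<integral>\<^sup>+ t. ennreal ((f t)\<^sup>2) \<partial>lborel)"
  proof (rule nn_integral_dominated_convergence[where w = "\<lambda>t. ennreal (B\<^sup>2) * indicator {-(B + 1)..B + 1} t"])
    fix n
    show "AE t in lborel. ennreal ((h n t)\<^sup>2) \<le> ennreal (B\<^sup>2) * indicator {-(B + 1)..B + 1} t"
    proof (rule AE_I2)
      fix t show "ennreal ((h n t)\<^sup>2) \<le> ennreal (B\<^sup>2) * indicator {-(B + 1)..B + 1} t"
      proof (cases "t \<in> {-(B + 1)..B + 1}")
        case True
        then have "h n t \<le> B" using hB[of n t] by simp
        then have "(h n t)\<^sup>2 \<le> B\<^sup>2" using h0 by (rule power_mono)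
        then show ?thesis using True by (simp add: ennreal_leI)
      next
        case False
        then have "h n t = 0" using hB[of n t] h0[of n t] by simp
        then show ?thesis by simp
      qed
    qed
  next
    show "(\<integral>\<^sup>+ t. ennreal (B\<^sup>2) * indicator {-(B + 1)..B + 1} t \<partial>lborel) < \<infinity>"
      by (subst nn_integral_cmult_indicator) (auto simp: emeasure_lborel_Icc_eq ennreal_mult_less_top)
    show "AE t in lborel. (\<lambda>n. ennreal ((h n t)\<^sup>2)) \<longlonglongrightarrow> ennreal ((f t)\<^sup>2)"
      using AEl by eventually_elim (intro tendsto_intros lim)
  qed measurable
  have "(\<integral>\<^sup>+ x. ennreal (f x) \<partial>\<nu>) \<le> (\<integral>\<^sup>+ x. liminf (\<lambda>n. ennreal (h n x)) \<partial>\<nu>)"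
  proof (rule nn_integral_mono_AE)
    show "AE x in \<nu>. ennreal (f x) \<le> liminf (\<lambda>n. ennreal (h n x))"
      using AE\<nu>
    proof eventually_elim
      case (elim x)
      have "(\<lambda>n. ennreal (h n x)) \<longlonglongrightarrow> ennreal (f x)" using lim[OF elim] by (intro tendsto_intros)
      then show ?case using lim_imp_Liminf[OF sequentially_bot] by (metis order_refl)
    qed
  qed
  also have "\<dots> \<le> liminf (\<lambda>n. \<integral>\<^sup>+ x. ennreal (h n x) \<partial>\<nu>)" by (rule nn_integral_liminf) measurable
  also have "\<dots> \<le> liminf (\<lambda>n. (\<integral>\<^sup>+ t. ennreal ((h n t)\<^sup>2) \<partial>lborel) + ennreal M)"
  proof (intro Liminf_mono always_eventually allI)
    fix n
    have "continuous_on UNIV (\<lambda>t. ennreal (h n t))" by (intro continuous_on_ennreal hc)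
    then have "open {t. c < ennreal (h n t)}" for c by (intro open_Collect_less) auto
    from lsc_integral_le[OF this]
    show "(\<integral>\<^sup>+ x. ennreal (h n x) \<partial>\<nu>) \<le> (\<integral>\<^sup>+ t. ennreal ((h n t)\<^sup>2) \<partial>lborel) + ennreal M"
      using h0 by (simp add: ennreal_power)
  qed
  also have "\<dots> = (\<integral>\<^sup>+ t. ennreal ((f t)\<^sup>2) \<partial>lborel) + ennreal M"
    by (intro lim_imp_Liminf tendsto_add sq tendsto_const) simp
  finally show ?thesis .
qed

text \<open>The duality bound lacks the factor 2 of \<open>2 a b \<le> a\<^sup>2 + b\<^sup>2\<close>; this is why it is applied to half the
  truncated density, so that the quadratic terms do not cancel.\<close>

lemma density_square_integrable:
  assumes \<phi>[measurable]: "\<phi> \<in> borel_measurable borel" and dens: "density lborel \<phi> = \<nu>"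
  shows "(\<integral>\<^sup>+ t. (\<phi> t)\<^sup>2 \<partial>lborel) \<le> ennreal (4 * M)"
proof -
  define f where "f n t = enn2real (min (\<phi> t) (of_nat n)) * indicator {-real n..real n} t" for n t
  have [measurable]: "f n \<in> borel_measurable borel" for n unfolding f_def by measurable
  have ef: "ennreal (f n t) = min (\<phi> t) (of_nat n) * indicator {-real n..real n} t" for n t
  proof -
    have "min (\<phi> t) (of_nat n) < top" by (simp add: min_less_iff_disj of_nat_less_top)
    then show ?thesis by (auto simp: f_def indicator_def)
  qed
  have f0: "0 \<le> f n t" for n t by (simp add: f_def)
  have fn: "f n t \<le> real n" for n t
  proof -
    have "ennreal (f n t) \<le> ennreal (real n)"
      unfolding ef by (auto simp: indicator_def ennreal_of_nat_eq_real_of_nat)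
    then show ?thesis by simp
  qed
  have sq: "(\<integral>\<^sup>+ t. ennreal ((f n t)\<^sup>2) \<partial>lborel) \<le> ennreal (4 * M)" for n
  proof -
    define I where "I = (\<integral>\<^sup>+ t. ennreal ((f n t)\<^sup>2) \<partial>lborel)"
    \<comment> \<open>Finiteness of I, guaranteed by the truncation, is what later allows I / 4 to
      be subtracted.\<close>
    have "I \<le> (\<integral>\<^sup>+ t. ennreal ((real n)\<^sup>2) * indicator {-real n..real n} t \<partial>lborel)"
      unfolding I_def
    proof (intro nn_integral_mono)
      fix t show "ennreal ((f n t)\<^sup>2) \<le> ennreal ((real n)\<^sup>2) * indicator {-real n..real n} t"
        using power_mono[OF fn f0, of n t 2]
        by (cases "t \<in> {-real n..real n}") (auto simp: f_def intro!: ennreal_leI)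
    qed
    also have "\<dots> < top"
      by (subst nn_integral_cmult_indicator) (auto simp: emeasure_lborel_Icc_eq ennreal_mult_less_top)
    finally obtain i where i: "I = ennreal i" "0 \<le> i" by (cases I) auto
    have "(\<integral>\<^sup>+ x. ennreal (f n x / 2) \<partial>\<nu>) \<le> (\<integral>\<^sup>+ t. ennreal ((f n t / 2)\<^sup>2) \<partial>lborel) + ennreal M"
    proof (rule bounded_integral_le[where B = "real n"])
      show "f n t / 2 \<le> real n" for t using fn[of n t] f0[of n t] by linarith
      show "f n t / 2 = 0" if "real n < \<bar>t\<bar>" for t using that by (auto simp: f_def indicator_def)
    qed (use f0 in auto)
    also have "(\<integral>\<^sup>+ t. ennreal ((f n t / 2)\<^sup>2) \<partial>lborel) = (\<integral>\<^sup>+ t. ennreal (1/4) * ennreal ((f n t)\<^sup>2) \<partial>lborel)"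
      by (intro nn_integral_cong) (simp add: power_divide flip: ennreal_mult)
    also have "\<dots> = ennreal (1/4) * I" unfolding I_def by (rule nn_integral_cmult) measurable
    finally have up: "(\<integral>\<^sup>+ x. ennreal (f n x / 2) \<partial>\<nu>) \<le> ennreal (1/4) * I + ennreal M" .
    \<comment> \<open>As \<open>f n\<close> is at most \<phi>, integrating half of it against \<nu>
      yields at least I / 2. With the upper bound I / 4 + M this gives 4 * M.\<close>
    have "ennreal (1/2) * I = (\<integral>\<^sup>+ t. ennreal (1/2) * ennreal ((f n t)\<^sup>2) \<partial>lborel)"
      unfolding I_def by (rule nn_integral_cmult[symmetric]) measurable
    also have "\<dots> \<le> (\<integral>\<^sup>+ t. \<phi> t * ennreal (f n t / 2) \<partial>lborel)"
    proof (rule nn_integral_mono)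
      fix t
      have "ennreal (1/2) * ennreal ((f n t)\<^sup>2) = ennreal (f n t) * ennreal (f n t / 2)"
      proof -
        have "ennreal (1/2) * ennreal ((f n t)\<^sup>2) = ennreal (1/2 * (f n t)\<^sup>2)"
          by (intro ennreal_mult[symmetric]) auto
        also have "1/2 * (f n t)\<^sup>2 = f n t * (f n t / 2)" by (simp add: power2_eq_square)
        also have "ennreal \<dots> = ennreal (f n t) * ennreal (f n t / 2)" using f0 by (intro ennreal_mult) auto
        finally show ?thesis .
      qed
      also have "\<dots> \<le> \<phi> t * ennreal (f n t / 2)"
        unfolding ef[of n t] by (intro mult_right_mono) (auto simp: indicator_def)
      finally show "ennreal (1/2) * ennreal ((f n t)\<^sup>2) \<le> \<phi> t * ennreal (f n t / 2)" .
    qed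
    also have "\<dots> = (\<integral>\<^sup>+ t. ennreal (f n t / 2) \<partial>density lborel \<phi>)"
      by (rule nn_integral_density[symmetric]) measurable
    also have "\<dots> = (\<integral>\<^sup>+ x. ennreal (f n x / 2) \<partial>\<nu>)" unfolding dens ..
    also note up
    finally have "ennreal (1/2) * ennreal i \<le> ennreal (1/4) * ennreal i + ennreal M" unfolding i(1) .
    moreover have "ennreal (1/2 * i) = ennreal (1/2) * ennreal i" using i(2) by (intro ennreal_mult) auto
    moreover have "ennreal (1/4 * i) = ennreal (1/4) * ennreal i" using i(2) by (intro ennreal_mult) auto
    moreover have "ennreal (1/4 * i + M) = ennreal (1/4 * i) + ennreal M" using i(2) M by (intro ennreal_plus) auto
    ultimately have "ennreal (1/2 * i) \<le> ennreal (1/4 * i + M)" by (simp only:)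
    then have "1/2 * i \<le> 1/4 * i + M" using i(2) M by (subst (asm) ennreal_le_iff) auto
    then have "i \<le> 4 * M" by simp
    then show ?thesis using i(1) by (simp add: I_def ennreal_leI)
  qed
  have "(\<phi> t)\<^sup>2 \<le> liminf (\<lambda>n. ennreal ((f n t)\<^sup>2))" for t
  proof -
    have "\<forall>\<^sub>F n in sequentially. \<bar>t\<bar> \<le> real n"
      using filterlim_real_sequentially unfolding filterlim_at_top by blast
    then have "\<forall>\<^sub>F n in sequentially. ennreal ((f n t)\<^sup>2) = (min (\<phi> t) (of_nat n))\<^sup>2"
    proof eventually_elim
      case (elim n)
      then have "t \<in> {-real n..real n}" by auto
      then show ?case using ef[of n t] f0[of n t] by (simp add: ennreal_power[symmetric])
    qed
    moreover have "(\<lambda>n. (min (\<phi> t) (of_nat n))\<^sup>2) \<longlonglongrightarrow> (\<phi> t)\<^sup>2"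
    proof -
      have "(\<lambda>n. min (\<phi> t) (of_nat n)) \<longlonglongrightarrow> min (\<phi> t) top"
        by (intro tendsto_min tendsto_const of_nat_tendsto_top_ennreal)
      then have "(\<lambda>n. min (\<phi> t) (of_nat n)) \<longlonglongrightarrow> \<phi> t" by simp
      from tendsto_mult_ennreal[OF this this] show ?thesis by (auto simp: power2_eq_square)
    qed
    ultimately have "(\<lambda>n. ennreal ((f n t)\<^sup>2)) \<longlonglongrightarrow> (\<phi> t)\<^sup>2" by (simp add: tendsto_cong)
    then show ?thesis using lim_imp_Liminf[OF sequentially_bot] by (metis order_refl)
  qed
  then have "(\<integral>\<^sup>+ t. (\<phi> t)\<^sup>2 \<partial>lborel) \<le> (\<integral>\<^sup>+ t. liminf (\<lambda>n. ennreal ((f n t)\<^sup>2)) \<partial>lborel)" by (rule nn_integral_mono)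
  also have "\<dots> \<le> liminf (\<lambda>n. \<integral>\<^sup>+ t. ennreal ((f n t)\<^sup>2) \<partial>lborel)" by (rule nn_integral_liminf) measurable
  also have "\<dots> \<le> ennreal (4 * M)" using sq by (intro Liminf_le always_eventually) auto
  finally show ?thesis .
qed

end

section \<open>Projections\<close>


lemma dir_vec_inner_self [simp]: "dir_vec \<theta> \<bullet> dir_vec \<theta> = 1"
  by (simp add: dot_square_norm)

lemma scaleR_dir_vec_measurable: "(\<lambda>t. t *\<^sub>R dir_vec \<theta>) \<in> measurable borel (restrict_space borel (line \<theta>))"
  by (intro measurable_restrict_space2) (auto simp: line_def span_mul span_base)

lemma inner_dir_vec_measurable: "(\<lambda>y. y \<bullet> dir_vec \<theta>) \<in> measurable (restrict_space borel (line \<theta>)) borel"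
  by (intro measurable_restrict_space1) simp

text \<open>Taking the inner product with the unit vector inverts the parametrization of the line,
  so statements on the line transfer to the reals and back.\<close>

lemma distr_line_inverse:
  assumes "sets N = sets borel"
  shows "distr (distr N (restrict_space borel (line \<theta>)) (\<lambda>t. t *\<^sub>R dir_vec \<theta>)) borel (\<lambda>y. y \<bullet> dir_vec \<theta>) = N"
proof -
  have "distr (distr N (restrict_space borel (line \<theta>)) (\<lambda>t. t *\<^sub>R dir_vec \<theta>)) borel (\<lambda>y. y \<bullet> dir_vec \<theta>) =
      distr N borel ((\<lambda>y. y \<bullet> dir_vec \<theta>) \<circ> (\<lambda>t. t *\<^sub>R dir_vec \<theta>))"
    using scaleR_dir_vec_measurable by (intro distr_distr inner_dir_vec_measurable) (simp add: measurable_cong_sets[OF assms refl])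
  also have "\<dots> = distr N borel (\<lambda>t. t)" by (intro distr_cong) auto
  also have "\<dots> = N" by (rule distr_id2) (simp add: assms)
  finally show ?thesis .
qed

text \<open>Sigma-finiteness is what makes \<open>RN_deriv\<close> an actual density.\<close>

lemma sigma_finite_lebesgue_line: "sigma_finite_measure (lebesgue_line \<theta>)"
proof (rule sigma_finite_measure_distr)
  show "(\<lambda>y. y \<bullet> dir_vec \<theta>) \<in> measurable (lebesgue_line \<theta>) borel"
    using inner_dir_vec_measurable by (simp add: lebesgue_line_def)
  have "distr (lebesgue_line \<theta>) borel (\<lambda>y. y \<bullet> dir_vec \<theta>) = lborel"
    unfolding lebesgue_line_def by (rule distr_line_inverse) simp
  then show "sigma_finite_measure (distr (lebesgue_line \<theta>) borel (\<lambda>y. y \<bullet> dir_vec \<theta>))"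
    by (simp add: lborel.sigma_finite_measure_axioms)
qed

text \<open>The projection factors through the coordinate on the line. Writing the restriction as a
  density keeps the whole plane as the underlying space, as the energy estimates assume.\<close>

lemma proj_measure_eq_distr:
  assumes Q[measurable]: "Q \<in> sets borel"
  shows "proj_measure d Q \<theta> =
    distr (distr (density (hausdorff_measure d) (indicator Q)) borel (\<lambda>x. x \<bullet> dir_vec \<theta>))
      (restrict_space borel (line \<theta>)) (\<lambda>t. t *\<^sub>R dir_vec \<theta>)"
proof -
  let ?N = "restrict_space borel (line \<theta>)" and ?H = "hausdorff_measure d :: (real \<times> real) measure"
  have proj_borel[measurable]: "proj \<theta> \<in> measurable borel ?N"
    by (intro measurable_restrict_space2 funcsetI proj_orthogonal(1)) (simp add: proj_def[abs_def])
  have "distr (distr (density ?H (indicator Q)) borel (\<lambda>x. x \<bullet> dir_vec \<theta>)) ?N (\<lambda>t. t *\<^sub>R dir_vec \<theta>) =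
      distr (density ?H (indicator Q)) ?N ((\<lambda>t. t *\<^sub>R dir_vec \<theta>) \<circ> (\<lambda>x. x \<bullet> dir_vec \<theta>))"
    by (intro distr_distr scaleR_dir_vec_measurable) measurable
  also have "(\<lambda>t. t *\<^sub>R dir_vec \<theta>) \<circ> (\<lambda>x. x \<bullet> dir_vec \<theta>) = proj \<theta>" by (auto simp: proj_def)
  also have "distr (density ?H (indicator Q)) ?N (proj \<theta>) = proj_measure d Q \<theta>"
    unfolding proj_measure_def
  proof (rule measure_eqI)
    fix A assume "A \<in> sets (distr (density ?H (indicator Q)) ?N (proj \<theta>))"
    then have A[measurable]: "A \<in> sets ?N" by simp
    have pA[measurable]: "proj \<theta> -` A \<in> sets borel" using measurable_sets[OF proj_borel A] by simp
    have "emeasure (distr (density ?H (indicator Q)) ?N (proj \<theta>)) A = emeasure (density ?H (indicator Q)) (proj \<theta> -` A)"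
      by (subst emeasure_distr) (auto simp: measurable_cong_sets[OF sets_hausdorff_measure refl])
    also have "\<dots> = emeasure ?H (Q \<inter> proj \<theta> -` A)"
      by (subst emeasure_density) (auto simp: indicator_inter_arith[symmetric])
    also have "\<dots> = emeasure (restrict_space ?H Q) (proj \<theta> -` A \<inter> Q)"
      by (subst emeasure_restrict_space) (auto simp: Int_commute)
    also have "\<dots> = emeasure (distr (restrict_space ?H Q) ?N (proj \<theta>)) A"
      by (subst emeasure_distr) (auto simp: space_restrict_space measurable_cong_sets[OF sets_hausdorff_measure refl] intro!: measurable_restrict_space1)
    finally show "emeasure (distr (density ?H (indicator Q)) ?N (proj \<theta>)) A = emeasure (distr (restrict_space ?H Q) ?N (proj \<theta>)) A" .
  qed simp
  finally show ?thesis by simp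
qed

lemma liminf_correlation_bounded:
  assumes \<nu>: "sets \<nu> = sets borel" "finite_measure \<nu>"
    and lim: "liminf (\<lambda>n. correlation \<nu> (1 / real (Suc n))) < \<infinity>"
  shows "\<exists>M. bounded_correlation \<nu> M"
proof -
  let ?c = "\<lambda>n. correlation \<nu> (1 / real (Suc n))"
  obtain m where m: "liminf ?c = ennreal m" "0 \<le> m" using lim by (cases "liminf ?c") auto
  \<comment> \<open>The lower limit m itself may be approached from above, whereas m + 1 is undercut
    at arbitrarily small radii.\<close>
  have "bounded_correlation \<nu> (m + 1)"
  proof (rule bounded_correlation.intro)
    fix \<epsilon> :: real assume \<epsilon>: "0 < \<epsilon>"
    show "\<exists>r. 0 < r \<and> r < \<epsilon> \<and> correlation \<nu> r \<le> ennreal (m + 1)"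
    proof (rule ccontr)
      assume neg: "\<not> ?thesis"
      obtain n0 where n0: "1 / real (Suc n0) < \<epsilon>" using nat_approx_posE[OF \<epsilon>] by blast
      have "ennreal (m + 1) \<le> ?c n" if n: "n0 \<le> n" for n
      proof -
        have "1 / real (Suc n) \<le> 1 / real (Suc n0)" using n by (intro divide_left_mono) auto
        then have "1 / real (Suc n) < \<epsilon>" using n0 by simp
        moreover have "0 < 1 / real (Suc n)" by simp
        ultimately show ?thesis using neg by (meson le_cases)
      qed
      then have "ennreal (m + 1) \<le> liminf ?c"
        by (intro Liminf_bounded eventually_sequentiallyI[of n0])
      then have "m + 1 \<le> m" unfolding m(1) ennreal_le_iff[OF m(2)] .
      then show False by simp
    qed
  next
    show "0 \<le> m + 1" using m(2) by simp
  qed (fact \<nu>)+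
  then show ?thesis ..
qed

lemma line_density_square_integrable:
  assumes "bounded_correlation \<nu> M"
    and P: "P = distr \<nu> (restrict_space borel (line \<theta>)) (\<lambda>t. t *\<^sub>R dir_vec \<theta>)"
  shows "absolutely_continuous (lebesgue_line \<theta>) P \<and> square_integrable (lebesgue_line \<theta>) (RN_deriv (lebesgue_line \<theta>) P)"
proof -
  interpret bounded_correlation \<nu> M by fact
  let ?N = "restrict_space borel (line \<theta>)" and ?j = "\<lambda>t. t *\<^sub>R dir_vec \<theta>" and ?L = "lebesgue_line \<theta>"
  have j\<nu>: "?j \<in> measurable \<nu> ?N" and jl: "?j \<in> measurable lborel ?N"
    using scaleR_dir_vec_measurable by (simp_all add: measurable_cong_sets[OF sets_\<nu> refl])
  have ac: "absolutely_continuous ?L P"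
    unfolding absolutely_continuous_def
  proof
    fix A assume "A \<in> null_sets ?L"
    then have A: "?j -` A \<inter> space lborel \<in> null_sets lborel" "A \<in> sets ?N"
      unfolding lebesgue_line_def null_sets_distr_iff[OF jl] by auto
    then show "A \<in> null_sets P"
      using null_sets_lborel_imp_null[OF A(1)] measurable_sets[OF j\<nu> A(2)]
      unfolding P null_sets_distr_iff[OF j\<nu>] by (auto simp: space_\<nu> null_sets_def)
  qed
  interpret L: sigma_finite_measure ?L by (rule sigma_finite_lebesgue_line)
  let ?R = "RN_deriv ?L P"
  have R: "?R \<in> borel_measurable ?N" using borel_measurable_RN_deriv[of ?L P] by (simp add: lebesgue_line_def)
  have dens: "density ?L ?R = P" by (rule L.density_RN_deriv[OF ac]) (simp add: P lebesgue_line_def)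
  \<comment> \<open>The derivative read in the coordinate of the line.
    \<open>distr_line_inverse\<close> shows that it is a density of \<nu>, and the change of
    variables preserves the integral of its square.\<close>
  define \<phi> where "\<phi> t = ?R (?j t)" for t
  have \<phi>: "\<phi> \<in> borel_measurable borel" unfolding \<phi>_def using measurable_compose[OF scaleR_dir_vec_measurable R] .
  have "distr (density lborel \<phi>) ?N ?j = distr \<nu> ?N ?j"
    using dens density_distr[OF R jl] unfolding P lebesgue_line_def \<phi>_def by simp
  then have "distr (distr (density lborel \<phi>) ?N ?j) borel (\<lambda>y. y \<bullet> dir_vec \<theta>) = distr (distr \<nu> ?N ?j) borel (\<lambda>y. y \<bullet> dir_vec \<theta>)"
    by (rule arg_cong)
  moreover have "distr (distr (density lborel \<phi>) ?N ?j) borel (\<lambda>y. y \<bullet> dir_vec \<theta>) = density lborel \<phi>"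
    by (rule distr_line_inverse) simp
  ultimately have "density lborel \<phi> = \<nu>" using distr_line_inverse[OF sets_\<nu>, of \<theta>] by metis
  then have "(\<integral>\<^sup>+ t. (\<phi> t)\<^sup>2 \<partial>lborel) \<le> ennreal (4 * M)" by (rule density_square_integrable[OF \<phi>])
  moreover have "(\<integral>\<^sup>+ x. (?R x)\<^sup>2 \<partial>?L) = (\<integral>\<^sup>+ t. (\<phi> t)\<^sup>2 \<partial>lborel)"
  proof -
    have "(\<integral>\<^sup>+ x. f x \<partial>?L) = (\<integral>\<^sup>+ t. f (?j t) \<partial>lborel)" if "f \<in> borel_measurable ?N" for f
      unfolding lebesgue_line_def using that by (intro nn_integral_distr[OF jl]) simp
    then show ?thesis unfolding \<phi>_def using borel_measurable_power_ennreal[OF R] by blast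
  qed
  ultimately have "(\<integral>\<^sup>+ x. (?R x)\<^sup>2 \<partial>?L) < \<infinity>" by (auto intro: le_less_trans)
  then show ?thesis using ac by (auto simp: square_integrable_def)
qed

theorem theorem1p2:
  fixes K1 K2 :: "real set" and \<alpha> d :: real
  assumes "\<alpha> > 0"
    and "regular_cantor_set \<alpha> K1"
    and "regular_cantor_set \<alpha> K2"
    and "d = hausdorff_dim K1 + hausdorff_dim K2"
    and "d > 1"
  shows "AE \<theta> in lborel.
           absolutely_continuous (lebesgue_line \<theta>) (proj_measure d (K1 \<times> K2) \<theta>) \<and>
           square_integrable (lebesgue_line \<theta>)
             (RN_deriv (lebesgue_line \<theta>) (proj_measure d (K1 \<times> K2) \<theta>))"
proof -
  note K1 = regular_cantor_set_homogeneous[OF assms(1,2)] and K2 = regular_cantor_set_homogeneous[OF assms(1,3)]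
  let ?\<mu> = "density (hausdorff_measure d) (indicator (K1 \<times> K2)) :: (real \<times> real) measure"
  obtain C1 C2 where h: "homogeneous C1 (hausdorff_dim K1) K1" "homogeneous C2 (hausdorff_dim K2) K2"
    using K1(3) K2(3) by blast
  obtain C where C: "0 \<le> C" "frostman C d ?\<mu>"
    using frostman_product[OF h assms(4)[symmetric] _ K1(1) K2(1)] \<open>d > 1\<close> by auto
  have Q: "K1 \<times> K2 \<in> sets borel" using K1(1) K2(1) by (intro borel_compact compact_Times)
  show ?thesis
    using AE_liminf_correlation[OF C(2) \<open>d > 1\<close> C(1)]
  proof eventually_elim
    case (elim \<theta>)
    have "finite_measure (distr ?\<mu> borel (\<lambda>x. x \<bullet> dir_vec \<theta>))"
      using C(2) by (intro finite_measure.finite_measure_distr) (auto simp: frostman_def measurable_cong_sets[of ?\<mu> borel])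
    then obtain M where M: "bounded_correlation (distr ?\<mu> borel (\<lambda>x. x \<bullet> dir_vec \<theta>)) M"
      using liminf_correlation_bounded[OF _ _ elim] by auto
    show ?case by (rule line_density_square_integrable[OF M proj_measure_eq_distr[OF Q]])
  qed
qed

end
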